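(* Let $L,H>0$, $D=\mathbb T_L\times(0,H)$, and $1<p<\infty$. Consider the steady/traveling flow in $D$ with stream function $$\bar\psi(x_1,x_2)=a\cos\left(\frac{2\pi x_1}{L}\right)\sin\left(\frac{\pi x_2}{H}\right)+b\sin\left(\frac{2\pi x_1}{L}\right)\sin\left(\frac{\pi x_2}{H}\right)+cx_2+d,\qquad a,b,c,d\in\mathbb R,$$ and let $\bar\omega:=-\Delta\bar\psi$. If $H/L\le\sqrt3/2$, then the flow is orbitally stable in the following sense: for any $\varepsilon>0$ there exists $\delta>0$ such that for any sufficiently smooth Euler flow in $D$ with vorticity $\omega(t,\mathbf x)$, $$\|\omega(0,\cdot)-\bar\omega\|_{L^p(D)}<\delta\quad\Longrightarrow\quad\min_{v\in\mathcal O_{\bar\omega}}\|\omega(t,\cdot)-v\|_{L^p(D)}<\varepsilon\quad\forall\,t\in\mathbb R,$$ where $\mathcal O_{\bar\omega}:=\{v:D\to\mathbb R\mid v(x_1,x_2)=\bar\omega(x_1+\alpha,x_2),\ \alpha\in\mathbb R\}$.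
   Context: $\mathbb T_L=\mathbb R/L\mathbb Z$, $D=\mathbb T_L\times(0,H)$ is a periodic channel with coordinates $\mathbf x=(x_1,x_2)$, $\bar D=\mathbb T_L\times[0,H]$. Euler flow: a solution, defined for all $t\in\mathbb R$, of $\partial_t\mathbf v+(\mathbf v\cdot\nabla)\mathbf v=-\nabla P$, $\nabla\cdot\mathbf v=0$ in $D$, with $v_2=0$ on $\{x_2=0\}\cup\{x_2=H\}$, where $\mathbf v=(v_1,v_2)$ and $P$ are functions on $\mathbb R\times D$ (so periodic in $x_1$). "Sufficiently smooth" means a classical solution, e.g. $\mathbf v\in C^2(\mathbb R\times\bar D)$, $P\in C^1(\mathbb R\times\bar D)$. Its vorticity is $\omega=\partial_{x_1}v_2-\partial_{x_2}v_1$. The steady/traveling flow with stream function $\bar\psi$ as in the claim is the Euler flow with velocity $\nabla^\perp\psi$, $\nabla^\perp=(\partial_{x_2},-\partial_{x_1})$, $\psi(t,x_1,x_2)=\bar\psi(x_1-ct,x_2)$. *)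

theory Defs
  imports "HOL-Analysis.Analysis"
begin

(* Functions on the torus T_L = R / L Z are represented by L-periodic functions of x1 in R.
   Points of the channel are pairs (x1, x2) with 0 < x2 < H; D is integrated over the
   fundamental domain [0,L) x (0,H). *)

definition channel :: "real \<Rightarrow> (real \<times> real) set" where
  "channel H = UNIV \<times> {0<..<H}"

definition closed_channel :: "real \<Rightarrow> (real \<times> real) set" where
  "closed_channel H = UNIV \<times> {0..H}"

definition cell :: "real \<Rightarrow> real \<Rightarrow> (real \<times> real) set" where
  "cell L H = {0..<L} \<times> {0<..<H}"

definition x1_periodic_on :: "real \<Rightarrow> real \<Rightarrow> (real \<times> real \<Rightarrow> 'a) \<Rightarrow> bool" where
  "x1_periodic_on L H f \<longleftrightarrow>
     (\<forall>x1 x2. (x1, x2) \<in> closed_channel H \<longrightarrow> f (x1 + L, x2) = f (x1, x2))"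

definition pd1 :: "(real \<times> real \<Rightarrow> 'a::real_normed_vector) \<Rightarrow> real \<times> real \<Rightarrow> 'a" where
  "pd1 f x = vector_derivative (\<lambda>s. f (s, snd x)) (at (fst x))"

definition pd2 :: "(real \<times> real \<Rightarrow> 'a::real_normed_vector) \<Rightarrow> real \<times> real \<Rightarrow> 'a" where
  "pd2 f x = vector_derivative (\<lambda>s. f (fst x, s)) (at (snd x))"

definition laplacian :: "(real \<times> real \<Rightarrow> real) \<Rightarrow> real \<times> real \<Rightarrow> real" where
  "laplacian f x = pd1 (pd1 f) x + pd2 (pd2 f) x"

(* C^1 and C^2 up to the boundary: derivatives are taken within S. They are unique on the
   sets used here, which are convex with nonempty interior. *)

definition C1_on :: "'a::real_normed_vector set \<Rightarrow> ('a \<Rightarrow> 'b::real_normed_vector) \<Rightarrow> bool" where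
  "C1_on S f \<longleftrightarrow>
     (\<exists>f' :: 'a \<Rightarrow> 'a \<Rightarrow>\<^sub>L 'b.
        (\<forall>x\<in>S. (f has_derivative blinfun_apply (f' x)) (at x within S)) \<and> continuous_on S f')"

definition C2_on :: "'a::real_normed_vector set \<Rightarrow> ('a \<Rightarrow> 'b::real_normed_vector) \<Rightarrow> bool" where
  "C2_on S f \<longleftrightarrow>
     (\<exists>f' :: 'a \<Rightarrow> 'a \<Rightarrow>\<^sub>L 'b.
        (\<forall>x\<in>S. (f has_derivative blinfun_apply (f' x)) (at x within S)) \<and> C1_on S f')"

(* Sufficiently smooth Euler flow: v and P are classical, global in time, L-periodic in x1,
   with v in C^2 and P in C^1 up to the boundary. *)

definition euler_flow ::
  "real \<Rightarrow> real \<Rightarrow> (real \<Rightarrow> real \<times> real \<Rightarrow> real \<times> real) \<Rightarrow> (real \<Rightarrow> real \<times> real \<Rightarrow> real) \<Rightarrow> bool"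
where
  "euler_flow L H v P \<longleftrightarrow>
     C2_on (UNIV \<times> closed_channel H) (\<lambda>(t, x). v t x) \<and>
     C1_on (UNIV \<times> closed_channel H) (\<lambda>(t, x). P t x) \<and>
     (\<forall>t. x1_periodic_on L H (v t) \<and> x1_periodic_on L H (P t)) \<and>
     (\<forall>t. \<forall>x\<in>channel H.
        vector_derivative (\<lambda>s. v s x) (at t)
          + fst (v t x) *\<^sub>R pd1 (v t) x + snd (v t x) *\<^sub>R pd2 (v t) x
          = - (pd1 (P t) x, pd2 (P t) x)) \<and>
     (\<forall>t. \<forall>x\<in>channel H. pd1 (\<lambda>y. fst (v t y)) x + pd2 (\<lambda>y. snd (v t y)) x = 0) \<and>
     (\<forall>t x1. snd (v t (x1, 0)) = 0 \<and> snd (v t (x1, H)) = 0)"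

definition vorticity :: "(real \<times> real \<Rightarrow> real \<times> real) \<Rightarrow> real \<times> real \<Rightarrow> real" where
  "vorticity u x = pd1 (\<lambda>y. snd (u y)) x - pd2 (\<lambda>y. fst (u y)) x"

(* The Bochner integral is 0 for non-integrable functions; this value is not reached for
   vorticities of Euler flows as above, which are continuous and bounded on D. *)

definition Lp_norm :: "real \<Rightarrow> real \<Rightarrow> real \<Rightarrow> (real \<times> real \<Rightarrow> real) \<Rightarrow> real" where
  "Lp_norm L H p f = (LINT x:cell L H|lborel. \<bar>f x\<bar> powr p) powr (1 / p)"

definition psi_bar ::
  "real \<Rightarrow> real \<Rightarrow> real \<Rightarrow> real \<Rightarrow> real \<Rightarrow> real \<Rightarrow> real \<times> real \<Rightarrow> real"
where
  "psi_bar L H a b c d = (\<lambda>(x1, x2).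
     a * cos (2 * pi * x1 / L) * sin (pi * x2 / H)
     + b * sin (2 * pi * x1 / L) * sin (pi * x2 / H) + c * x2 + d)"

definition omega_bar ::
  "real \<Rightarrow> real \<Rightarrow> real \<Rightarrow> real \<Rightarrow> real \<Rightarrow> real \<Rightarrow> real \<times> real \<Rightarrow> real"
where
  "omega_bar L H a b c d x = - laplacian (psi_bar L H a b c d) x"

definition orbit :: "(real \<times> real \<Rightarrow> real) \<Rightarrow> (real \<times> real \<Rightarrow> real) set" where
  "orbit w = {v. \<exists>\<alpha>. v = (\<lambda>(x1, x2). w (x1 + \<alpha>, x2))}"

end

(* The vorticity is transported, so all integrals of functions of it are conserved, and so are the energy,
   the mean velocity and the impulse. In the frame of zero mean velocity the stream function \<psi> vanishes
   on both walls, the energy E is the integral of \<psi> times the vorticity \<omega>, and for H / L <= sqrt 3 / 2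
   the Poincare inequality, applied to \<psi> minus its mean, has the best constant
   \<lambda> = (2 pi / L)^2 + (pi / H)^2. Hence the integral of \<omega>^2 minus \<lambda> E bounds the distance of \<omega> to the
   null space of the second variation, which is spanned by the waves cos (2 pi x1 / L) sin (pi x2 / H) and
   sin (2 pi x1 / L) sin (pi x2 / H) and, in the borderline case, by cos (2 pi x2 / H) and sin (2 pi x2 / H).
   The impulse removes the last mode, the second, third and fourth moments of \<omega> remove the third one and
   fix the amplitude, which leaves only the phase. Since closeness holds only in L^p, this is applied to
   the vorticity truncated at the maximum of the wave. The remainder stays small in L^p and pairs with
   \<psi> by the embedding of the energy space into every L^q. *)

theory Submission
  imports Defs
begin

text \<open>The constant sqrt 3 / 2 comes from comparing \<lambda> with (2 pi / H)^2: the x1-average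
  of the stream function, once its mean over the cell is subtracted, need not vanish on the walls
  and is merely periodic in x2, so it has this lowest eigenvalue. The second moment fixes only (a^2
  + b^2) / 4 + c^2 / 2, where c is the coefficient of cos (2 pi x2 / H). The third moment forces
  (a^2 + b^2) c to zero, which leaves either the wave or the cosine mode alone. The fourth separates
  them: per unit area and at second moment A^2 / 4 it is 9 A^4 / 64 for the wave and 6 A^4 / 64 for
  the cosine mode. Truncation is compatible with the dynamics because the truncated vorticity and
  the remainder are continuous functions of the vorticity, so their integrals are conserved as well;
  at time 0, cutting off at a bound of the wave can only move values closer to the wave. Uniformity
  in time comes from an argument by contradiction with arbitrary flows and times; \<delta> is not
  computed.\<close>

subsection \<open>One-dimensional Wirtinger inequalities with remainder\<close>

text \<open>Completing the square with the weight \<open>k tan (k (x - c))\<close>; staying below the critical \<open>k\<close> avoids its poles.\<close>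

lemma wirtinger_tan_weight:
  fixes f f' :: "real \<Rightarrow> real"
  assumes "a \<le> b"
    and df: "\<And>x. x \<in> {a..b} \<Longrightarrow> (f has_real_derivative f' x) (at x within {a..b})"
    and cf': "continuous_on {a..b} f'"
    and small: "\<And>x. x \<in> {a..b} \<Longrightarrow> \<bar>k * (x - c)\<bar> < pi / 2"
  shows "k\<^sup>2 * integral {a..b} (\<lambda>x. (f x)\<^sup>2) \<le> integral {a..b} (\<lambda>x. (f' x)\<^sup>2)
           + (k * tan (k * (b - c)) * (f b)\<^sup>2 - k * tan (k * (a - c)) * (f a)\<^sup>2)"
proof -
  have cf: "continuous_on {a..b} f"
    using df by (meson DERIV_continuous continuous_on_eq_continuous_within)
  let ?q = "\<lambda>x. k * tan (k * (x - c)) * (f x)\<^sup>2"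
  have cosne: "cos (k * (x - c)) \<noteq> 0" if "x \<in> {a..b}" for x
  proof -
    have "- (pi / 2) < k * (x - c)" "k * (x - c) < pi / 2"
      using small[OF that] by linarith+
    from cos_gt_zero_pi[OF this] show ?thesis by simp
  qed
  have sec2: "inverse ((cos (k * (x - c)))\<^sup>2) = 1 + (tan (k * (x - c)))\<^sup>2" if "x \<in> {a..b}" for x
    using tan_sec[OF cosne[OF that]] by (metis power_inverse)
  have dq: "(?q has_vector_derivative
       (k\<^sup>2 * (1 + (tan (k * (x - c)))\<^sup>2) * (f x)\<^sup>2 + 2 * (k * tan (k * (x - c))) * f x * f' x))
         (at x within {a..b})" if x: "x \<in> {a..b}" for x
  proof -
    have "((\<lambda>x. k * (x - c)) has_real_derivative k) (at x within {a..b})"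
      by (auto intro!: derivative_eq_intros)
    from DERIV_chain2[OF DERIV_tan[OF cosne[OF x]] this]
    have t: "((\<lambda>x. tan (k * (x - c))) has_real_derivative (1 + (tan (k * (x - c)))\<^sup>2) * k) (at x within {a..b})"
      unfolding sec2[OF x] .
    have p: "((\<lambda>x. (f x)\<^sup>2) has_real_derivative 2 * f x * f' x) (at x within {a..b})"
      using DERIV_power[OF df[OF x], of 2] by (simp add: mult_ac)
    have "(?q has_real_derivative
       (k * ((1 + (tan (k * (x - c)))\<^sup>2) * k) * (f x)\<^sup>2 + 2 * f x * f' x * (k * tan (k * (x - c)))))
         (at x within {a..b})"
      by (rule DERIV_mult DERIV_cmult t p)+
    then show ?thesis
      unfolding has_real_derivative_iff_has_vector_derivative[symmetric]
      by (simp add: mult_ac power2_eq_square)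
  qed
  have Q: "((\<lambda>x. k\<^sup>2 * (1 + (tan (k * (x - c)))\<^sup>2) * (f x)\<^sup>2
        + 2 * (k * tan (k * (x - c))) * f x * f' x) has_integral (?q b - ?q a)) {a..b}"
    by (intro dq fundamental_theorem_of_calculus[OF \<open>a \<le> b\<close>])
  have i1: "(\<lambda>x. (f x)\<^sup>2) integrable_on {a..b}" and i2: "(\<lambda>x. (f' x)\<^sup>2) integrable_on {a..b}"
    by (intro integrable_continuous_real continuous_intros cf cf')+
  have "((\<lambda>x. (f' x)\<^sup>2 - k\<^sup>2 * (f x)\<^sup>2 + (k\<^sup>2 * (1 + (tan (k * (x - c)))\<^sup>2) * (f x)\<^sup>2
        + 2 * (k * tan (k * (x - c))) * f x * f' x))
      has_integral (integral {a..b} (\<lambda>x. (f' x)\<^sup>2) - k\<^sup>2 * integral {a..b} (\<lambda>x. (f x)\<^sup>2) + (?q b - ?q a))) {a..b}"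
    by (intro has_integral_add has_integral_diff has_integral_mult_right integrable_integral i1 i2 Q)
  moreover have "(\<lambda>x. (f' x)\<^sup>2 - k\<^sup>2 * (f x)\<^sup>2 + (k\<^sup>2 * (1 + (tan (k * (x - c)))\<^sup>2) * (f x)\<^sup>2
        + 2 * (k * tan (k * (x - c))) * f x * f' x)) = (\<lambda>x. (f' x + k * tan (k * (x - c)) * f x)\<^sup>2)"
    by (rule ext) (simp add: power2_eq_square algebra_simps)
  ultimately have "((\<lambda>x. (f' x + k * tan (k * (x - c)) * f x)\<^sup>2)
      has_integral (integral {a..b} (\<lambda>x. (f' x)\<^sup>2) - k\<^sup>2 * integral {a..b} (\<lambda>x. (f x)\<^sup>2) + (?q b - ?q a))) {a..b}"
    by simp
  from has_integral_nonneg[OF this] show ?thesis by simp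
qed

text \<open>The critical wave number is lowered by the factor \<open>sqrt z\<close>, so that the
  argument of the tangent stays away from the poles even at the ends of an interval of length
  \<open>l\<close>. The sharp constant returns as \<open>z\<close> tends to 1.\<close>

lemma sqrt_scaled_lt:
  fixes z l x :: real
  assumes "0 < z" "z < 1" "0 < l" "\<bar>x\<bar> \<le> l / 2"
  shows "\<bar>sqrt z * (pi / l) * x\<bar> < pi / 2"
proof -
  have "\<bar>sqrt z * (pi / l) * x\<bar> = sqrt z * ((pi / l) * \<bar>x\<bar>)"
    using assms by (simp add: abs_mult)
  also have "\<dots> \<le> sqrt z * ((pi / l) * (l / 2))"
    using assms by (intro mult_left_mono) auto
  also have "\<dots> = sqrt z * (pi / 2)" using assms by simp
  also have "\<dots> < 1 * (pi / 2)"
    using assms by (intro mult_strict_right_mono) auto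
  finally show ?thesis by simp
qed

text \<open>By periodicity some value is taken at two points half a period apart. After it is
  subtracted, the function vanishes at the ends of two arcs of length l / 2, and the Dirichlet
  inequality on each arc has the constant (2 pi / l)^2. The subtraction can only increase the
  integral of the square, because the mean is zero.\<close>

lemma wirtinger_mean_zero:
  fixes f f' :: "real \<Rightarrow> real"
  assumes "0 < l"
    and df: "\<And>x. x \<in> {0..l} \<Longrightarrow> (f has_real_derivative f' x) (at x within {0..l})"
    and cf': "continuous_on {0..l} f'"
    and per: "f l = f 0" and mean: "integral {0..l} f = 0"
  shows "(2 * pi / l)\<^sup>2 * integral {0..l} (\<lambda>x. (f x)\<^sup>2) \<le> integral {0..l} (\<lambda>x. (f' x)\<^sup>2)"
proof -
  have cf: "continuous_on {0..l} f"
    using df by (meson DERIV_continuous continuous_on_eq_continuous_within)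
  \<comment> \<open>The difference of \<open>f x\<close> and \<open>f (x + l / 2)\<close> has
    opposite values at 0 and at l / 2, since \<open>f l = f 0\<close>.\<close>
  obtain x0 where x0: "0 \<le> x0" "x0 \<le> l / 2" and eq: "f x0 = f (x0 + l / 2)"
  proof -
    have c: "continuous_on {0..l / 2} (\<lambda>x. f x - f (x + l / 2))"
      by (intro continuous_intros continuous_on_compose2[OF cf]) (use \<open>0 < l\<close> in auto)
    have "\<exists>x\<ge>0. x \<le> l / 2 \<and> f x - f (x + l / 2) = 0"
    proof (cases "f 0 - f (l / 2) \<le> 0")
      case True
      then show ?thesis
        by (intro IVT' c) (use per \<open>0 < l\<close> in auto)
    next
      case False
      then show ?thesis
        by (intro IVT2' c) (use per \<open>0 < l\<close> in auto)
    qed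
    then show ?thesis using that by auto
  qed
  define h where "h = (\<lambda>x. f x - f x0)"
  have dh: "(h has_real_derivative f' x) (at x within S)" if "x \<in> S" "S \<subseteq> {0..l}" for x S
  proof -
    have "(f has_real_derivative f' x) (at x within S)"
      using that by (intro has_field_derivative_subset[OF df]) auto
    then show ?thesis unfolding h_def by (auto intro!: derivative_eq_intros)
  qed
  have ch: "continuous_on {0..l} h" unfolding h_def by (intro continuous_intros cf)
  have i1: "(\<lambda>x. (h x)\<^sup>2) integrable_on {0..l}" and i2: "(\<lambda>x. (f' x)\<^sup>2) integrable_on {0..l}"
    by (intro integrable_continuous_real continuous_intros ch cf')+
  have split: "integral {0..l} g = integral {0..x0} g + integral {x0..x0 + l / 2} g + integral {x0 + l / 2..l} g"
    if "g integrable_on {0..l}" for g :: "real \<Rightarrow> real"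
  proof -
    have "integral {0..x0} g + integral {x0..l} g = integral {0..l} g"
      by (rule Henstock_Kurzweil_Integration.integral_combine) (use x0 that in auto)
    moreover have "g integrable_on {x0..l}"
      by (rule integrable_on_subinterval[OF that]) (use x0 in auto)
    then have "integral {x0..x0 + l / 2} g + integral {x0 + l / 2..l} g = integral {x0..l} g"
      by (intro Henstock_Kurzweil_Integration.integral_combine) (use x0 in auto)
    ultimately show ?thesis by simp
  qed
  have "(2 * pi / l)\<^sup>2 * integral {0..l} (\<lambda>x. (h x)\<^sup>2) \<le> integral {0..l} (\<lambda>x. (f' x)\<^sup>2)"
  proof (rule field_le_mult_one_interval)
    fix z :: real assume z: "0 < z" "z < 1"
    define k where "k = sqrt z * (pi / (l / 2))"
    have k2: "k\<^sup>2 = z * (2 * pi / l)\<^sup>2" using z by (simp add: k_def power_mult_distrib power_divide)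
    have sm: "\<bar>k * y\<bar> < pi / 2" if "- (l / 4) \<le> y" "y \<le> l / 4" for y
      unfolding k_def using that \<open>0 < l\<close> by (intro sqrt_scaled_lt z) auto
    \<comment> \<open>The midpoint of the arc from x0 + l / 2 to x0 + l, which wraps around. Its two
      pieces carry weights centred at \<open>?c - l\<close> and at \<open>?c\<close>, one period
      apart, so that their boundary terms at 0 and at \<open>l\<close> cancel.\<close>
    let ?c = "x0 + 3 * l / 4"
    have b0: "h x0 = 0" "h (x0 + l / 2) = 0" "h l = h 0" using eq per by (auto simp: h_def)
    have I1: "k\<^sup>2 * integral {0..x0} (\<lambda>x. (h x)\<^sup>2) \<le> integral {0..x0} (\<lambda>x. (f' x)\<^sup>2)
        + (k * tan (k * (x0 - (?c - l))) * (h x0)\<^sup>2 - k * tan (k * (0 - (?c - l))) * (h 0)\<^sup>2)"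
      using x0 \<open>0 < l\<close>
      by (intro wirtinger_tan_weight dh sm continuous_on_subset[OF cf']) auto
    have I2: "k\<^sup>2 * integral {x0..x0 + l / 2} (\<lambda>x. (h x)\<^sup>2) \<le> integral {x0..x0 + l / 2} (\<lambda>x. (f' x)\<^sup>2)
        + (k * tan (k * (x0 + l / 2 - (x0 + l / 4))) * (h (x0 + l / 2))\<^sup>2 - k * tan (k * (x0 - (x0 + l / 4))) * (h x0)\<^sup>2)"
      using x0 \<open>0 < l\<close>
      by (intro wirtinger_tan_weight dh sm continuous_on_subset[OF cf']) auto
    have I3: "k\<^sup>2 * integral {x0 + l / 2..l} (\<lambda>x. (h x)\<^sup>2) \<le> integral {x0 + l / 2..l} (\<lambda>x. (f' x)\<^sup>2)
        + (k * tan (k * (l - ?c)) * (h l)\<^sup>2 - k * tan (k * (x0 + l / 2 - ?c)) * (h (x0 + l / 2))\<^sup>2)"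
      using x0 \<open>0 < l\<close>
      by (intro wirtinger_tan_weight dh sm continuous_on_subset[OF cf']) auto
    have "0 - (?c - l) = l - ?c" by simp
    then have "k\<^sup>2 * (integral {0..x0} (\<lambda>x. (h x)\<^sup>2) + integral {x0..x0 + l / 2} (\<lambda>x. (h x)\<^sup>2)
        + integral {x0 + l / 2..l} (\<lambda>x. (h x)\<^sup>2))
      \<le> integral {0..x0} (\<lambda>x. (f' x)\<^sup>2) + integral {x0..x0 + l / 2} (\<lambda>x. (f' x)\<^sup>2)
        + integral {x0 + l / 2..l} (\<lambda>x. (f' x)\<^sup>2)"
      using I1 I2 I3 unfolding b0 by (simp add: distrib_left)
    then show "z * ((2 * pi / l)\<^sup>2 * integral {0..l} (\<lambda>x. (h x)\<^sup>2)) \<le> integral {0..l} (\<lambda>x. (f' x)\<^sup>2)"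
      unfolding split[OF i1, symmetric] split[OF i2, symmetric] k2 by (simp add: mult.assoc)
  qed
  moreover have "integral {0..l} (\<lambda>x. (f x)\<^sup>2) \<le> integral {0..l} (\<lambda>x. (h x)\<^sup>2)"
  proof -
    have "((\<lambda>x. (f x)\<^sup>2 - 2 * f x0 * f x + (f x0)\<^sup>2) has_integral
      (integral {0..l} (\<lambda>x. (f x)\<^sup>2) - 2 * f x0 * integral {0..l} f + (l - 0) *\<^sub>R (f x0)\<^sup>2)) {0..l}"
      by (intro has_integral_add has_integral_diff has_integral_mult_right integrable_integral
          integrable_continuous_real continuous_intros cf) (use has_integral_const_real[of "(f x0)\<^sup>2" 0 l] \<open>0 < l\<close> in simp)
    moreover have "(\<lambda>x. (f x)\<^sup>2 - 2 * f x0 * f x + (f x0)\<^sup>2) = (\<lambda>x. (h x)\<^sup>2)"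
      by (auto simp: h_def power2_eq_square algebra_simps)
    ultimately have "integral {0..l} (\<lambda>x. (h x)\<^sup>2) = integral {0..l} (\<lambda>x. (f x)\<^sup>2) + l * (f x0)\<^sup>2"
      using mean by (simp add: integral_unique)
    then show ?thesis using \<open>0 < l\<close> by simp
  qed
  ultimately show ?thesis
    by (meson mult_left_mono order_trans zero_le_power2)
qed

lemma integral_half_shift:
  fixes g :: "real \<Rightarrow> real"
  assumes "0 \<le> l" "continuous_on {0..l} g"
  shows "integral {0..l} g = integral {0..l / 2} (\<lambda>x. g x + g (x + l / 2))"
proof -
  have i: "g integrable_on {0..l}" using assms by (intro integrable_continuous_real)
  have "integral {0..l / 2} g + integral {l / 2..l} g = integral {0..l} g"
    by (rule Henstock_Kurzweil_Integration.integral_combine) (use assms i in auto)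
  moreover have "integral {0..l / 2} (\<lambda>x. g (x + l / 2)) = integral {l / 2..l} g"
    using integral_shift_cbox_plus[of 0 "l / 2" g "l / 2"] by (simp add: o_def add.commute)
  moreover have "integral {0..l / 2} (\<lambda>x. g x + g (x + l / 2))
      = integral {0..l / 2} g + integral {0..l / 2} (\<lambda>x. g (x + l / 2))"
    by (intro integral_add integrable_continuous_real continuous_on_compose2[OF assms(2)]
        continuous_intros continuous_on_subset[OF assms(2)]) (use assms in auto)
  ultimately show ?thesis by simp
qed

lemma has_real_derivative_subinterval_shift:
  fixes f f' :: "real \<Rightarrow> real"
  assumes "\<And>x. x \<in> {a..b} \<Longrightarrow> (f has_real_derivative f' x) (at x within {a..b})"
    and "x \<in> S" "\<And>y. y \<in> S \<Longrightarrow> y + c \<in> {a..b}"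
  shows "((\<lambda>x. f (x + c)) has_real_derivative f' (x + c)) (at x within S)"
proof -
  have "(f has_real_derivative f' (x + c)) (at (x + c) within (\<lambda>y. y + c) ` S)"
    using assms by (intro has_field_derivative_subset[OF assms(1)]) auto
  moreover have "((\<lambda>y. y + c) has_real_derivative 1) (at x within S)"
    by (auto intro!: derivative_eq_intros)
  ultimately show ?thesis
    using DERIV_image_chain[of f "f' (x + c)" "\<lambda>y. y + c" x S 1] by (simp add: o_def)
qed

lemma rotated_squares:
  fixes u w k S C :: real
  shows "(u * C - k * w * S)\<^sup>2 + (u * S + k * w * C)\<^sup>2 = (u\<^sup>2 + k\<^sup>2 * w\<^sup>2) * (S\<^sup>2 + C\<^sup>2)"
  by (simp add: power2_eq_square algebra_simps)

text \<open>Split \<open>f\<close> into the parts that are even and odd under translation by \<open>l / 2\<close>. The even part has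
  half the period; the odd part acquires it after multiplication with \<open>cos\<close> and \<open>sin\<close>.\<close>

lemma wirtinger_second_eigenvalue:
  fixes f f' :: "real \<Rightarrow> real"
  assumes "0 < l"
    and df: "\<And>x. x \<in> {0..l} \<Longrightarrow> (f has_real_derivative f' x) (at x within {0..l})"
    and cf': "continuous_on {0..l} f'"
    and per: "f l = f 0" and mean: "integral {0..l} f = 0"
    and orth_cos: "integral {0..l} (\<lambda>x. f x * cos (2 * pi / l * x)) = 0"
    and orth_sin: "integral {0..l} (\<lambda>x. f x * sin (2 * pi / l * x)) = 0"
  shows "3 * (2 * pi / l)\<^sup>2 * integral {0..l} (\<lambda>x. (f x)\<^sup>2) \<le> integral {0..l} (\<lambda>x. (f' x)\<^sup>2)"
proof -
  define s where "s = l / 2"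
  define \<kappa> where "\<kappa> = 2 * pi / l"
  have s: "0 < s" "l = 2 * s" "\<kappa> * s = pi" using \<open>0 < l\<close> by (auto simp: s_def \<kappa>_def)
  have cf: "continuous_on {0..l} f"
    using df by (meson DERIV_continuous continuous_on_eq_continuous_within)
  have df0: "(f has_real_derivative f' x) (at x within {0..s})" if "x \<in> {0..s}" for x
    using has_real_derivative_subinterval_shift[OF df that, of 0] s by auto
  have dfs: "((\<lambda>x. f (x + s)) has_real_derivative f' (x + s)) (at x within {0..s})" if "x \<in> {0..s}" for x
    using has_real_derivative_subinterval_shift[OF df that, of s] s by auto
  have cs [continuous_intros]: "continuous_on {0..s} f" "continuous_on {0..s} f'"
     "continuous_on {0..s} (\<lambda>x. f (x + s))" "continuous_on {0..s} (\<lambda>x. f' (x + s))"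
    by (auto intro!: continuous_intros continuous_on_compose2[OF cf] continuous_on_compose2[OF cf']
       simp: s(2) \<open>0 < s\<close>)
  define fe where "fe = (\<lambda>x. (f x + f (x + s)) / 2)"
  define fo where "fo = (\<lambda>x. (f x - f (x + s)) / 2)"
  define fe' where "fe' = (\<lambda>x. (f' x + f' (x + s)) / 2)"
  define fo' where "fo' = (\<lambda>x. (f' x - f' (x + s)) / 2)"
  have ceo [continuous_intros]: "continuous_on {0..s} fe" "continuous_on {0..s} fo"
    "continuous_on {0..s} fe'" "continuous_on {0..s} fo'"
    unfolding fe_def fo_def fe'_def fo'_def by (intro continuous_intros; simp)+
  have dfe: "(fe has_real_derivative fe' x) (at x within {0..s})" if "x \<in> {0..s}" for x
    unfolding fe_def fe'_def by (rule derivative_eq_intros df0[OF that] dfs[OF that] refl | simp)+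
  have dfo: "(fo has_real_derivative fo' x) (at x within {0..s})" if "x \<in> {0..s}" for x
    unfolding fo_def fo'_def by (rule derivative_eq_intros df0[OF that] dfs[OF that] refl | simp)+
  note half = integral_half_shift[OF less_imp_le[OF \<open>0 < l\<close>], folded s_def]
  have shift: "cos (\<kappa> * (x + s)) = - cos (\<kappa> * x)" "sin (\<kappa> * (x + s)) = - sin (\<kappa> * x)" for x
    by (simp_all add: distrib_left s(3))
  have E: "4 * \<kappa>\<^sup>2 * integral {0..s} (\<lambda>x. (fe x)\<^sup>2) \<le> integral {0..s} (\<lambda>x. (fe' x)\<^sup>2)"
  proof -
    have eq: "(\<lambda>x. 2 * fe x) = (\<lambda>x. f x + f (x + s))" by (simp add: fe_def fun_eq_iff field_simps)
    have "integral {0..s} (\<lambda>x. 2 * fe x) = integral {0..l} f"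
      unfolding half[OF cf] eq ..
    then have m0: "integral {0..s} fe = 0" using mean by simp
    have p0: "fe s = fe 0" using per s by (simp add: fe_def)
    have "4 * \<kappa>\<^sup>2 = (2 * pi / s)\<^sup>2" by (simp add: \<kappa>_def s(2) power_divide power_mult_distrib)
    then show ?thesis using wirtinger_mean_zero[OF s(1) dfe ceo(3) p0 m0] by simp
  qed
  \<comment> \<open>Multiplication by cos and sin turns the odd part into two functions of period
    \<open>s\<close>, whose means vanish by the orthogonality assumptions. Their squares add up to
    \<open>fo^2\<close>, the squares of their derivatives to \<open>fo'^2 + \<kappa>^2 fo^2\<close>;
    the extra term leaves 4 - 1 = 3 in the final constant.\<close>
  have O: "4 * \<kappa>\<^sup>2 * integral {0..s} (\<lambda>x. (fo x)\<^sup>2) \<le> integral {0..s} (\<lambda>x. (fo' x)\<^sup>2) + \<kappa>\<^sup>2 * integral {0..s} (\<lambda>x. (fo x)\<^sup>2)"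
  proof -
    let ?h1 = "\<lambda>x. fo x * cos (\<kappa> * x)" and ?h2 = "\<lambda>x. fo x * sin (\<kappa> * x)"
    let ?h1' = "\<lambda>x. fo' x * cos (\<kappa> * x) - \<kappa> * fo x * sin (\<kappa> * x)"
    let ?h2' = "\<lambda>x. fo' x * sin (\<kappa> * x) + \<kappa> * fo x * cos (\<kappa> * x)"
    have d1: "(?h1 has_real_derivative ?h1' x) (at x within {0..s})" if "x \<in> {0..s}" for x
      by (rule derivative_eq_intros dfo[OF that] refl | simp)+
    have d2: "(?h2 has_real_derivative ?h2' x) (at x within {0..s})" if "x \<in> {0..s}" for x
      by (rule derivative_eq_intros dfo[OF that] refl | simp)+
    have c: "continuous_on {0..s} ?h1" "continuous_on {0..s} ?h2" "continuous_on {0..s} ?h1'" "continuous_on {0..s} ?h2'"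
      by (intro continuous_intros)+
    have foS: "fo s = - fo 0" using per s by (simp add: fo_def field_simps)
    have p: "?h1 s = ?h1 0" "?h2 s = ?h2 0" using s(3) foS by simp_all
    have eq1: "(\<lambda>x. 2 * ?h1 x) = (\<lambda>x. f x * cos (\<kappa> * x) + f (x + s) * cos (\<kappa> * (x + s)))"
      unfolding shift by (simp add: fo_def fun_eq_iff field_simps)
    have c1: "continuous_on {0..l} (\<lambda>x. f x * cos (\<kappa> * x))" by (intro continuous_intros cf)
    have "integral {0..s} (\<lambda>x. 2 * ?h1 x) = integral {0..l} (\<lambda>x. f x * cos (\<kappa> * x))"
      unfolding half[OF c1] eq1 ..
    then have m1: "integral {0..s} ?h1 = 0" using orth_cos by (simp add: \<kappa>_def)
    have eq2: "(\<lambda>x. 2 * ?h2 x) = (\<lambda>x. f x * sin (\<kappa> * x) + f (x + s) * sin (\<kappa> * (x + s)))"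
      unfolding shift by (simp add: fo_def fun_eq_iff field_simps)
    have c2: "continuous_on {0..l} (\<lambda>x. f x * sin (\<kappa> * x))" by (intro continuous_intros cf)
    have "integral {0..s} (\<lambda>x. 2 * ?h2 x) = integral {0..l} (\<lambda>x. f x * sin (\<kappa> * x))"
      unfolding half[OF c2] eq2 ..
    then have m2: "integral {0..s} ?h2 = 0" using orth_sin by (simp add: \<kappa>_def)
    have k: "(2 * pi / s)\<^sup>2 = 4 * \<kappa>\<^sup>2" by (simp add: \<kappa>_def s(2) power_divide power_mult_distrib)
    have "4 * \<kappa>\<^sup>2 * (integral {0..s} (\<lambda>x. (?h1 x)\<^sup>2) + integral {0..s} (\<lambda>x. (?h2 x)\<^sup>2))
        \<le> integral {0..s} (\<lambda>x. (?h1' x)\<^sup>2) + integral {0..s} (\<lambda>x. (?h2' x)\<^sup>2)"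
      using wirtinger_mean_zero[OF s(1) d1 c(3) p(1) m1] wirtinger_mean_zero[OF s(1) d2 c(4) p(2) m2]
      unfolding k by (simp add: distrib_left)
    moreover have "integral {0..s} (\<lambda>x. (?h1 x)\<^sup>2) + integral {0..s} (\<lambda>x. (?h2 x)\<^sup>2) = integral {0..s} (\<lambda>x. (fo x)\<^sup>2)"
    proof -
      have "(fo x)\<^sup>2 = (?h1 x)\<^sup>2 + (?h2 x)\<^sup>2" for x
        using sin_cos_squared_add[of "\<kappa> * x"] by (simp add: power_mult_distrib distrib_left[symmetric] add.commute)
      then show ?thesis
        by (simp only:) (intro integral_add[symmetric] integrable_continuous_real continuous_intros)
    qed
    moreover have "integral {0..s} (\<lambda>x. (?h1' x)\<^sup>2) + integral {0..s} (\<lambda>x. (?h2' x)\<^sup>2)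
       = integral {0..s} (\<lambda>x. (fo' x)\<^sup>2) + \<kappa>\<^sup>2 * integral {0..s} (\<lambda>x. (fo x)\<^sup>2)"
    proof -
      have "(?h1' x)\<^sup>2 + (?h2' x)\<^sup>2 = ((fo' x)\<^sup>2 + \<kappa>\<^sup>2 * (fo x)\<^sup>2) * ((sin (\<kappa> * x))\<^sup>2 + (cos (\<kappa> * x))\<^sup>2)" for x
        by (rule rotated_squares)
      then have "(?h1' x)\<^sup>2 + (?h2' x)\<^sup>2 = (fo' x)\<^sup>2 + \<kappa>\<^sup>2 * (fo x)\<^sup>2" for x by simp
      then have "integral {0..s} (\<lambda>x. (?h1' x)\<^sup>2 + (?h2' x)\<^sup>2) = integral {0..s} (\<lambda>x. (fo' x)\<^sup>2 + \<kappa>\<^sup>2 * (fo x)\<^sup>2)"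
        by simp
      moreover have "integral {0..s} (\<lambda>x. (?h1' x)\<^sup>2 + (?h2' x)\<^sup>2) = integral {0..s} (\<lambda>x. (?h1' x)\<^sup>2) + integral {0..s} (\<lambda>x. (?h2' x)\<^sup>2)"
        by (intro integral_add integrable_continuous_real continuous_intros)
      moreover have "integral {0..s} (\<lambda>x. (fo' x)\<^sup>2 + \<kappa>\<^sup>2 * (fo x)\<^sup>2) = integral {0..s} (\<lambda>x. (fo' x)\<^sup>2) + integral {0..s} (\<lambda>x. \<kappa>\<^sup>2 * (fo x)\<^sup>2)"
        by (intro integral_add integrable_continuous_real continuous_intros)
      ultimately show ?thesis by simp
    qed
    ultimately show ?thesis by simp
  qed
  have sum: "integral {0..l} (\<lambda>x. (g x)\<^sup>2) = 2 * (integral {0..s} (\<lambda>x. ((g x + g (x + s)) / 2)\<^sup>2) + integral {0..s} (\<lambda>x. ((g x - g (x + s)) / 2)\<^sup>2))"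
    if c: "continuous_on {0..l} g" for g :: "real \<Rightarrow> real"
  proof -
    have cc [continuous_intros]: "continuous_on {0..s} g" "continuous_on {0..s} (\<lambda>x. g (x + s))"
      using \<open>0 < s\<close> by (auto intro!: continuous_intros continuous_on_compose2[OF c] simp: s(2))
    have "integral {0..l} (\<lambda>x. (g x)\<^sup>2) = integral {0..s} (\<lambda>x. (g x)\<^sup>2 + (g (x + s))\<^sup>2)"
      by (rule half) (intro continuous_intros c)
    also have "\<dots> = integral {0..s} (\<lambda>x. 2 * (((g x + g (x + s)) / 2)\<^sup>2 + ((g x - g (x + s)) / 2)\<^sup>2))"
      by (rule integral_cong) (simp add: power2_eq_square field_simps)
    also have "\<dots> = 2 * integral {0..s} (\<lambda>x. ((g x + g (x + s)) / 2)\<^sup>2 + ((g x - g (x + s)) / 2)\<^sup>2)"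
      by (rule integral_mult_right)
    also have "integral {0..s} (\<lambda>x. ((g x + g (x + s)) / 2)\<^sup>2 + ((g x - g (x + s)) / 2)\<^sup>2)
      = integral {0..s} (\<lambda>x. ((g x + g (x + s)) / 2)\<^sup>2) + integral {0..s} (\<lambda>x. ((g x - g (x + s)) / 2)\<^sup>2)"
      by (intro integral_add integrable_continuous_real continuous_intros) auto
    finally show ?thesis .
  qed
  have "0 \<le> \<kappa>\<^sup>2 * integral {0..s} (\<lambda>x. (fe x)\<^sup>2)"
    by (intro mult_nonneg_nonneg integral_nonneg integrable_continuous_real continuous_intros) auto
  then have "3 * \<kappa>\<^sup>2 * integral {0..s} (\<lambda>x. (fe x)\<^sup>2) \<le> integral {0..s} (\<lambda>x. (fe' x)\<^sup>2)" using E by simp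
  moreover have "3 * \<kappa>\<^sup>2 * integral {0..s} (\<lambda>x. (fo x)\<^sup>2) \<le> integral {0..s} (\<lambda>x. (fo' x)\<^sup>2)" using O by simp
  ultimately have "3 * \<kappa>\<^sup>2 * (2 * (integral {0..s} (\<lambda>x. (fe x)\<^sup>2) + integral {0..s} (\<lambda>x. (fo x)\<^sup>2)))
      \<le> 2 * (integral {0..s} (\<lambda>x. (fe' x)\<^sup>2) + integral {0..s} (\<lambda>x. (fo' x)\<^sup>2))"
    by (simp add: distrib_left)
  then show ?thesis
    unfolding sum[OF cf] sum[OF cf'] fe_def fo_def fe'_def fo'_def \<kappa>_def .
qed

text \<open>Write f = m + T + R with T the first harmonics of f. T gives equality in the Wirtinger
  inequality, R satisfies it with the constant \<open>3 * \<kappa>^2\<close>, and the surplus of R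
  over \<open>\<kappa>^2\<close> is the factor 2 in front of the remainder.\<close>

lemma wirtinger_periodic_remainder:
  fixes f f' :: "real \<Rightarrow> real"
  assumes "0 < l"
    and df: "\<And>x. x \<in> {0..l} \<Longrightarrow> (f has_real_derivative f' x) (at x within {0..l})"
    and cf': "continuous_on {0..l} f'"
    and per: "f l = f 0"
  defines "\<kappa> \<equiv> 2 * pi / l"
  defines "m \<equiv> integral {0..l} f / l"
  defines "A \<equiv> 2 / l * integral {0..l} (\<lambda>x. f x * cos (\<kappa> * x))"
  defines "B \<equiv> 2 / l * integral {0..l} (\<lambda>x. f x * sin (\<kappa> * x))"
  shows "\<kappa>\<^sup>2 * integral {0..l} (\<lambda>x. (f x - m)\<^sup>2)
      + 2 * \<kappa>\<^sup>2 * integral {0..l} (\<lambda>x. (f x - m - (A * cos (\<kappa> * x) + B * sin (\<kappa> * x)))\<^sup>2)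
      \<le> integral {0..l} (\<lambda>x. (f' x)\<^sup>2)"
proof -
  have \<kappa>: "\<kappa> \<noteq> 0" "\<kappa> * l = 2 * pi" using \<open>0 < l\<close> by (auto simp: \<kappa>_def)
  have cf [continuous_intros]: "continuous_on {0..l} f"
    using df by (meson DERIV_continuous continuous_on_eq_continuous_within)
  note cf' [continuous_intros]
  define T where "T = (\<lambda>x. A * cos (\<kappa> * x) + B * sin (\<kappa> * x))"
  define T' where "T' = (\<lambda>x. \<kappa> * (B * cos (\<kappa> * x) - A * sin (\<kappa> * x)))"
  define R where "R = (\<lambda>x. f x - m - T x)"
  define R' where "R' = (\<lambda>x. f' x - T' x)"
  have dT: "(T has_real_derivative T' x) (at x within {0..l})" for x
    unfolding T_def T'_def by (auto intro!: derivative_eq_intros simp: algebra_simps)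
  have dT': "(T' has_real_derivative - \<kappa>\<^sup>2 * T x) (at x within {0..l})" for x
    unfolding T_def T'_def by (auto intro!: derivative_eq_intros simp: algebra_simps power2_eq_square)
  have dR: "(R has_real_derivative R' x) (at x within {0..l})" if "x \<in> {0..l}" for x
    unfolding R_def R'_def by (auto intro!: derivative_eq_intros df[OF that] dT)
  have cT [continuous_intros]: "continuous_on {0..l} T" "continuous_on {0..l} T'"
    unfolding T_def T'_def by (intro continuous_intros)+
  have cR [continuous_intros]: "continuous_on {0..l} R" "continuous_on {0..l} R'"
    unfolding R_def R'_def by (intro continuous_intros)+
  have Tper: "T l = T 0" "T' l = T' 0" unfolding T_def T'_def \<kappa>(2) by simp_all
  have Rper: "R l = R 0" using per Tper by (simp add: R_def)
  have ftc: "integral {0..l} g' = g l - g 0"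
    if "\<And>x. (g has_real_derivative g' x) (at x within {0..l})" for g g' :: "real \<Rightarrow> real"
    using fundamental_theorem_of_calculus[of 0 l g g'] that \<open>0 < l\<close>
    by (simp add: has_real_derivative_iff_has_vector_derivative integral_unique)
  have i_cos: "integral {0..l} (\<lambda>x. cos (\<kappa> * x)) = 0"
  proof -
    have "integral {0..l} (\<lambda>x. cos (\<kappa> * x)) = sin (\<kappa> * l) / \<kappa> - sin (\<kappa> * 0) / \<kappa>"
      using \<kappa> by (intro ftc) (auto intro!: derivative_eq_intros)
    then show ?thesis unfolding \<kappa>(2) by simp
  qed
  have i_sin: "integral {0..l} (\<lambda>x. sin (\<kappa> * x)) = 0"
  proof -
    have "integral {0..l} (\<lambda>x. sin (\<kappa> * x)) = - cos (\<kappa> * l) / \<kappa> - - cos (\<kappa> * 0) / \<kappa>"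
      using \<kappa> by (intro ftc) (auto intro!: derivative_eq_intros)
    then show ?thesis unfolding \<kappa>(2) by simp
  qed
  have i_sc: "integral {0..l} (\<lambda>x. sin (\<kappa> * x) * cos (\<kappa> * x)) = 0"
  proof -
    have "integral {0..l} (\<lambda>x. sin (\<kappa> * x) * cos (\<kappa> * x)) = (sin (\<kappa> * l))\<^sup>2 / (2 * \<kappa>) - (sin (\<kappa> * 0))\<^sup>2 / (2 * \<kappa>)"
      using \<kappa> by (intro ftc) (auto intro!: derivative_eq_intros)
    then show ?thesis unfolding \<kappa>(2) by simp
  qed
  have i_cs: "integral {0..l} (\<lambda>x. cos (\<kappa> * x) * sin (\<kappa> * x)) = 0"
    using i_sc by (simp add: mult.commute)
  have cos_cos: "cos y * cos y = 1 - sin y * sin y" for y :: real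
    by (simp add: cos_squared_eq flip: power2_eq_square)
  have i_cc: "integral {0..l} (\<lambda>x. cos (\<kappa> * x) * cos (\<kappa> * x)) = l / 2"
  proof -
    have "integral {0..l} (\<lambda>x. cos (\<kappa> * x) * cos (\<kappa> * x))
       = (l / 2 + sin (\<kappa> * l) * cos (\<kappa> * l) / (2 * \<kappa>)) - (0 / 2 + sin (\<kappa> * 0) * cos (\<kappa> * 0) / (2 * \<kappa>))"
      using \<kappa> by (intro ftc) (auto intro!: derivative_eq_intros simp: field_simps power2_eq_square cos_cos)
    then show ?thesis unfolding \<kappa>(2) by simp
  qed
  have i_ss: "integral {0..l} (\<lambda>x. sin (\<kappa> * x) * sin (\<kappa> * x)) = l / 2"
  proof -
    have "integral {0..l} (\<lambda>x. sin (\<kappa> * x) * sin (\<kappa> * x))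
       = (l / 2 - sin (\<kappa> * l) * cos (\<kappa> * l) / (2 * \<kappa>)) - (0 / 2 - sin (\<kappa> * 0) * cos (\<kappa> * 0) / (2 * \<kappa>))"
      using \<kappa> by (intro ftc) (auto intro!: derivative_eq_intros simp: field_simps power2_eq_square cos_cos)
    then show ?thesis unfolding \<kappa>(2) by simp
  qed
  have R_int: "integral {0..l} (\<lambda>x. R x * w x) = integral {0..l} (\<lambda>x. f x * w x) - m * integral {0..l} w
      - A * integral {0..l} (\<lambda>x. cos (\<kappa> * x) * w x) - B * integral {0..l} (\<lambda>x. sin (\<kappa> * x) * w x)"
    if [continuous_intros]: "continuous_on {0..l} w" for w :: "real \<Rightarrow> real"
  proof -
    have "((\<lambda>x. f x * w x - m * w x - A * (cos (\<kappa> * x) * w x) - B * (sin (\<kappa> * x) * w x)) has_integral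
       integral {0..l} (\<lambda>x. f x * w x) - m * integral {0..l} w
      - A * integral {0..l} (\<lambda>x. cos (\<kappa> * x) * w x) - B * integral {0..l} (\<lambda>x. sin (\<kappa> * x) * w x)) {0..l}"
      by (intro has_integral_diff has_integral_mult_right integrable_integral integrable_continuous_real continuous_intros)
    then show ?thesis by (simp add: R_def T_def algebra_simps integral_unique)
  qed
  have R0: "integral {0..l} R = 0"
    using R_int[of "\<lambda>x. 1"] \<open>0 < l\<close> by (simp add: i_cos i_sin m_def)
  have R1: "integral {0..l} (\<lambda>x. R x * cos (\<kappa> * x)) = 0"
    using R_int[of "\<lambda>x. cos (\<kappa> * x)"] \<open>0 < l\<close>
    by (simp add: i_cos i_cc i_sc A_def continuous_intros)
  have R2: "integral {0..l} (\<lambda>x. R x * sin (\<kappa> * x)) = 0"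
    using R_int[of "\<lambda>x. sin (\<kappa> * x)"] \<open>0 < l\<close>
    by (simp add: i_sin i_ss i_cs B_def continuous_intros)
  have gap: "3 * \<kappa>\<^sup>2 * integral {0..l} (\<lambda>x. (R x)\<^sup>2) \<le> integral {0..l} (\<lambda>x. (R' x)\<^sup>2)"
    using wirtinger_second_eigenvalue[OF \<open>0 < l\<close> dR cR(2) Rper R0] R1 R2 by (simp add: \<kappa>_def)
  \<comment> \<open>By periodicity the integral of this derivative vanishes. Hence the integral of 2
    R' T' + T'^2 equals \<open>\<kappa>^2\<close> times that of 2 R T + T^2, which settles the cross
    terms and the part of T at once.\<close>
  have d: "((\<lambda>x. (2 * R x + T x) * T' x) has_real_derivative
      (2 * R' x + T' x) * T' x + (2 * R x + T x) * (- \<kappa>\<^sup>2 * T x)) (at x within {0..l})" if "x \<in> {0..l}" for x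
    by (auto intro!: derivative_eq_intros dR[OF that] dT dT')
  have Z: "((\<lambda>x. (2 * R' x + T' x) * T' x + (2 * R x + T x) * (- \<kappa>\<^sup>2 * T x)) has_integral 0) {0..l}"
    using fundamental_theorem_of_calculus[of 0 l "\<lambda>x. (2 * R x + T x) * T' x"
        "\<lambda>x. (2 * R' x + T' x) * T' x + (2 * R x + T x) * (- \<kappa>\<^sup>2 * T x)"] d \<open>0 < l\<close>
    by (simp add: has_real_derivative_iff_has_vector_derivative Rper Tper)
  have "((\<lambda>x. \<kappa>\<^sup>2 * (f x - m)\<^sup>2 + (R' x)\<^sup>2 - \<kappa>\<^sup>2 * (R x)\<^sup>2
        + ((2 * R' x + T' x) * T' x + (2 * R x + T x) * (- \<kappa>\<^sup>2 * T x))) has_integral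
      \<kappa>\<^sup>2 * integral {0..l} (\<lambda>x. (f x - m)\<^sup>2) + integral {0..l} (\<lambda>x. (R' x)\<^sup>2)
        - \<kappa>\<^sup>2 * integral {0..l} (\<lambda>x. (R x)\<^sup>2) + 0) {0..l}"
    by (intro has_integral_diff has_integral_add has_integral_mult_right integrable_integral
        integrable_continuous_real continuous_intros Z)
  moreover have "(\<lambda>x. \<kappa>\<^sup>2 * (f x - m)\<^sup>2 + (R' x)\<^sup>2 - \<kappa>\<^sup>2 * (R x)\<^sup>2
        + ((2 * R' x + T' x) * T' x + (2 * R x + T x) * (- \<kappa>\<^sup>2 * T x))) = (\<lambda>x. (f' x)\<^sup>2)"
    by (simp add: R_def R'_def fun_eq_iff power2_eq_square algebra_simps)
  ultimately have "integral {0..l} (\<lambda>x. (f' x)\<^sup>2) = \<kappa>\<^sup>2 * integral {0..l} (\<lambda>x. (f x - m)\<^sup>2)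
      + integral {0..l} (\<lambda>x. (R' x)\<^sup>2) - \<kappa>\<^sup>2 * integral {0..l} (\<lambda>x. (R x)\<^sup>2)"
    by (simp add: integral_unique)
  then show ?thesis using gap unfolding R_def T_def by linarith
qed

text \<open>Odd reflection at \<open>l\<close> produces a function of period 2 l with mean zero and
  without cosine coefficient, so that the periodic inequality leaves only the sine term. All
  integrals double, which cancels in the result.\<close>

lemma wirtinger_dirichlet_remainder:
  fixes f f' :: "real \<Rightarrow> real"
  assumes "0 < l"
    and df: "\<And>x. x \<in> {0..l} \<Longrightarrow> (f has_real_derivative f' x) (at x within {0..l})"
    and cf': "continuous_on {0..l} f'"
    and f0: "f 0 = 0" "f l = 0"
  defines "\<kappa> \<equiv> pi / l"
  defines "B \<equiv> 2 / l * integral {0..l} (\<lambda>x. f x * sin (\<kappa> * x))"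
  shows "\<kappa>\<^sup>2 * integral {0..l} (\<lambda>x. (f x)\<^sup>2)
      + 2 * \<kappa>\<^sup>2 * integral {0..l} (\<lambda>x. (f x - B * sin (\<kappa> * x))\<^sup>2)
      \<le> integral {0..l} (\<lambda>x. (f' x)\<^sup>2)"
proof -
  have cf [continuous_intros]: "continuous_on {0..l} f"
    using df by (meson DERIV_continuous continuous_on_eq_continuous_within)
  define F where "F = (\<lambda>x. if x \<le> l then f x else - f (2 * l - x))"
  define F' where "F' = (\<lambda>x. if x \<le> l then f' x else f' (2 * l - x))"
  have dr: "((\<lambda>x. - f (2 * l - x)) has_real_derivative f' (2 * l - x)) (at x within {l..2 * l})"
    if "x \<in> {l..2 * l}" for x
  proof -
    have "(f has_real_derivative f' (2 * l - x)) (at (2 * l - x) within (\<lambda>y. 2 * l - y) ` {l..2 * l})"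
      using that by (intro has_field_derivative_subset[OF df]) auto
    moreover have "((\<lambda>y. 2 * l - y) has_real_derivative -1) (at x within {l..2 * l})"
      by (auto intro!: derivative_eq_intros)
    ultimately have "((\<lambda>y. f (2 * l - y)) has_real_derivative f' (2 * l - x) * -1) (at x within {l..2 * l})"
      using DERIV_image_chain[of f "f' (2 * l - x)" "\<lambda>y. 2 * l - y" x "{l..2 * l}" "-1"] by (simp add: o_def)
    from DERIV_minus[OF this] show ?thesis by simp
  qed
  have U: "{0..2 * l} = {0..l} \<union> {l..2 * l}" using \<open>0 < l\<close> by auto
  \<comment> \<open>At x = l the two pieces fit together because \<open>f l = 0\<close>, and both
    one-sided derivatives equal \<open>f' l\<close>.\<close>
  have dF: "(F has_real_derivative F' x) (at x within {0..2 * l})" if "x \<in> {0..2 * l}" for x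
  proof -
    have "((\<lambda>x. if x \<in> {0..l} then f x else - f (2 * l - x)) has_vector_derivative
       (if x \<in> {0..l} then f' x else f' (2 * l - x))) (at x within {0..2 * l})"
      by (rule has_vector_derivative_If_within_closures[where S = "{0..l}" and T = "{l..2 * l}"])
        (use that f0 \<open>0 < l\<close> df dr in \<open>auto simp: has_real_derivative_iff_has_vector_derivative insert_absorb U\<close>)
    then have "(F has_vector_derivative F' x) (at x within {0..2 * l})"
      using that by (elim has_vector_derivative_transform[rotated 2, THEN has_vector_derivative_eq_rhs])
        (auto simp: F_def F'_def)
    then show ?thesis by (simp add: has_real_derivative_iff_has_vector_derivative)
  qed
  have cF': "continuous_on {0..2 * l} F'"
    unfolding U F'_def
    by (intro continuous_on_cases cf' continuous_intros continuous_on_compose2[OF cf'])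
      (use \<open>0 < l\<close> in \<open>auto intro!: continuous_on_compose2[OF cf'] continuous_intros\<close>)
  have cF: "continuous_on {0..2 * l} F"
    using dF by (meson DERIV_continuous continuous_on_eq_continuous_within)
  have refl: "integral {l..2 * l} g = integral {0..l} (\<lambda>x. g (2 * l - x))" for g :: "real \<Rightarrow> real"
  proof -
    have "integral {0..l} (\<lambda>x. g (2 * l - x)) = integral {- l..- 0} (\<lambda>x. g (2 * l - - x))"
      by (rule Henstock_Kurzweil_Integration.integral_reflect_real[symmetric])
    also have "\<dots> = integral {-l + 2 * l..0 + 2 * l} g"
      using integral_shift_cbox_plus[of "- l" 0 g "2 * l"] by (simp add: o_def)
    finally show ?thesis by simp
  qed
  have split: "integral {0..2 * l} g = integral {0..l} (\<lambda>x. g x + g (2 * l - x))"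
    if c: "continuous_on {0..2 * l} g" for g :: "real \<Rightarrow> real"
  proof -
    have "integral {0..l} g + integral {l..2 * l} g = integral {0..2 * l} g"
      by (rule Henstock_Kurzweil_Integration.integral_combine)
        (use \<open>0 < l\<close> c in \<open>auto intro: integrable_continuous_real\<close>)
    moreover have "integral {0..l} (\<lambda>x. g x + g (2 * l - x)) = integral {0..l} g + integral {0..l} (\<lambda>x. g (2 * l - x))"
      by (intro integral_add integrable_continuous_real continuous_on_compose2[OF c] continuous_on_subset[OF c]
          continuous_intros) (use \<open>0 < l\<close> in auto)
    ultimately show ?thesis unfolding refl by simp
  qed
  have F0: "F x = f x" "F' x = f' x" if "x \<in> {0..l}" for x using that by (auto simp: F_def F'_def)
  have F1: "F (2 * l - x) = - f x" "F' (2 * l - x) = f' x" if "x \<in> {0..l}" for x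
    using that f0 by (auto simp: F_def F'_def)
  have k: "2 * pi / (2 * l) = \<kappa>" by (simp add: \<kappa>_def)
  have kr: "\<kappa> * (2 * l - x) = 2 * pi - \<kappa> * x" for x using \<open>0 < l\<close> by (simp add: \<kappa>_def field_simps)
  have csr: "cos (\<kappa> * (2 * l - x)) = cos (\<kappa> * x)" "sin (\<kappa> * (2 * l - x)) = - sin (\<kappa> * x)" for x
    unfolding kr by (simp_all add: cos_diff sin_diff)
  have m0: "integral {0..2 * l} F = 0"
  proof -
    have "integral {0..2 * l} F = integral {0..l} (\<lambda>x. 0)"
      unfolding split[OF cF] by (rule integral_cong) (simp add: F0 F1)
    then show ?thesis by simp
  qed
  have A0: "integral {0..2 * l} (\<lambda>x. F x * cos (\<kappa> * x)) = 0"
  proof -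
    have "integral {0..2 * l} (\<lambda>x. F x * cos (\<kappa> * x)) = integral {0..l} (\<lambda>x. 0)"
      by (subst split, intro continuous_intros cF, rule integral_cong) (simp add: F0 F1 csr)
    then show ?thesis by simp
  qed
  have BB: "integral {0..2 * l} (\<lambda>x. F x * sin (\<kappa> * x)) = integral {0..l} (\<lambda>x. 2 * (f x * sin (\<kappa> * x)))"
    by (subst split, intro continuous_intros cF, rule integral_cong) (simp add: F0 F1 csr)
  have B2: "2 / (2 * l) * integral {0..2 * l} (\<lambda>x. F x * sin (\<kappa> * x)) = B"
    unfolding BB B_def by simp
  have per: "F (2 * l) = F 0" using f0 \<open>0 < l\<close> by (simp add: F_def)
  have "\<kappa>\<^sup>2 * integral {0..2 * l} (\<lambda>x. (F x)\<^sup>2)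
      + 2 * \<kappa>\<^sup>2 * integral {0..2 * l} (\<lambda>x. (F x - B * sin (\<kappa> * x))\<^sup>2)
      \<le> integral {0..2 * l} (\<lambda>x. (F' x)\<^sup>2)"
    using wirtinger_periodic_remainder[of "2 * l" F F', OF _ dF cF' per] \<open>0 < l\<close> unfolding k m0 A0 B2 by simp
  moreover have "integral {0..2 * l} (\<lambda>x. (F x)\<^sup>2) = integral {0..l} (\<lambda>x. 2 * (f x)\<^sup>2)"
    by (subst split, intro continuous_intros cF, rule integral_cong) (simp add: F0 F1)
  moreover have "integral {0..2 * l} (\<lambda>x. (F' x)\<^sup>2) = integral {0..l} (\<lambda>x. 2 * (f' x)\<^sup>2)"
    by (subst split, intro continuous_intros cF', rule integral_cong) (simp add: F0 F1)
  moreover have "integral {0..2 * l} (\<lambda>x. (F x - B * sin (\<kappa> * x))\<^sup>2) = integral {0..l} (\<lambda>x. 2 * (f x - B * sin (\<kappa> * x))\<^sup>2)"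
    by (subst split, intro continuous_intros cF, rule integral_cong)
      (simp only: F0 F1 csr, simp add: power2_eq_square algebra_simps)
  ultimately show ?thesis by simp
qed

subsection \<open>Functions on the periodic cell\<close>

lemma integral_Cauchy_Schwarz:
  fixes f g :: "'a::euclidean_space \<Rightarrow> real"
  assumes f: "(\<lambda>x. (f x)\<^sup>2) integrable_on S" and g: "(\<lambda>x. (g x)\<^sup>2) integrable_on S"
    and fg: "(\<lambda>x. f x * g x) integrable_on S"
  shows "(integral S (\<lambda>x. f x * g x))\<^sup>2 \<le> integral S (\<lambda>x. (f x)\<^sup>2) * integral S (\<lambda>x. (g x)\<^sup>2)"
proof -
  define A B C where "A = integral S (\<lambda>x. (f x)\<^sup>2)" and "B = integral S (\<lambda>x. f x * g x)"
    and "C = integral S (\<lambda>x. (g x)\<^sup>2)"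
  have q: "0 \<le> A + 2 * s * B + s\<^sup>2 * C" for s
  proof -
    have "((\<lambda>x. (f x)\<^sup>2 + 2 * s * (f x * g x) + s\<^sup>2 * (g x)\<^sup>2) has_integral (A + 2 * s * B + s\<^sup>2 * C)) S"
      unfolding A_def B_def C_def
      by (intro has_integral_add has_integral_mult_right integrable_integral f g fg)
    moreover have "(f x)\<^sup>2 + 2 * s * (f x * g x) + s\<^sup>2 * (g x)\<^sup>2 = (f x + s * g x)\<^sup>2" for x
      by (simp add: power2_eq_square algebra_simps)
    ultimately have "((\<lambda>x. (f x + s * g x)\<^sup>2) has_integral (A + 2 * s * B + s\<^sup>2 * C)) S" by simp
    from has_integral_nonneg[OF this] show ?thesis by simp
  qed
  have "0 \<le> C" unfolding C_def by (intro integral_nonneg g) simp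
  have "B\<^sup>2 \<le> A * C"
  proof (cases "C = 0")
    case True
    \<comment> \<open>For C = 0 the quadratic in \<open>s\<close> is affine, and a nonzero slope
      would let it reach the value -1.\<close>
    have "B = 0"
    proof (rule ccontr)
      assume "B \<noteq> 0"
      then have "A + 2 * (- (A + 1) / (2 * B)) * B = -1" by (simp add: field_simps)
      then show False using q[of "- (A + 1) / (2 * B)"] True by simp
    qed
    then show ?thesis using True by simp
  next
    case False
    with \<open>0 \<le> C\<close> have "0 < C" by simp
    have "A + 2 * (- B / C) * B + (- B / C)\<^sup>2 * C = (A * C - B\<^sup>2) / C"
      using \<open>0 < C\<close> by (simp add: field_simps power2_eq_square)
    then show ?thesis using q[of "- B / C"] \<open>0 < C\<close> by (simp add: zero_le_divide_iff)
  qed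
  then show ?thesis unfolding A_def B_def C_def .
qed

text \<open>The conjugate exponent p / (p - 1) is replaced by an integer \<open>n\<close> above it,
  because the stream function will be controlled in integer powers; 1 + |a|^n dominates the power
  with the true exponent. The case distinction asks which of the two factors is large relative to
  the other.\<close>

lemma abs_mult_le_Young:
  fixes a b \<tau> p :: real
  assumes "1 < p" "0 < \<tau>" "p / (p - 1) \<le> real n"
  shows "\<bar>a * b\<bar> \<le> \<tau> * (1 + \<bar>a\<bar> ^ n) + \<tau> powr (1 - p) * \<bar>b\<bar> powr p"
proof (cases "\<bar>b\<bar> \<le> \<tau> * \<bar>a\<bar> powr (1 / (p - 1))")
  case True
  define q where "q = p / (p - 1)"
  have q: "1 + 1 / (p - 1) = q" "0 < q" "q \<le> real n" using assms by (auto simp: q_def field_simps)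
  have "\<bar>a * b\<bar> \<le> \<bar>a\<bar> * (\<tau> * \<bar>a\<bar> powr (1 / (p - 1)))"
    unfolding abs_mult using True by (intro mult_left_mono) auto
  also have "\<dots> = \<tau> * \<bar>a\<bar> powr q"
    by (cases "a = 0") (use q in \<open>auto simp: q(1)[symmetric] powr_add\<close>)
  also have "\<bar>a\<bar> powr q \<le> 1 + \<bar>a\<bar> ^ n"
  proof (cases "\<bar>a\<bar> \<le> 1")
    case True
    then have "\<bar>a\<bar> powr q \<le> 1 powr q" using q by (intro powr_mono2) auto
    then show ?thesis by (simp add: add_increasing2)
  next
    case False
    then have "\<bar>a\<bar> powr q \<le> \<bar>a\<bar> powr real n" using q by (intro powr_mono) auto
    also have "\<dots> = \<bar>a\<bar> ^ n" using False by (intro powr_realpow) auto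
    finally show ?thesis by simp
  qed
  finally have "\<bar>a * b\<bar> \<le> \<tau> * (1 + \<bar>a\<bar> ^ n)" using assms by (simp add: mult_left_mono)
  moreover have "0 \<le> \<tau> powr (1 - p) * \<bar>b\<bar> powr p" by simp
  ultimately show ?thesis by linarith
next
  case False
  have "b \<noteq> 0" using False assms(2) by auto
  have "\<bar>a\<bar> powr (1 / (p - 1)) \<le> \<bar>b\<bar> / \<tau>" using False assms by (simp add: field_simps)
  then have "(\<bar>a\<bar> powr (1 / (p - 1))) powr (p - 1) \<le> (\<bar>b\<bar> / \<tau>) powr (p - 1)"
    using assms by (intro powr_mono2) auto
  then have "\<bar>a\<bar> \<le> (\<bar>b\<bar> / \<tau>) powr (p - 1)" using assms by (simp add: powr_powr)
  then have "\<bar>a * b\<bar> \<le> (\<bar>b\<bar> / \<tau>) powr (p - 1) * \<bar>b\<bar>"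
    unfolding abs_mult by (intro mult_right_mono) auto
  also have "\<dots> = \<tau> powr (1 - p) * \<bar>b\<bar> powr p"
    using \<open>b \<noteq> 0\<close> assms by (simp add: powr_divide powr_diff field_simps)
  also have "\<dots> \<le> \<tau> * (1 + \<bar>a\<bar> ^ n) + \<dots>" using assms by simp
  finally show ?thesis .
qed

locale periodic_cell =
  fixes L H :: real
  assumes L: "0 < L" and H: "0 < H"
begin

abbreviation Q :: "(real \<times> real) set" where "Q \<equiv> {0..L} \<times> {0..H}"

abbreviation J :: "(real \<times> real \<Rightarrow> real) \<Rightarrow> real" where "J f \<equiv> integral Q f"

abbreviation dirichlet :: "(real \<times> real \<Rightarrow> real) \<Rightarrow> (real \<times> real \<Rightarrow> real) \<Rightarrow> real" where
  "dirichlet \<psi>x \<psi>y \<equiv> J (\<lambda>z. (\<psi>x z)\<^sup>2 + (\<psi>y z)\<^sup>2)"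

lemma Q_cbox: "Q = cbox (0, 0) (L, H)"
  by (simp add: cbox_Pair_eq)

lemma integrable_Q: "continuous_on Q f \<Longrightarrow> f integrable_on Q" for f :: "real \<times> real \<Rightarrow> real"
  unfolding Q_cbox by (rule integrable_continuous)

lemma J_add: "continuous_on Q f \<Longrightarrow> continuous_on Q g \<Longrightarrow> J (\<lambda>z. f z + g z) = J f + J g"
  by (intro integral_add integrable_Q)

lemma J_diff: "continuous_on Q f \<Longrightarrow> continuous_on Q g \<Longrightarrow> J (\<lambda>z. f z - g z) = J f - J g"
  by (intro integral_diff integrable_Q)

lemma J_cmult: "J (\<lambda>z. c * f z) = c * J f"
  by (rule integral_mult_right)

lemma J_mono: "continuous_on Q f \<Longrightarrow> continuous_on Q g \<Longrightarrow> (\<And>z. z \<in> Q \<Longrightarrow> f z \<le> g z) \<Longrightarrow> J f \<le> J g"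
  by (intro integral_le integrable_Q)

lemma J_nonneg: "continuous_on Q f \<Longrightarrow> (\<And>z. z \<in> Q \<Longrightarrow> 0 \<le> f z) \<Longrightarrow> 0 \<le> J f"
  by (intro integral_nonneg integrable_Q)

lemma J_cong: "(\<And>z. z \<in> Q \<Longrightarrow> f z = g z) \<Longrightarrow> J f = J g"
  by (rule integral_cong)

lemma J_const: "J (\<lambda>z. c) = c * (L * H)"
  unfolding Q_cbox using L H by (simp add: content_Pair)

lemma J_abs_le: "continuous_on Q f \<Longrightarrow> \<bar>J f\<bar> \<le> J (\<lambda>z. \<bar>f z\<bar>)"
  using integral_norm_bound_integral[of f Q "\<lambda>z. \<bar>f z\<bar>"]
  by (simp add: integrable_Q continuous_on_rabs)

lemma J_Cauchy_Schwarz: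
  assumes "continuous_on Q f" "continuous_on Q g"
  shows "(J (\<lambda>z. f z * g z))\<^sup>2 \<le> J (\<lambda>z. (f z)\<^sup>2) * J (\<lambda>z. (g z)\<^sup>2)"
  by (intro integral_Cauchy_Schwarz integrable_Q continuous_intros assms)

lemma cont_fst: "continuous_on {0..L} g \<Longrightarrow> continuous_on Q (\<lambda>z. g (fst z))" for g :: "real \<Rightarrow> real"
  by (rule continuous_on_compose2[where g = g]) (auto intro!: continuous_intros)

lemma cont_snd: "continuous_on {0..H} g \<Longrightarrow> continuous_on Q (\<lambda>z. g (snd z))" for g :: "real \<Rightarrow> real"
  by (rule continuous_on_compose2[where g = g]) (auto intro!: continuous_intros)

lemma cont_slice1: "continuous_on Q f \<Longrightarrow> y \<in> {0..H} \<Longrightarrow> continuous_on {0..L} (\<lambda>x. f (x, y))"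
  for f :: "real \<times> real \<Rightarrow> real"
  by (rule continuous_on_compose2[where g = f]) (auto intro!: continuous_intros)

lemma cont_slice2: "continuous_on Q f \<Longrightarrow> x \<in> {0..L} \<Longrightarrow> continuous_on {0..H} (\<lambda>y. f (x, y))"
  for f :: "real \<times> real \<Rightarrow> real"
  by (rule continuous_on_compose2[where g = f]) (auto intro!: continuous_intros)

lemma cont_swap: "continuous_on Q f \<Longrightarrow> continuous_on ({0..H} \<times> {0..L}) (\<lambda>(y, x). f (x, y))"
  for f :: "real \<times> real \<Rightarrow> real"
  unfolding split_beta by (rule continuous_on_compose2[where g = f]) (auto intro!: continuous_intros)

lemma cont_int1: "continuous_on Q f \<Longrightarrow> continuous_on {0..H} (\<lambda>y. integral {0..L} (\<lambda>x. f (x, y)))"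
  for f :: "real \<times> real \<Rightarrow> real"
  using integral_continuous_on_param[of "{0..H}" 0 L "\<lambda>y x. f (x, y)"] cont_swap[of f] by simp

lemma cont_int2: "continuous_on Q f \<Longrightarrow> continuous_on {0..L} (\<lambda>x. integral {0..H} (\<lambda>y. f (x, y)))"
  for f :: "real \<times> real \<Rightarrow> real"
  using integral_continuous_on_param[of "{0..L}" 0 H "\<lambda>x y. f (x, y)"] by (simp add: split_beta)

lemma J_iter2: "continuous_on Q f \<Longrightarrow> J f = integral {0..L} (\<lambda>x. integral {0..H} (\<lambda>y. f (x, y)))"
  unfolding Q_cbox using integral_prod_continuous[of 0 0 L H f] by simp

lemma J_iter1: "continuous_on Q f \<Longrightarrow> J f = integral {0..H} (\<lambda>y. integral {0..L} (\<lambda>x. f (x, y)))"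
  using J_iter2[of f] integral_swap_continuous[of 0 0 L H "\<lambda>x y. f (x, y)"]
  by (simp add: Q_cbox split_beta)

lemma J_dx_zero:
  assumes c: "continuous_on Q Fx"
    and d: "\<And>x y. x \<in> {0..L} \<Longrightarrow> y \<in> {0..H} \<Longrightarrow>
      ((\<lambda>s. F (s, y)) has_real_derivative Fx (x, y)) (at x within {0..L})"
    and per: "\<And>y. y \<in> {0..H} \<Longrightarrow> F (L, y) = F (0, y)"
  shows "J Fx = 0"
proof -
  have "integral {0..L} (\<lambda>x. Fx (x, y)) = 0" if "y \<in> {0..H}" for y
    using fundamental_theorem_of_calculus[of 0 L "\<lambda>x. F (x, y)" "\<lambda>x. Fx (x, y)"] d[OF _ that] per[OF that] L
    by (simp add: has_real_derivative_iff_has_vector_derivative integral_unique)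
  then have "integral {0..H} (\<lambda>y. integral {0..L} (\<lambda>x. Fx (x, y))) = integral {0..H} (\<lambda>y. 0)"
    by (intro integral_cong) auto
  then show ?thesis unfolding J_iter1[OF c] by simp
qed

lemma J_dy_zero:
  assumes c: "continuous_on Q Fy"
    and d: "\<And>x y. x \<in> {0..L} \<Longrightarrow> y \<in> {0..H} \<Longrightarrow>
      ((\<lambda>s. F (x, s)) has_real_derivative Fy (x, y)) (at y within {0..H})"
    and bd: "\<And>x. x \<in> {0..L} \<Longrightarrow> F (x, H) = F (x, 0)"
  shows "J Fy = 0"
proof -
  have "integral {0..H} (\<lambda>y. Fy (x, y)) = 0" if "x \<in> {0..L}" for x
    using fundamental_theorem_of_calculus[of 0 H "\<lambda>y. F (x, y)" "\<lambda>y. Fy (x, y)"] d[OF that] bd[OF that] H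
    by (simp add: has_real_derivative_iff_has_vector_derivative integral_unique)
  then have "integral {0..L} (\<lambda>x. integral {0..H} (\<lambda>y. Fy (x, y))) = integral {0..L} (\<lambda>x. 0)"
    by (intro integral_cong) auto
  then show ?thesis unfolding J_iter2[OF c] by simp
qed

text \<open>The gradient is carried along as explicit functions, with one-sided derivatives at the
  edges of the closed cell. The same class serves for stream functions and for test functions, and
  no second derivatives occur in it.\<close>

definition stream_fun ::
  "(real \<times> real \<Rightarrow> real) \<Rightarrow> (real \<times> real \<Rightarrow> real) \<Rightarrow> (real \<times> real \<Rightarrow> real) \<Rightarrow> bool" where
  "stream_fun \<psi> \<psi>x \<psi>y \<longleftrightarrow> continuous_on Q \<psi> \<and> continuous_on Q \<psi>x \<and> continuous_on Q \<psi>y \<and>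
     (\<forall>x\<in>{0..L}. \<forall>y\<in>{0..H}. ((\<lambda>s. \<psi> (s, y)) has_real_derivative \<psi>x (x, y)) (at x within {0..L}) \<and>
        ((\<lambda>s. \<psi> (x, s)) has_real_derivative \<psi>y (x, y)) (at y within {0..H})) \<and>
     (\<forall>y\<in>{0..H}. \<psi> (L, y) = \<psi> (0, y)) \<and> (\<forall>x\<in>{0..L}. \<psi> (x, 0) = 0 \<and> \<psi> (x, H) = 0)"

lemma stream_funD:
  assumes "stream_fun \<psi> \<psi>x \<psi>y"
  shows "continuous_on Q \<psi>" "continuous_on Q \<psi>x" "continuous_on Q \<psi>y"
    "\<And>x y. x \<in> {0..L} \<Longrightarrow> y \<in> {0..H} \<Longrightarrow> ((\<lambda>s. \<psi> (s, y)) has_real_derivative \<psi>x (x, y)) (at x within {0..L})"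
    "\<And>x y. x \<in> {0..L} \<Longrightarrow> y \<in> {0..H} \<Longrightarrow> ((\<lambda>s. \<psi> (x, s)) has_real_derivative \<psi>y (x, y)) (at y within {0..H})"
    "\<And>y. y \<in> {0..H} \<Longrightarrow> \<psi> (L, y) = \<psi> (0, y)"
    "\<And>x. x \<in> {0..L} \<Longrightarrow> \<psi> (x, 0) = 0" "\<And>x. x \<in> {0..L} \<Longrightarrow> \<psi> (x, H) = 0"
  using assms unfolding stream_fun_def by blast+

section \<open>Embedding of the energy space into the spaces L^q\<close>

lemma abs_le_average_plus_variation:
  fixes f f' :: "real \<Rightarrow> real"
  assumes l: "0 < l" and df: "\<And>x. x \<in> {0..l} \<Longrightarrow> (f has_real_derivative f' x) (at x within {0..l})"
    and cf': "continuous_on {0..l} f'" and x: "x \<in> {0..l}"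
  shows "\<bar>f x\<bar> \<le> integral {0..l} (\<lambda>x. \<bar>f x\<bar>) / l + integral {0..l} (\<lambda>x. \<bar>f' x\<bar>)"
    and "f 0 = 0 \<Longrightarrow> \<bar>f x\<bar> \<le> integral {0..l} (\<lambda>x. \<bar>f' x\<bar>)"
proof -
  have cf: "continuous_on {0..l} f"
    using df by (meson DERIV_continuous continuous_on_eq_continuous_within)
  let ?V = "integral {0..l} (\<lambda>x. \<bar>f' x\<bar>)"
  have le: "\<bar>f b - f a\<bar> \<le> ?V" if "0 \<le> a" "a \<le> b" "b \<le> l" for a b
  proof -
    have "(f' has_integral (f b - f a)) {a..b}"
      using that by (intro fundamental_theorem_of_calculus)
        (auto simp: has_real_derivative_iff_has_vector_derivative[symmetric] intro!: has_field_derivative_subset[OF df])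
    then have "\<bar>f b - f a\<bar> = \<bar>integral {a..b} f'\<bar>" by (simp add: integral_unique)
    also have "\<dots> \<le> integral {a..b} (\<lambda>x. \<bar>f' x\<bar>)"
      using integral_norm_bound_integral[of f' "{a..b}" "\<lambda>x. \<bar>f' x\<bar>"] that
      by (simp add: integrable_continuous_real continuous_on_rabs continuous_on_subset[OF cf'])
    also have "\<dots> \<le> ?V"
      using that by (intro integral_subset_le integrable_continuous_real continuous_on_rabs continuous_on_subset[OF cf']) auto
    finally show ?thesis .
  qed
  have both: "\<bar>f x - f s\<bar> \<le> ?V" if "s \<in> {0..l}" for s
    using le[of x s] le[of s x] that x by (cases "x \<le> s") (auto simp: abs_minus_commute)
  show "f 0 = 0 \<Longrightarrow> \<bar>f x\<bar> \<le> ?V" using both[of 0] l by simp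
  have "integral {0..l} (\<lambda>s. \<bar>f x\<bar>) \<le> integral {0..l} (\<lambda>s. \<bar>f s\<bar> + ?V)"
  proof (intro integral_le integrable_continuous_real continuous_intros cf)
    fix s assume "s \<in> {0..l}"
    from both[OF this] show "\<bar>f x\<bar> \<le> \<bar>f s\<bar> + ?V" by linarith
  qed
  also have "\<dots> = integral {0..l} (\<lambda>s. \<bar>f s\<bar>) + integral {0..l} (\<lambda>s. ?V)"
    by (intro integral_add integrable_continuous_real continuous_intros cf)
  finally have "l * \<bar>f x\<bar> \<le> integral {0..l} (\<lambda>s. \<bar>f s\<bar>) + l * ?V" using l by simp
  then show "\<bar>f x\<bar> \<le> integral {0..l} (\<lambda>x. \<bar>f x\<bar>) / l + ?V" using l by (simp add: field_simps)
qed

lemma J_prod: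
  assumes "continuous_on {0..L} a" "continuous_on {0..H} b"
  shows "J (\<lambda>z. a (fst z) * b (snd z)) = integral {0..L} a * integral {0..H} b"
proof -
  have "J (\<lambda>z. a (fst z) * b (snd z)) = integral {0..L} (\<lambda>x. integral {0..H} (\<lambda>y. a x * b y))"
    by (subst J_iter2) (auto intro!: continuous_intros cont_fst cont_snd assms)
  then show ?thesis by simp
qed

text \<open>The product of the one-dimensional bounds in each variable gives the two-dimensional
  embedding of \<open>W\<^sup>1\<^sup>,\<^sup>1\<close> into \<open>L\<^sup>2\<close>.\<close>

lemma J_square_le_gradient:
  assumes f: "continuous_on Q f" "continuous_on Q fx" "continuous_on Q fy"
    and dx: "\<And>x y. x \<in> {0..L} \<Longrightarrow> y \<in> {0..H} \<Longrightarrow> ((\<lambda>s. f (s, y)) has_real_derivative fx (x, y)) (at x within {0..L})"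
    and dy: "\<And>x y. x \<in> {0..L} \<Longrightarrow> y \<in> {0..H} \<Longrightarrow> ((\<lambda>s. f (x, s)) has_real_derivative fy (x, y)) (at y within {0..H})"
    and bd: "\<And>x. x \<in> {0..L} \<Longrightarrow> f (x, 0) = 0"
  shows "J (\<lambda>z. (f z)\<^sup>2) \<le> J (\<lambda>z. \<bar>fy z\<bar>) * (H / L * J (\<lambda>z. \<bar>fy z\<bar>) + J (\<lambda>z. \<bar>fx z\<bar>))"
proof -
  note f [continuous_intros]
  define a where "a = (\<lambda>x. integral {0..H} (\<lambda>y. \<bar>fy (x, y)\<bar>))"
  define b where "b = (\<lambda>y. integral {0..L} (\<lambda>x. \<bar>f (x, y)\<bar>) / L + integral {0..L} (\<lambda>x. \<bar>fx (x, y)\<bar>))"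
  have ca: "continuous_on {0..L} a" unfolding a_def by (intro cont_int2 continuous_intros)
  have cb: "continuous_on {0..H} b" unfolding b_def by (intro continuous_intros cont_int1) (use L in auto)
  have fa: "\<bar>f (x, y)\<bar> \<le> a x" if "x \<in> {0..L}" "y \<in> {0..H}" for x y
    unfolding a_def using abs_le_average_plus_variation(2)[OF H dy[OF that(1)] cont_slice2[OF f(3) that(1)] that(2) bd[OF that(1)]] .
  have fb: "\<bar>f (x, y)\<bar> \<le> b y" if "x \<in> {0..L}" "y \<in> {0..H}" for x y
    unfolding b_def using abs_le_average_plus_variation(1)[OF L dx[OF _ that(2)] cont_slice1[OF f(2) that(2)] that(1)] .
  have Ja: "integral {0..L} a = J (\<lambda>z. \<bar>fy z\<bar>)"
    unfolding a_def by (subst J_iter2) (auto intro!: continuous_intros)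
  have Jf: "J (\<lambda>z. \<bar>f z\<bar>) \<le> H * J (\<lambda>z. \<bar>fy z\<bar>)"
  proof -
    have "J (\<lambda>z. \<bar>f z\<bar>) \<le> J (\<lambda>z. a (fst z) * 1)"
      by (intro J_mono continuous_intros cont_fst ca) (use fa in auto)
    also have "\<dots> = H * J (\<lambda>z. \<bar>fy z\<bar>)"
      using J_prod[OF ca, of "\<lambda>_. 1"] H by (simp add: Ja)
    finally show ?thesis .
  qed
  have "J (\<lambda>z. (f z)\<^sup>2) \<le> J (\<lambda>z. a (fst z) * b (snd z))"
  proof (intro J_mono continuous_intros cont_fst cont_snd ca cb)
    fix z assume "z \<in> Q"
    then have z: "fst z \<in> {0..L}" "snd z \<in> {0..H}" by auto
    have "(f z)\<^sup>2 = \<bar>f (fst z, snd z)\<bar> * \<bar>f (fst z, snd z)\<bar>" by (simp add: power2_eq_square)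
    also have "\<dots> \<le> a (fst z) * b (snd z)"
      using fa[OF z] fb[OF z] by (intro mult_mono) auto
    finally show "(f z)\<^sup>2 \<le> a (fst z) * b (snd z)" .
  qed
  also have "\<dots> = J (\<lambda>z. \<bar>fy z\<bar>) * integral {0..H} b"
    by (simp add: J_prod[OF ca cb] Ja)
  also have "integral {0..H} b = integral {0..H} (\<lambda>y. integral {0..L} (\<lambda>x. \<bar>f (x, y)\<bar>) / L)
      + integral {0..H} (\<lambda>y. integral {0..L} (\<lambda>x. \<bar>fx (x, y)\<bar>))"
    unfolding b_def by (intro integral_add integrable_continuous_real continuous_intros cont_int1) (use L in auto)
  also have "\<dots> = J (\<lambda>z. \<bar>f z\<bar>) / L + J (\<lambda>z. \<bar>fx z\<bar>)"
    by (subst (1 2) J_iter1) (auto intro!: continuous_intros)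
  also have "J (\<lambda>z. \<bar>fy z\<bar>) * (J (\<lambda>z. \<bar>f z\<bar>) / L + J (\<lambda>z. \<bar>fx z\<bar>))
     \<le> J (\<lambda>z. \<bar>fy z\<bar>) * (H / L * J (\<lambda>z. \<bar>fy z\<bar>) + J (\<lambda>z. \<bar>fx z\<bar>))"
    using Jf L by (intro mult_left_mono add_right_mono J_nonneg continuous_intros) (auto simp: field_simps)
  finally show ?thesis .
qed

text \<open>The embedding is applied to \<open>\<psi> ^ Suc m\<close>, whose gradient is
  \<open>Suc m\<close> times \<open>\<psi> ^ m\<close> times the gradient of \<psi>. Cauchy-Schwarz
  separates the last two factors, and the exponent drops by two.\<close>

lemma power_integral_step:
  assumes \<psi>: "stream_fun \<psi> \<psi>x \<psi>y"
  shows "J (\<lambda>z. (\<psi> z) ^ (2 * Suc m))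
     \<le> (H / L + 1) * (real (Suc m))\<^sup>2 * (J (\<lambda>z. (\<psi> z) ^ (2 * m)) * dirichlet \<psi>x \<psi>y)"
proof -
  note \<psi>D = stream_funD[OF \<psi>]
  note \<psi>D(1-3) [continuous_intros]
  let ?X = "dirichlet \<psi>x \<psi>y" and ?P = "J (\<lambda>z. (\<psi> z) ^ (2 * m))"
  define n where "n = real (Suc m)"
  define fx where "fx = (\<lambda>z. n * (\<psi> z) ^ m * \<psi>x z)"
  define fy where "fy = (\<lambda>z. n * (\<psi> z) ^ m * \<psi>y z)"
  have cf [continuous_intros]: "continuous_on Q fx" "continuous_on Q fy"
    unfolding fx_def fy_def by (intro continuous_intros)+
  have "J (\<lambda>z. ((\<psi> z) ^ Suc m)\<^sup>2) \<le> J (\<lambda>z. \<bar>fy z\<bar>) * (H / L * J (\<lambda>z. \<bar>fy z\<bar>) + J (\<lambda>z. \<bar>fx z\<bar>))"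
  proof (rule J_square_le_gradient[OF _ cf])
    show "continuous_on Q (\<lambda>z. \<psi> z ^ Suc m)" by (intro continuous_intros)
    show "\<psi> (x, 0) ^ Suc m = 0" if "x \<in> {0..L}" for x using \<psi>D(7)[OF that] by simp
    fix x y assume xy: "x \<in> {0..L}" "y \<in> {0..H}"
    show "((\<lambda>s. \<psi> (s, y) ^ Suc m) has_real_derivative fx (x, y)) (at x within {0..L})"
      using DERIV_power[OF \<psi>D(4)[OF xy], of "Suc m"] by (simp add: fx_def n_def mult_ac)
    show "((\<lambda>s. \<psi> (x, s) ^ Suc m) has_real_derivative fy (x, y)) (at y within {0..H})"
      using DERIV_power[OF \<psi>D(5)[OF xy], of "Suc m"] by (simp add: fy_def n_def mult_ac)
  qed
  moreover have cs: "J (\<lambda>z. \<bar>n * (\<psi> z) ^ m * h z\<bar>) \<le> n * sqrt (?P * ?X)"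
    if [continuous_intros]: "continuous_on Q h" and h: "\<And>z. (h z)\<^sup>2 \<le> (\<psi>x z)\<^sup>2 + (\<psi>y z)\<^sup>2" for h
  proof -
    have "(J (\<lambda>z. \<bar>\<psi> z ^ m\<bar> * \<bar>h z\<bar>))\<^sup>2 \<le> J (\<lambda>z. \<bar>\<psi> z ^ m\<bar>\<^sup>2) * J (\<lambda>z. \<bar>h z\<bar>\<^sup>2)"
      by (intro J_Cauchy_Schwarz continuous_intros)
    also have "J (\<lambda>z. \<bar>\<psi> z ^ m\<bar>\<^sup>2) = ?P" by (simp add: power_mult[symmetric] mult.commute)
    also have "?P * J (\<lambda>z. \<bar>h z\<bar>\<^sup>2) \<le> ?P * ?X"
      by (intro mult_left_mono J_mono J_nonneg continuous_intros) (auto simp: h power_mult)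
    finally have "J (\<lambda>z. \<bar>\<psi> z ^ m\<bar> * \<bar>h z\<bar>) \<le> sqrt (?P * ?X)" by (rule real_le_rsqrt)
    then have "n * J (\<lambda>z. \<bar>\<psi> z ^ m\<bar> * \<bar>h z\<bar>) \<le> n * sqrt (?P * ?X)"
      by (intro mult_left_mono) (auto simp: n_def)
    moreover have "J (\<lambda>z. \<bar>n * (\<psi> z) ^ m * h z\<bar>) = J (\<lambda>z. n * (\<bar>\<psi> z ^ m\<bar> * \<bar>h z\<bar>))"
      by (intro J_cong) (auto simp: abs_mult n_def)
    ultimately show ?thesis by (simp add: J_cmult)
  qed
  have PX: "0 \<le> ?P * ?X"
    by (intro mult_nonneg_nonneg J_nonneg continuous_intros) (auto simp: power_mult)
  have "J (\<lambda>z. \<bar>fy z\<bar>) * (H / L * J (\<lambda>z. \<bar>fy z\<bar>) + J (\<lambda>z. \<bar>fx z\<bar>))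
     \<le> (n * sqrt (?P * ?X)) * (H / L * (n * sqrt (?P * ?X)) + n * sqrt (?P * ?X))"
    unfolding fx_def fy_def using L H
    by (intro mult_mono add_mono mult_left_mono cs continuous_intros add_nonneg_nonneg mult_nonneg_nonneg J_nonneg)
      (use PX in \<open>auto simp: n_def\<close>)
  also have "\<dots> = (H / L + 1) * n\<^sup>2 * (sqrt (?P * ?X))\<^sup>2"
    by (simp add: power2_eq_square algebra_simps)
  also have "(sqrt (?P * ?X))\<^sup>2 = ?P * ?X"
    by (intro real_sqrt_pow2 mult_nonneg_nonneg J_nonneg continuous_intros) (auto simp: power_mult)
  moreover have "(\<psi> z) ^ (2 * Suc m) = ((\<psi> z) ^ Suc m)\<^sup>2" for z
    unfolding power_mult[symmetric] by (simp add: mult.commute)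
  ultimately show ?thesis unfolding n_def by simp
qed

text \<open>With even integer exponents no absolute values or real powers have to be differentiated.
  The constant is chosen before \<psi>, which makes the embedding uniform over all flows and
  times.\<close>

lemma power_integral_bound:
  "\<exists>C\<ge>0. \<forall>\<psi> \<psi>x \<psi>y. stream_fun \<psi> \<psi>x \<psi>y \<longrightarrow>
     J (\<lambda>z. (\<psi> z) ^ (2 * m)) \<le> C * dirichlet \<psi>x \<psi>y ^ m"
proof (induction m)
  case 0
  then show ?case using L H by (intro exI[of _ "L * H"]) (auto simp: J_const[of 1, simplified])
next
  case (Suc m)
  then obtain C where C: "C \<ge> 0" and b: "\<And>\<psi> \<psi>x \<psi>y. stream_fun \<psi> \<psi>x \<psi>y \<Longrightarrow>
     J (\<lambda>z. (\<psi> z) ^ (2 * m)) \<le> C * dirichlet \<psi>x \<psi>y ^ m" by blast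
  show ?case
  proof (intro exI[of _ "(H / L + 1) * (real (Suc m))\<^sup>2 * C"] conjI allI impI)
    show "0 \<le> (H / L + 1) * (real (Suc m))\<^sup>2 * C" using C L H by simp
    fix \<psi> \<psi>x \<psi>y assume s: "stream_fun \<psi> \<psi>x \<psi>y"
    let ?X = "dirichlet \<psi>x \<psi>y"
    have "0 \<le> ?X" using stream_funD(2,3)[OF s] by (intro J_nonneg continuous_intros) auto
    have "J (\<lambda>z. (\<psi> z) ^ (2 * Suc m)) \<le> (H / L + 1) * (real (Suc m))\<^sup>2 * (J (\<lambda>z. (\<psi> z) ^ (2 * m)) * ?X)"
      by (rule power_integral_step[OF s])
    also have "\<dots> \<le> (H / L + 1) * (real (Suc m))\<^sup>2 * ((C * ?X ^ m) * ?X)"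
      using L H \<open>0 \<le> ?X\<close> by (intro mult_left_mono mult_right_mono b[OF s]) auto
    finally show "J (\<lambda>z. (\<psi> z) ^ (2 * Suc m)) \<le> (H / L + 1) * (real (Suc m))\<^sup>2 * C * ?X ^ Suc m"
      by (simp add: mult_ac)
  qed
qed

text \<open>Dividing \<psi> by the square root of its Dirichlet integral bounds its even powers by a
  constant, so Young's inequality asks only for a small integral of |\<rho>|^p. The bound keeps the
  square root of the energy as a factor, so that it can be absorbed when \<rho> is itself the
  vorticity of \<psi>.\<close>

lemma pairing_small:
  assumes p: "1 < p" and \<theta>: "0 < \<theta>"
  shows "\<exists>\<delta>>0. \<forall>\<rho> \<psi> \<psi>x \<psi>y. continuous_on Q \<rho> \<longrightarrow> stream_fun \<psi> \<psi>x \<psi>y \<longrightarrow>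
     J (\<lambda>z. \<bar>\<rho> z\<bar> powr p) < \<delta> \<longrightarrow> J (\<lambda>z. \<bar>\<psi> z * \<rho> z\<bar>) \<le> \<theta> * sqrt (dirichlet \<psi>x \<psi>y)"
proof -
  obtain m where m: "p / (p - 1) \<le> real m" using real_arch_simple by blast
  then have m2: "p / (p - 1) \<le> real (2 * m)" by simp
  obtain C where C: "C \<ge> 0" and bC: "\<And>\<psi> \<psi>x \<psi>y. stream_fun \<psi> \<psi>x \<psi>y \<Longrightarrow>
     J (\<lambda>z. (\<psi> z) ^ (2 * m)) \<le> C * dirichlet \<psi>x \<psi>y ^ m"
    using power_integral_bound[of m] by blast
  obtain D where bD: "\<And>\<psi> \<psi>x \<psi>y. stream_fun \<psi> \<psi>x \<psi>y \<Longrightarrow>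
     J (\<lambda>z. (\<psi> z) ^ 2) \<le> D * dirichlet \<psi>x \<psi>y"
    using power_integral_bound[of 1] by auto
  \<comment> \<open>With this choice the term of Young's inequality that carries \<psi> contributes
    at most \<theta> / 2; the threshold for \<rho> below leaves it the other half.\<close>
  define \<tau> where "\<tau> = \<theta> / (2 * (L * H + C))"
  have K: "0 < L * H + C" using L H C by (simp add: add_pos_nonneg)
  have \<tau>: "0 < \<tau>" "\<tau> * (L * H + C) = \<theta> / 2" using \<theta> K by (auto simp: \<tau>_def field_simps)
  show ?thesis
  proof (intro exI[of _ "\<theta> / 2 / \<tau> powr (1 - p)"] conjI allI impI)
    show "0 < \<theta> / 2 / \<tau> powr (1 - p)" using \<theta> \<tau> by simp
    fix \<rho> \<psi> \<psi>x \<psi>y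
    assume [continuous_intros]: "continuous_on Q \<rho>" and s: "stream_fun \<psi> \<psi>x \<psi>y"
      and small: "J (\<lambda>z. \<bar>\<rho> z\<bar> powr p) < \<theta> / 2 / \<tau> powr (1 - p)"
    note stream_funD(1-3)[OF s, continuous_intros]
    have cp: "continuous_on Q (\<lambda>z. \<bar>\<rho> z\<bar> powr p)"
      using p by (intro continuous_on_powr' continuous_intros) auto
    define X where "X = dirichlet \<psi>x \<psi>y"
    have "0 \<le> X" unfolding X_def by (intro J_nonneg continuous_intros) auto
    show "J (\<lambda>z. \<bar>\<psi> z * \<rho> z\<bar>) \<le> \<theta> * sqrt (dirichlet \<psi>x \<psi>y)"
    proof (cases "X = 0")
      \<comment> \<open>Without energy the normalization is impossible, but then the integral of
        \<open>\<psi>^2\<close> vanishes as well.\<close>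
      case True
      have "(J (\<lambda>z. \<bar>\<psi> z\<bar> * \<bar>\<rho> z\<bar>))\<^sup>2 \<le> J (\<lambda>z. \<bar>\<psi> z\<bar>\<^sup>2) * J (\<lambda>z. \<bar>\<rho> z\<bar>\<^sup>2)"
        by (intro J_Cauchy_Schwarz continuous_intros)
      also have "\<dots> \<le> 0"
        using bD[OF s] True unfolding X_def
        by (intro mult_nonpos_nonneg J_nonneg continuous_intros) auto
      finally show ?thesis using True unfolding X_def by (simp add: abs_mult)
    next
      case False
      with \<open>0 \<le> X\<close> have X: "0 < X" by simp
      have "J (\<lambda>z. \<bar>\<psi> z / sqrt X * \<rho> z\<bar>) \<le>
          J (\<lambda>z. \<tau> * (1 + \<bar>\<psi> z / sqrt X\<bar> ^ (2 * m)) + \<tau> powr (1 - p) * \<bar>\<rho> z\<bar> powr p)"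
        using X by (intro J_mono continuous_intros cp abs_mult_le_Young[OF p \<tau>(1) m2]) auto
      also have "\<dots> = \<tau> * (J (\<lambda>z. 1) + J (\<lambda>z. \<bar>\<psi> z / sqrt X\<bar> ^ (2 * m))) + \<tau> powr (1 - p) * J (\<lambda>z. \<bar>\<rho> z\<bar> powr p)"
        using X by (subst J_add, (intro continuous_intros cp; simp)+, subst J_cmult, subst J_cmult, subst J_add)
          (auto intro!: continuous_intros)
      also have "J (\<lambda>z. \<bar>\<psi> z / sqrt X\<bar> ^ (2 * m)) = J (\<lambda>z. (1 / X ^ m) * (\<psi> z) ^ (2 * m))"
        using X by (intro J_cong) (simp add: power_mult power_divide)
      also have "\<dots> = J (\<lambda>z. (\<psi> z) ^ (2 * m)) / X ^ m" by (simp only: J_cmult) simp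
      also have "\<dots> \<le> C" using bC[OF s] X unfolding X_def by (simp add: field_simps)
      finally have "J (\<lambda>z. \<bar>\<psi> z / sqrt X * \<rho> z\<bar>) \<le> \<tau> * (L * H + C) + \<tau> powr (1 - p) * J (\<lambda>z. \<bar>\<rho> z\<bar> powr p)"
        using \<tau>(1) by (simp add: J_const[of 1, simplified] mult_left_mono)
      also have "\<dots> \<le> \<theta>" unfolding \<tau>(2) using small \<tau>(1) by (simp add: field_simps)
      finally have "J (\<lambda>z. \<bar>\<psi> z / sqrt X * \<rho> z\<bar>) \<le> \<theta>" .
      moreover have "J (\<lambda>z. \<bar>\<psi> z / sqrt X * \<rho> z\<bar>) = J (\<lambda>z. (1 / sqrt X) * \<bar>\<psi> z * \<rho> z\<bar>)"
        using X by (intro J_cong) (simp add: abs_mult)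
      ultimately have "(1 / sqrt X) * J (\<lambda>z. \<bar>\<psi> z * \<rho> z\<bar>) \<le> \<theta>" by (simp only: J_cmult)
      then show ?thesis using X unfolding X_def[symmetric] by (simp add: field_simps)
    qed
  qed
qed


section \<open>The Poincare inequality with a remainder\<close>

lemma J_mono_slice1:
  assumes "continuous_on Q f" "continuous_on Q g"
    and "\<And>y. y \<in> {0..H} \<Longrightarrow> integral {0..L} (\<lambda>x. f (x, y)) \<le> integral {0..L} (\<lambda>x. g (x, y))"
  shows "J f \<le> J g"
  unfolding J_iter1[OF assms(1)] J_iter1[OF assms(2)]
  by (intro integral_le integrable_continuous_real cont_int1 assms)

lemma J_mono_slice2:
  assumes "continuous_on Q f" "continuous_on Q g"
    and "\<And>x. x \<in> {0..L} \<Longrightarrow> integral {0..H} (\<lambda>y. f (x, y)) \<le> integral {0..H} (\<lambda>y. g (x, y))"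
  shows "J f \<le> J g"
  unfolding J_iter2[OF assms(1)] J_iter2[OF assms(2)]
  by (intro integral_le integrable_continuous_real cont_int2 assms)

lemma J_snd: "continuous_on {0..H} g \<Longrightarrow> J (\<lambda>z. g (snd z)) = L * integral {0..H} g"
  using J_prod[of "\<lambda>_. 1" g] L by simp

lemma J_pythagoras:
  assumes h: "continuous_on Q h" and g: "continuous_on {0..H} g"
    and mean: "\<And>y. y \<in> {0..H} \<Longrightarrow> integral {0..L} (\<lambda>x. h (x, y)) = 0"
  shows "J (\<lambda>z. (h z + g (snd z))\<^sup>2) = J (\<lambda>z. (h z)\<^sup>2) + L * integral {0..H} (\<lambda>y. (g y)\<^sup>2)"
proof -
  note h [continuous_intros] cont_snd[OF g, continuous_intros]
  have "J (\<lambda>z. g (snd z) * h z) = integral {0..H} (\<lambda>y. integral {0..L} (\<lambda>x. g y * h (x, y)))"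
    by (subst J_iter1) (auto intro!: continuous_intros)
  also have "\<dots> = integral {0..H} (\<lambda>y. 0)"
    by (rule integral_cong) (simp add: mean)
  finally have orth: "J (\<lambda>z. g (snd z) * h z) = 0" by simp
  have "J (\<lambda>z. (h z + g (snd z))\<^sup>2) = J (\<lambda>z. (h z)\<^sup>2 + (2 * (g (snd z) * h z) + (g (snd z))\<^sup>2))"
    by (intro J_cong) (simp add: power2_eq_square algebra_simps)
  also have "\<dots> = J (\<lambda>z. (h z)\<^sup>2) + (2 * J (\<lambda>z. g (snd z) * h z) + J (\<lambda>z. (g (snd z))\<^sup>2))"
    by (subst J_add, (intro continuous_intros)+, subst J_add, (intro continuous_intros)+, simp add: J_cmult)
  also have "J (\<lambda>z. (g (snd z))\<^sup>2) = L * integral {0..H} (\<lambda>y. (g y)\<^sup>2)"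
    by (rule J_snd) (intro continuous_intros g)
  finally show ?thesis using orth by simp
qed

text \<open>The mean over \<open>x\<^sub>1\<close> vanishes on both walls, hence is an \<open>H\<close>-periodic function of \<open>x\<^sub>2\<close>; this is why its
  inequality has the constant \<open>(2 pi / H)\<^sup>2\<close>. The part of mean zero has remainders in both variables,
  which are combined by projecting the second onto the first Fourier mode in \<open>x\<^sub>1\<close>.\<close>

lemma poincare_deficit:
  assumes spectral: "(2 * pi / L)\<^sup>2 + (pi / H)\<^sup>2 \<le> (2 * pi / H)\<^sup>2"
  shows "\<exists>c>0. \<forall>\<psi> \<psi>x \<psi>y. stream_fun \<psi> \<psi>x \<psi>y \<longrightarrow> (\<exists>a1 a2 a3 a4.
     c * J (\<lambda>z. (\<psi> z - J \<psi> / (L * H)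
         - (a1 * cos (2 * pi / L * fst z) * sin (pi / H * snd z) + a2 * sin (2 * pi / L * fst z) * sin (pi / H * snd z)
            + a3 * cos (2 * pi / H * snd z) + a4 * sin (2 * pi / H * snd z)))\<^sup>2)
     \<le> dirichlet \<psi>x \<psi>y
        - ((2 * pi / L)\<^sup>2 + (pi / H)\<^sup>2) * J (\<lambda>z. (\<psi> z - J \<psi> / (L * H))\<^sup>2))"
proof -
  define \<kappa> \<eta> \<nu> where "\<kappa> = 2 * pi / L" and "\<eta> = pi / H" and "\<nu> = 2 * pi / H"
  have pos: "0 < \<kappa>" "0 < \<eta>" "0 < \<nu>" "\<nu> = 2 * \<eta>" using L H by (auto simp: \<kappa>_def \<eta>_def \<nu>_def)
  \<comment> \<open>The factor 3 stems from the square of a sum of the three remainders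
    \<open>R1\<close>, \<open>R4\<close>, \<open>R3\<close>, and 48 = 3 * 16 from the bound of
    \<open>R4\<close> by \<open>R2\<close>.\<close>
  define c where "c = min (2 * \<kappa>\<^sup>2 / 3) (2 * \<eta>\<^sup>2 / 48)"
  have c: "0 < c" "c * 3 \<le> 2 * \<kappa>\<^sup>2" "c * 48 \<le> 2 * \<eta>\<^sup>2" "c * 3 \<le> 2 * \<nu>\<^sup>2"
  proof -
    show c0: "0 < c" "c * 3 \<le> 2 * \<kappa>\<^sup>2" "c * 48 \<le> 2 * \<eta>\<^sup>2" using pos by (auto simp: c_def)
    have "c * 3 \<le> c * 48" using c0(1) by simp
    also have "\<dots> \<le> 2 * \<eta>\<^sup>2" by (rule c0)
    also have "\<dots> \<le> 2 * \<nu>\<^sup>2" by (simp add: pos(4) power_mult_distrib)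
    finally show "c * 3 \<le> 2 * \<nu>\<^sup>2" .
  qed
  show ?thesis unfolding \<kappa>_def[symmetric] \<eta>_def[symmetric] \<nu>_def[symmetric]
  proof (rule exI[of _ c], intro conjI allI impI c(1))
    fix \<psi> \<psi>x \<psi>y assume s: "stream_fun \<psi> \<psi>x \<psi>y"
    note sD = stream_funD[OF s]
    note sD(1-3) [continuous_intros]
    define \<Psi> where "\<Psi> = (\<lambda>y. integral {0..L} (\<lambda>x. \<psi> (x, y)) / L)"
    define \<Psi>' where "\<Psi>' = (\<lambda>y. integral {0..L} (\<lambda>x. \<psi>y (x, y)) / L)"
    define A where "A = (\<lambda>y. 2 / L * integral {0..L} (\<lambda>x. \<psi> (x, y) * cos (\<kappa> * x)))"
    define B where "B = (\<lambda>y. 2 / L * integral {0..L} (\<lambda>x. \<psi> (x, y) * sin (\<kappa> * x)))"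
    define \<mu> where "\<mu> = J \<psi> / (L * H)"
    define h where "h = (\<lambda>z. \<psi> z - \<Psi> (snd z))"
    define S where "S = (\<lambda>x. 2 / H * integral {0..H} (\<lambda>y. h (x, y) * sin (\<eta> * y)))"
    have c1: "continuous_on {0..H} \<Psi>" "continuous_on {0..H} \<Psi>'" "continuous_on {0..H} A" "continuous_on {0..H} B"
      unfolding \<Psi>_def \<Psi>'_def using L
      by (auto simp: A_def B_def intro!: continuous_intros cont_int1 cont_int1[where f = "\<lambda>z. \<psi> z * cos (\<kappa> * fst z)", simplified]
         cont_int1[where f = "\<lambda>z. \<psi> z * sin (\<kappa> * fst z)", simplified])
    note c1[continuous_intros] c1[THEN cont_snd, continuous_intros]
    have ch [continuous_intros]: "continuous_on Q h" unfolding h_def by (intro continuous_intros)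
    have cS [continuous_intros]: "continuous_on {0..L} S"
      unfolding S_def by (intro continuous_intros cont_int2[where f = "\<lambda>z. h z * sin (\<eta> * snd z)", simplified])
    note cS[THEN cont_fst, continuous_intros]
    have d\<Psi>: "(\<Psi> has_real_derivative \<Psi>' y) (at y within {0..H})" if "y \<in> {0..H}" for y
    proof -
      have "((\<lambda>y. integral (cbox 0 L) (\<lambda>x. \<psi> (x, y))) has_real_derivative integral (cbox 0 L) (\<lambda>x. \<psi>y (x, y))) (at y within {0..H})"
        by (rule leibniz_rule_field_derivative[where fx = "\<lambda>y x. \<psi>y (x, y)"])
          (use that sD(5) cont_swap[OF sD(3)] cont_slice1[OF sD(1)] in \<open>auto intro!: integrable_continuous_real\<close>)
      then show ?thesis unfolding \<Psi>_def \<Psi>'_def by (auto intro!: DERIV_cdivide)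
    qed
    have \<Psi>0: "\<Psi> 0 = 0" "\<Psi> H = 0"
    proof -
      have "integral {0..L} (\<lambda>x. \<psi> (x, 0)) = integral {0..L} (\<lambda>x. 0)"
        "integral {0..L} (\<lambda>x. \<psi> (x, H)) = integral {0..L} (\<lambda>x. 0)"
        by (rule integral_cong, simp add: sD(7,8))+
      then show "\<Psi> 0 = 0" "\<Psi> H = 0" by (auto simp: \<Psi>_def)
    qed
    define R1 where "R1 = (\<lambda>z. h z - (A (snd z) * cos (\<kappa> * fst z) + B (snd z) * sin (\<kappa> * fst z)))"
    define R2 where "R2 = (\<lambda>z. h z - S (fst z) * sin (\<eta> * snd z))"
    define a1 where "a1 = 2 / L * integral {0..L} (\<lambda>x. S x * cos (\<kappa> * x))"
    define a2 where "a2 = 2 / L * integral {0..L} (\<lambda>x. S x * sin (\<kappa> * x))"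
    define a3 where "a3 = 2 / H * integral {0..H} (\<lambda>y. \<Psi> y * cos (\<nu> * y))"
    define a4 where "a4 = 2 / H * integral {0..H} (\<lambda>y. \<Psi> y * sin (\<nu> * y))"
    define R3 where "R3 = (\<lambda>y. \<Psi> y - \<mu> - (a3 * cos (\<nu> * y) + a4 * sin (\<nu> * y)))"
    \<comment> \<open>The part of the first x1-harmonics of \<psi> that is not proportional to sin
      (pi x2 / H). As \<open>h\<close> is \<open>R1\<close> plus these harmonics,
      \<open>R1 + R4\<close> is the difference between \<open>h\<close> and the two waves.\<close>
    define R4 where "R4 = (\<lambda>z. (A (snd z) - a1 * sin (\<eta> * snd z)) * cos (\<kappa> * fst z)
        + (B (snd z) - a2 * sin (\<eta> * snd z)) * sin (\<kappa> * fst z))"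
    have cR [continuous_intros]: "continuous_on Q R1" "continuous_on Q R2" "continuous_on Q R4" "continuous_on {0..H} R3"
      unfolding R1_def R2_def R4_def R3_def by (intro continuous_intros)+
    note cR(4)[THEN cont_snd, continuous_intros]
    have I\<Psi>: "integral {0..H} \<Psi> = J \<psi> / L"
      unfolding \<Psi>_def J_iter1[OF sD(1)] by simp
    have step1: "\<kappa>\<^sup>2 * J (\<lambda>z. (h z)\<^sup>2) + 2 * \<kappa>\<^sup>2 * J (\<lambda>z. (R1 z)\<^sup>2) \<le> J (\<lambda>z. (\<psi>x z)\<^sup>2)"
    proof -
      have "J (\<lambda>z. \<kappa>\<^sup>2 * (h z)\<^sup>2 + 2 * \<kappa>\<^sup>2 * (R1 z)\<^sup>2) \<le> J (\<lambda>z. (\<psi>x z)\<^sup>2)"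
      proof (rule J_mono_slice1)
        fix y assume y: "y \<in> {0..H}"
        note cs = cont_slice1[OF _ y]
        have "integral {0..L} (\<lambda>x. \<kappa>\<^sup>2 * (h (x, y))\<^sup>2 + 2 * \<kappa>\<^sup>2 * (R1 (x, y))\<^sup>2)
           = \<kappa>\<^sup>2 * integral {0..L} (\<lambda>x. (h (x, y))\<^sup>2) + 2 * \<kappa>\<^sup>2 * integral {0..L} (\<lambda>x. (R1 (x, y))\<^sup>2)"
          by (subst integral_add) (auto intro!: integrable_continuous_real continuous_intros cs ch cR)
        also have "\<dots> \<le> integral {0..L} (\<lambda>x. (\<psi>x (x, y))\<^sup>2)"
          using wirtinger_periodic_remainder[OF L sD(4)[OF _ y] cs[OF sD(2)] sD(6)[OF y]]
          by (simp add: h_def R1_def \<Psi>_def A_def B_def \<kappa>_def)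
        finally show "integral {0..L} (\<lambda>x. \<kappa>\<^sup>2 * (h (x, y))\<^sup>2 + 2 * \<kappa>\<^sup>2 * (R1 (x, y))\<^sup>2)
           \<le> integral {0..L} (\<lambda>x. (\<psi>x (x, y))\<^sup>2)" .
      qed (intro continuous_intros)+
      then show ?thesis by (subst (asm) J_add) (auto intro!: continuous_intros simp: J_cmult)
    qed
    have step2: "\<eta>\<^sup>2 * J (\<lambda>z. (h z)\<^sup>2) + 2 * \<eta>\<^sup>2 * J (\<lambda>z. (R2 z)\<^sup>2) \<le> J (\<lambda>z. (\<psi>y z - \<Psi>' (snd z))\<^sup>2)"
    proof -
      have "J (\<lambda>z. \<eta>\<^sup>2 * (h z)\<^sup>2 + 2 * \<eta>\<^sup>2 * (R2 z)\<^sup>2) \<le> J (\<lambda>z. (\<psi>y z - \<Psi>' (snd z))\<^sup>2)"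
      proof (rule J_mono_slice2)
        fix x assume x: "x \<in> {0..L}"
        note cs = cont_slice2[OF _ x]
        have dh: "((\<lambda>y. h (x, y)) has_real_derivative \<psi>y (x, y) - \<Psi>' y) (at y within {0..H})" if "y \<in> {0..H}" for y
          unfolding h_def using sD(5)[OF x that] d\<Psi>[OF that] by (auto intro!: derivative_eq_intros)
        have "integral {0..H} (\<lambda>y. \<eta>\<^sup>2 * (h (x, y))\<^sup>2 + 2 * \<eta>\<^sup>2 * (R2 (x, y))\<^sup>2)
           = \<eta>\<^sup>2 * integral {0..H} (\<lambda>y. (h (x, y))\<^sup>2) + 2 * \<eta>\<^sup>2 * integral {0..H} (\<lambda>y. (R2 (x, y))\<^sup>2)"
          by (subst integral_add) (auto intro!: integrable_continuous_real continuous_intros cs ch cR)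
        also have "\<dots> \<le> integral {0..H} (\<lambda>y. (\<psi>y (x, y) - \<Psi>' y)\<^sup>2)"
          using wirtinger_dirichlet_remainder[OF H dh] sD(7,8)[OF x] \<Psi>0
          by (simp add: h_def R2_def S_def \<eta>_def continuous_intros cs sD)
        finally show "integral {0..H} (\<lambda>y. \<eta>\<^sup>2 * (h (x, y))\<^sup>2 + 2 * \<eta>\<^sup>2 * (R2 (x, y))\<^sup>2)
           \<le> integral {0..H} (\<lambda>y. (\<psi>y (x, y) - \<Psi>' (snd (x, y)))\<^sup>2)" by simp
      qed (intro continuous_intros)+
      then show ?thesis by (subst (asm) J_add) (auto intro!: continuous_intros simp: J_cmult)
    qed
    have step3: "\<nu>\<^sup>2 * integral {0..H} (\<lambda>y. (\<Psi> y - \<mu>)\<^sup>2) + 2 * \<nu>\<^sup>2 * integral {0..H} (\<lambda>y. (R3 y)\<^sup>2)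
        \<le> integral {0..H} (\<lambda>y. (\<Psi>' y)\<^sup>2)"
      using wirtinger_periodic_remainder[OF H d\<Psi> c1(2)] \<Psi>0
      by (simp add: R3_def \<mu>_def a3_def a4_def \<nu>_def I\<Psi>)
    have mean_h: "integral {0..L} (\<lambda>x. h (x, y)) = 0" if y: "y \<in> {0..H}" for y
    proof -
      have "integral {0..L} (\<lambda>x. h (x, y)) = integral {0..L} (\<lambda>x. \<psi> (x, y)) - integral {0..L} (\<lambda>x. \<Psi> y)"
        unfolding h_def snd_conv by (intro integral_diff integrable_continuous_real continuous_intros cont_slice1[OF sD(1) y])
      then show ?thesis using L by (simp add: \<Psi>_def)
    qed
    have mean_hy: "integral {0..L} (\<lambda>x. \<psi>y (x, y) - \<Psi>' y) = 0" if y: "y \<in> {0..H}" for y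
    proof -
      have "integral {0..L} (\<lambda>x. \<psi>y (x, y) - \<Psi>' y) = integral {0..L} (\<lambda>x. \<psi>y (x, y)) - integral {0..L} (\<lambda>x. \<Psi>' y)"
        by (intro integral_diff integrable_continuous_real continuous_intros cont_slice1[OF sD(3) y])
      then show ?thesis using L by (simp add: \<Psi>'_def)
    qed
    have pyth_y: "J (\<lambda>z. (\<psi>y z)\<^sup>2) = J (\<lambda>z. (\<psi>y z - \<Psi>' (snd z))\<^sup>2) + L * integral {0..H} (\<lambda>y. (\<Psi>' y)\<^sup>2)"
      using J_pythagoras[of "\<lambda>z. \<psi>y z - \<Psi>' (snd z)" \<Psi>'] by (simp add: mean_hy continuous_intros)
    have pyth_\<phi>: "J (\<lambda>z. (\<psi> z - \<mu>)\<^sup>2) = J (\<lambda>z. (h z)\<^sup>2) + L * integral {0..H} (\<lambda>y. (\<Psi> y - \<mu>)\<^sup>2)"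
      using J_pythagoras[of h "\<lambda>y. \<Psi> y - \<mu>"] by (simp add: mean_h continuous_intros) (simp add: h_def)
    have i_cos: "integral {0..L} (\<lambda>x. cos (\<kappa> * x)) = 0" and i_sin: "integral {0..L} (\<lambda>x. sin (\<kappa> * x)) = 0"
    proof -
      have kl: "\<kappa> * L = 2 * pi" using L by (simp add: \<kappa>_def)
      have "((\<lambda>x. cos (\<kappa> * x)) has_integral sin (\<kappa> * L) / \<kappa> - sin (\<kappa> * 0) / \<kappa>) {0..L}"
        using L pos by (intro fundamental_theorem_of_calculus)
          (auto intro!: derivative_eq_intros simp: has_real_derivative_iff_has_vector_derivative[symmetric])
      then show "integral {0..L} (\<lambda>x. cos (\<kappa> * x)) = 0" unfolding kl by (simp add: integral_unique)
      have "((\<lambda>x. sin (\<kappa> * x)) has_integral (- cos (\<kappa> * L) / \<kappa>) - (- cos (\<kappa> * 0) / \<kappa>)) {0..L}"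
        using L pos by (intro fundamental_theorem_of_calculus)
          (auto intro!: derivative_eq_intros simp: has_real_derivative_iff_has_vector_derivative[symmetric])
      then show "integral {0..L} (\<lambda>x. sin (\<kappa> * x)) = 0" unfolding kl by (simp add: integral_unique)
    qed
    \<comment> \<open>The difference of coefficients is the Fourier coefficient of \<open>R2\<close>
      against \<open>w\<close>: the mean \<Psi> drops out because \<open>w\<close> has mean zero.
      Cauchy-Schwarz then gives the factor (2 / L)^2 times L, that is 4 / L.\<close>
    have coeff: "(2 / L * integral {0..L} (\<lambda>x. \<psi> (x, y) * w x) - 2 / L * integral {0..L} (\<lambda>x. S x * w x) * sin (\<eta> * y))\<^sup>2
       \<le> 4 / L * integral {0..L} (\<lambda>x. (R2 (x, y))\<^sup>2)"
      if y: "y \<in> {0..H}" and w [continuous_intros]: "continuous_on {0..L} w" and w0: "integral {0..L} w = 0"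
        and w1: "\<And>x. \<bar>w x\<bar> \<le> 1" for y w
    proof -
      note cs = cont_slice1[OF _ y]
      have "((\<lambda>x. \<psi> (x, y) * w x - \<Psi> y * w x - sin (\<eta> * y) * (S x * w x)) has_integral
        integral {0..L} (\<lambda>x. \<psi> (x, y) * w x) - \<Psi> y * integral {0..L} w - sin (\<eta> * y) * integral {0..L} (\<lambda>x. S x * w x)) {0..L}"
        by (intro has_integral_diff has_integral_mult_right integrable_integral integrable_continuous_real continuous_intros cs)
      then have "integral {0..L} (\<lambda>x. R2 (x, y) * w x)
          = integral {0..L} (\<lambda>x. \<psi> (x, y) * w x) - sin (\<eta> * y) * integral {0..L} (\<lambda>x. S x * w x)"
        by (simp add: integral_unique R2_def h_def algebra_simps w0)
      then have R2w: "integral {0..L} (\<lambda>x. \<psi> (x, y) * w x) - sin (\<eta> * y) * integral {0..L} (\<lambda>x. S x * w x)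
          = integral {0..L} (\<lambda>x. R2 (x, y) * w x)" ..
      have "(2 / L * u - 2 / L * v * t)\<^sup>2 = 4 / L\<^sup>2 * (u - t * v)\<^sup>2" for u v t
        using L by (simp add: power2_eq_square field_simps)
      then have "(2 / L * integral {0..L} (\<lambda>x. \<psi> (x, y) * w x) - 2 / L * integral {0..L} (\<lambda>x. S x * w x) * sin (\<eta> * y))\<^sup>2
          = 4 / L\<^sup>2 * (integral {0..L} (\<lambda>x. R2 (x, y) * w x))\<^sup>2"
        unfolding R2w[symmetric] .
      also have "\<dots> \<le> 4 / L\<^sup>2 * (integral {0..L} (\<lambda>x. (R2 (x, y))\<^sup>2) * integral {0..L} (\<lambda>x. 1))"
      proof (intro mult_left_mono)
        have "(integral {0..L} (\<lambda>x. R2 (x, y) * w x))\<^sup>2 \<le> integral {0..L} (\<lambda>x. (R2 (x, y))\<^sup>2) * integral {0..L} (\<lambda>x. (w x)\<^sup>2)"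
          by (intro integral_Cauchy_Schwarz integrable_continuous_real continuous_intros cs)
        also have "\<dots> \<le> integral {0..L} (\<lambda>x. (R2 (x, y))\<^sup>2) * integral {0..L} (\<lambda>x. 1)"
          by (intro mult_left_mono integral_le integral_nonneg integrable_continuous_real continuous_intros cs)
            (use w1 in \<open>auto simp: abs_square_le_1\<close>)
        finally show "(integral {0..L} (\<lambda>x. R2 (x, y) * w x))\<^sup>2 \<le> integral {0..L} (\<lambda>x. (R2 (x, y))\<^sup>2) * integral {0..L} (\<lambda>x. 1)" .
      qed simp
      also have "\<dots> = 4 / L * integral {0..L} (\<lambda>x. (R2 (x, y))\<^sup>2)"
        using L by (simp add: power2_eq_square)
      finally show ?thesis .
    qed
    \<comment> \<open>16 is 2 * (4 + 4): the factor 2 for the square of a sum of two terms, and 4 /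
      L times the slice integral of \<open>R2^2\<close> for each of the two coefficients.\<close>
    have step5: "J (\<lambda>z. (R4 z)\<^sup>2) \<le> 16 * J (\<lambda>z. (R2 z)\<^sup>2)"
    proof -
      define G where "G = (\<lambda>y. integral {0..L} (\<lambda>x. (R2 (x, y))\<^sup>2))"
      have cG [continuous_intros]: "continuous_on {0..H} G"
        unfolding G_def by (intro cont_int1 continuous_intros)
      have "J (\<lambda>z. (R4 z)\<^sup>2) \<le> J (\<lambda>z. 16 / L * G (snd z))"
      proof (intro J_mono continuous_intros cont_snd)
        fix z assume "z \<in> Q"
        then have y: "snd z \<in> {0..H}" by auto
        define \<alpha> where "\<alpha> = A (snd z) - a1 * sin (\<eta> * snd z)"
        define \<beta> where "\<beta> = B (snd z) - a2 * sin (\<eta> * snd z)"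
        have \<alpha>: "\<alpha>\<^sup>2 \<le> 4 / L * G (snd z)"
          unfolding \<alpha>_def A_def a1_def G_def
          by (intro coeff y i_cos continuous_intros) (auto simp: abs_cos_le_one)
        have \<beta>: "\<beta>\<^sup>2 \<le> 4 / L * G (snd z)"
          unfolding \<beta>_def B_def a2_def G_def
          by (intro coeff y i_sin continuous_intros) (auto simp: abs_sin_le_one)
        have "(R4 z)\<^sup>2 \<le> 2 * ((\<alpha> * cos (\<kappa> * fst z))\<^sup>2 + (\<beta> * sin (\<kappa> * fst z))\<^sup>2)"
          unfolding R4_def \<alpha>_def[symmetric] \<beta>_def[symmetric]
          using sum_squares_bound[of "\<alpha> * cos (\<kappa> * fst z)" "\<beta> * sin (\<kappa> * fst z)"]
          by (simp add: power2_sum)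
        also have "\<dots> \<le> 2 * (\<alpha>\<^sup>2 * 1 + \<beta>\<^sup>2 * 1)"
          unfolding power_mult_distrib
          by (intro mult_left_mono add_mono) (auto simp: abs_square_le_1)
        also have "\<dots> \<le> 4 * (4 / L * G (snd z))"
        proof -
          have "2 * (u * 1 + v * 1) \<le> 4 * g" if "u \<le> g" "v \<le> g" for u v g :: real using that by simp
          from this[OF \<alpha> \<beta>] show ?thesis .
        qed
        also have "\<dots> = 16 / L * G (snd z)" by simp
        finally show "(R4 z)\<^sup>2 \<le> 16 / L * G (snd z)" .
      qed
      also have "\<dots> = 16 * integral {0..H} G"
        using L by (simp only: J_cmult J_snd[OF cG]) simp
      also have "integral {0..H} G = J (\<lambda>z. (R2 z)\<^sup>2)"
        unfolding G_def by (subst J_iter1) (auto intro!: continuous_intros)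
      finally show ?thesis .
    qed
    let ?I3 = "integral {0..H} (\<lambda>y. (R3 y)\<^sup>2)"
    have step6: "J (\<lambda>z. (\<psi> z - \<mu> - (a1 * cos (\<kappa> * fst z) * sin (\<eta> * snd z) + a2 * sin (\<kappa> * fst z) * sin (\<eta> * snd z)
            + a3 * cos (\<nu> * snd z) + a4 * sin (\<nu> * snd z)))\<^sup>2)
       \<le> 3 * (J (\<lambda>z. (R1 z)\<^sup>2) + J (\<lambda>z. (R4 z)\<^sup>2) + L * ?I3)"
    proof -
      have "J (\<lambda>z. (\<psi> z - \<mu> - (a1 * cos (\<kappa> * fst z) * sin (\<eta> * snd z) + a2 * sin (\<kappa> * fst z) * sin (\<eta> * snd z)
            + a3 * cos (\<nu> * snd z) + a4 * sin (\<nu> * snd z)))\<^sup>2) = J (\<lambda>z. (R1 z + R4 z + R3 (snd z))\<^sup>2)"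
        by (intro J_cong arg_cong[where f = "\<lambda>u. u\<^sup>2"]) (simp add: R1_def R4_def R3_def h_def algebra_simps)
      also have "\<dots> \<le> J (\<lambda>z. 3 * ((R1 z)\<^sup>2 + (R4 z)\<^sup>2 + (R3 (snd z))\<^sup>2))"
      proof (intro J_mono continuous_intros)
        have "(u + v + w)\<^sup>2 \<le> 3 * (u\<^sup>2 + v\<^sup>2 + w\<^sup>2)" for u v w :: real
        proof -
          have "3 * (u\<^sup>2 + v\<^sup>2 + w\<^sup>2) - (u + v + w)\<^sup>2 = (u - v)\<^sup>2 + (v - w)\<^sup>2 + (u - w)\<^sup>2"
            by (simp add: power2_eq_square algebra_simps)
          then show ?thesis by (smt (verit) zero_le_power2)
        qed
        then show "(R1 z + R4 z + R3 (snd z))\<^sup>2 \<le> 3 * ((R1 z)\<^sup>2 + (R4 z)\<^sup>2 + (R3 (snd z))\<^sup>2)" for z by simp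
      qed
      also have "\<dots> = 3 * (J (\<lambda>z. (R1 z)\<^sup>2) + J (\<lambda>z. (R4 z)\<^sup>2) + J (\<lambda>z. (R3 (snd z))\<^sup>2))"
        by (simp only: J_cmult) (subst J_add, (intro continuous_intros)+, subst J_add, (intro continuous_intros)+, simp)
      also have "J (\<lambda>z. (R3 (snd z))\<^sup>2) = L * ?I3"
        by (rule J_snd) (intro continuous_intros)
      finally show ?thesis .
    qed
    have E: "dirichlet \<psi>x \<psi>y = J (\<lambda>z. (\<psi>x z)\<^sup>2) + J (\<lambda>z. (\<psi>y z)\<^sup>2)"
      by (intro J_add continuous_intros)
    have nn: "0 \<le> J (\<lambda>z. (R1 z)\<^sup>2)" "0 \<le> J (\<lambda>z. (R2 z)\<^sup>2)" "0 \<le> L * ?I3"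
        "0 \<le> integral {0..H} (\<lambda>y. (\<Psi> y - \<mu>)\<^sup>2)"
      using L by (auto intro!: J_nonneg mult_nonneg_nonneg integral_nonneg integrable_Q integrable_continuous_real continuous_intros)
    \<comment> \<open>Here the spectral condition enters: the constant \<open>\<nu>^2\<close> of the
      x1-average must not lie below that of the waves. Equality is allowed, because in
      \<open>R3\<close> the modes of wave number \<nu> have already been taken out.\<close>
    have m3: "(\<kappa>\<^sup>2 + \<eta>\<^sup>2) * (L * integral {0..H} (\<lambda>y. (\<Psi> y - \<mu>)\<^sup>2)) + 2 * \<nu>\<^sup>2 * (L * ?I3)
        \<le> L * integral {0..H} (\<lambda>y. (\<Psi>' y)\<^sup>2)"
    proof -
      have "(\<kappa>\<^sup>2 + \<eta>\<^sup>2) * integral {0..H} (\<lambda>y. (\<Psi> y - \<mu>)\<^sup>2) \<le> \<nu>\<^sup>2 * integral {0..H} (\<lambda>y. (\<Psi> y - \<mu>)\<^sup>2)"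
        using spectral nn(4) unfolding \<kappa>_def \<eta>_def \<nu>_def by (rule mult_right_mono)
      then have "(\<kappa>\<^sup>2 + \<eta>\<^sup>2) * integral {0..H} (\<lambda>y. (\<Psi> y - \<mu>)\<^sup>2) + 2 * \<nu>\<^sup>2 * ?I3 \<le> integral {0..H} (\<lambda>y. (\<Psi>' y)\<^sup>2)"
        using step3 by linarith
      from mult_left_mono[OF this less_imp_le[OF L]] show ?thesis by (simp add: algebra_simps)
    qed
    have "c * J (\<lambda>z. (\<psi> z - \<mu> - (a1 * cos (\<kappa> * fst z) * sin (\<eta> * snd z) + a2 * sin (\<kappa> * fst z) * sin (\<eta> * snd z)
            + a3 * cos (\<nu> * snd z) + a4 * sin (\<nu> * snd z)))\<^sup>2)
       \<le> c * (3 * (J (\<lambda>z. (R1 z)\<^sup>2) + 16 * J (\<lambda>z. (R2 z)\<^sup>2) + L * ?I3))"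
      using step5 step6 c(1) by (intro mult_left_mono) auto
    also have "\<dots> = (c * 3) * J (\<lambda>z. (R1 z)\<^sup>2) + (c * 48) * J (\<lambda>z. (R2 z)\<^sup>2) + (c * 3) * (L * ?I3)"
      by (simp add: algebra_simps)
    also have "\<dots> \<le> (2 * \<kappa>\<^sup>2) * J (\<lambda>z. (R1 z)\<^sup>2) + (2 * \<eta>\<^sup>2) * J (\<lambda>z. (R2 z)\<^sup>2) + (2 * \<nu>\<^sup>2) * (L * ?I3)"
      by (intro add_mono mult_right_mono c nn)
    also have "\<dots> \<le> dirichlet \<psi>x \<psi>y - (\<kappa>\<^sup>2 + \<eta>\<^sup>2) * J (\<lambda>z. (\<psi> z - \<mu>)\<^sup>2)"
      using step1 step2 m3 unfolding E pyth_y pyth_\<phi> by (simp add: algebra_simps)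
    finally show "\<exists>a1 a2 a3 a4. c * J (\<lambda>z. (\<psi> z - J \<psi> / (L * H)
         - (a1 * cos (\<kappa> * fst z) * sin (\<eta> * snd z) + a2 * sin (\<kappa> * fst z) * sin (\<eta> * snd z)
            + a3 * cos (\<nu> * snd z) + a4 * sin (\<nu> * snd z)))\<^sup>2)
       \<le> dirichlet \<psi>x \<psi>y - (\<kappa>\<^sup>2 + \<eta>\<^sup>2) * J (\<lambda>z. (\<psi> z - J \<psi> / (L * H))\<^sup>2)"
      unfolding \<mu>_def[symmetric] by blast
  qed
qed

end

subsection \<open>Identification of the limiting vorticity\<close>

text \<open>Powers reduce to harmonics: \<open>u^2\<close> is a constant plus the second harmonic
  \<open>v\<close>, and \<open>v^2\<close> is a constant plus the fourth harmonic \<open>v4\<close>,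
  all of which integrate to zero over a period. The cube integrates to zero because \<open>u\<close>
  changes sign under translation by half a period.\<close>

lemma trig_moments:
  fixes p q r l :: real
  assumes l: "0 < l"
  defines "u \<equiv> \<lambda>x. p * cos (2 * pi / l * x) + q * sin (2 * pi / l * x)"
  shows "integral {0..l} (\<lambda>x. u x + r) = l * r"
    and "integral {0..l} (\<lambda>x. (u x + r)\<^sup>2) = l * ((p\<^sup>2 + q\<^sup>2) / 2 + r\<^sup>2)"
    and "integral {0..l} (\<lambda>x. (u x + r) ^ 3) = l * (r ^ 3 + 3 / 2 * r * (p\<^sup>2 + q\<^sup>2))"
    and "integral {0..l} (\<lambda>x. (u x + r) ^ 4) = l * (r ^ 4 + 3 * r\<^sup>2 * (p\<^sup>2 + q\<^sup>2) + 3 / 8 * (p\<^sup>2 + q\<^sup>2)\<^sup>2)"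
proof -
  define \<kappa> where "\<kappa> = 2 * pi / l"
  have \<kappa>: "\<kappa> \<noteq> 0" "\<kappa> * l = 2 * pi" "\<kappa> * (l / 2) = pi" using l by (auto simp: \<kappa>_def)
  have u: "u = (\<lambda>x. p * cos (\<kappa> * x) + q * sin (\<kappa> * x))" by (simp add: u_def \<kappa>_def)
  have cu [continuous_intros]: "continuous_on S u" for S unfolding u by (intro continuous_intros)
  have mode: "((\<lambda>x. P * cos (real n * (\<kappa> * x)) + R * sin (real n * (\<kappa> * x))) has_integral 0) {0..l}"
    if "0 < n" for P R n
  proof -
    define k where "k = real n * \<kappa>"
    have k: "k \<noteq> 0" using that \<kappa> by (simp add: k_def)
    have kl: "k * l = 2 * real n * pi" using \<kappa>(2) by (simp add: k_def mult_ac)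
    have "((\<lambda>x. P * cos (k * x) + R * sin (k * x)) has_integral
        (P * sin (k * l) / k - R * cos (k * l) / k) - (P * sin (k * 0) / k - R * cos (k * 0) / k)) {0..l}"
      using l k by (intro fundamental_theorem_of_calculus)
        (auto intro!: derivative_eq_intros simp: has_real_derivative_iff_has_vector_derivative[symmetric])
    moreover have "sin (k * l) = 0" "cos (k * l) = 1"
      unfolding kl by (rule sin_2npi cos_2npi)+
    ultimately show ?thesis by (simp add: k_def mult.assoc)
  qed
  define v where "v = (\<lambda>x. (p\<^sup>2 - q\<^sup>2) / 2 * cos (2 * (\<kappa> * x)) + p * q * sin (2 * (\<kappa> * x)))"
  define v4 where "v4 = (\<lambda>x. (((p\<^sup>2 - q\<^sup>2) / 2)\<^sup>2 - (p * q)\<^sup>2) / 2 * cos (4 * (\<kappa> * x))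
      + (p\<^sup>2 - q\<^sup>2) / 2 * (p * q) * sin (4 * (\<kappa> * x)))"
  have sq: "(P * cos y + R * sin y)\<^sup>2 = (P\<^sup>2 + R\<^sup>2) / 2 + ((P\<^sup>2 - R\<^sup>2) / 2 * cos (2 * y) + P * R * sin (2 * y))"
    for P R y :: real
  proof -
    have c: "cos (2 * y) = 2 * (cos y)\<^sup>2 - 1" "sin (2 * y) = 2 * sin y * cos y"
      by (simp_all add: cos_double_cos sin_double)
    have s: "(sin y)\<^sup>2 = 1 - (cos y)\<^sup>2" by (simp add: sin_squared_eq)
    have "(P * cos y + R * sin y)\<^sup>2 = P\<^sup>2 * (cos y)\<^sup>2 + R\<^sup>2 * (sin y)\<^sup>2 + 2 * P * R * sin y * cos y"
      by (simp add: power2_eq_square algebra_simps)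
    then show ?thesis unfolding c s by (simp add: field_simps)
  qed
  have u2: "(u x)\<^sup>2 = (p\<^sup>2 + q\<^sup>2) / 2 + v x" for x unfolding u v_def by (rule sq)
  have v2: "(v x)\<^sup>2 = (p\<^sup>2 + q\<^sup>2)\<^sup>2 / 8 + v4 x" for x
  proof -
    have "(v x)\<^sup>2 = (((p\<^sup>2 - q\<^sup>2) / 2)\<^sup>2 + (p * q)\<^sup>2) / 2 + v4 x"
      unfolding v_def v4_def using sq[of "(p\<^sup>2 - q\<^sup>2) / 2" "2 * (\<kappa> * x)" "p * q"] by simp
    also have "((p\<^sup>2 - q\<^sup>2) / 2)\<^sup>2 + (p * q)\<^sup>2 = (p\<^sup>2 + q\<^sup>2)\<^sup>2 / 4"
      by (simp add: power2_eq_square field_simps)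
    finally show ?thesis by simp
  qed
  have iu: "(u has_integral 0) {0..l}" using mode[of 1 p q] by (simp add: u)
  have iv: "(v has_integral 0) {0..l}" using mode[of 2 "(p\<^sup>2 - q\<^sup>2) / 2" "p * q"] by (simp add: v_def)
  have iv4: "(v4 has_integral 0) {0..l}"
    using mode[of 4 "(((p\<^sup>2 - q\<^sup>2) / 2)\<^sup>2 - (p * q)\<^sup>2) / 2" "(p\<^sup>2 - q\<^sup>2) / 2 * (p * q)"] by (simp add: v4_def)
  have ic: "((\<lambda>x. c) has_integral l * c) {0..l}" for c :: real
    using has_integral_const_real[of c 0 l] l by simp
  have iu3: "((\<lambda>x. (u x) ^ 3) has_integral 0) {0..l}"
  proof -
    have "\<kappa> * (x + l / 2) = \<kappa> * x + pi" for x by (metis \<kappa>(3) distrib_left)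
    then have "u (x + l / 2) = - u x" for x by (simp add: u)
    then have "integral {0..l} (\<lambda>x. (u x) ^ 3) = integral {0..l / 2} (\<lambda>x. 0)"
      using integral_half_shift[of l "\<lambda>x. (u x) ^ 3"] l by (simp add: continuous_intros)
    then show ?thesis
      using integrable_integral[of "\<lambda>x. (u x) ^ 3" "{0..l}"] by (simp add: integrable_continuous_real continuous_intros)
  qed
  show "integral {0..l} (\<lambda>x. u x + r) = l * r"
    using has_integral_add[OF iu ic[of r]] by (simp add: integral_unique)
  have "((\<lambda>x. v x + 2 * r * u x + ((p\<^sup>2 + q\<^sup>2) / 2 + r\<^sup>2)) has_integral 0 + 2 * r * 0 + l * ((p\<^sup>2 + q\<^sup>2) / 2 + r\<^sup>2)) {0..l}"
    by (intro has_integral_add has_integral_mult_right iu iv ic)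
  moreover have "v x + 2 * r * u x + ((p\<^sup>2 + q\<^sup>2) / 2 + r\<^sup>2) = (u x + r)\<^sup>2" for x
    unfolding power2_sum using u2[of x] by simp
  ultimately show "integral {0..l} (\<lambda>x. (u x + r)\<^sup>2) = l * ((p\<^sup>2 + q\<^sup>2) / 2 + r\<^sup>2)"
    by (simp add: integral_unique)
  have "((\<lambda>x. (u x) ^ 3 + 3 * r * v x + 3 * r\<^sup>2 * u x + (r ^ 3 + 3 / 2 * r * (p\<^sup>2 + q\<^sup>2)))
      has_integral 0 + 3 * r * 0 + 3 * r\<^sup>2 * 0 + l * (r ^ 3 + 3 / 2 * r * (p\<^sup>2 + q\<^sup>2))) {0..l}"
    by (intro has_integral_add has_integral_mult_right iu iv iu3 ic)
  moreover have "(u x) ^ 3 + 3 * r * v x + 3 * r\<^sup>2 * u x + (r ^ 3 + 3 / 2 * r * (p\<^sup>2 + q\<^sup>2)) = (u x + r) ^ 3" for x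
  proof -
    have "(u x + r) ^ 3 = (u x) ^ 3 + 3 * r * (u x)\<^sup>2 + 3 * r\<^sup>2 * u x + r ^ 3"
      by (simp add: power2_eq_square power3_eq_cube algebra_simps)
    then show ?thesis unfolding u2 by (simp add: algebra_simps)
  qed
  ultimately show "integral {0..l} (\<lambda>x. (u x + r) ^ 3) = l * (r ^ 3 + 3 / 2 * r * (p\<^sup>2 + q\<^sup>2))"
    by (simp add: integral_unique)
  have "((\<lambda>x. (v4 x + (p\<^sup>2 + q\<^sup>2) * v x) + 4 * r * (u x) ^ 3 + 6 * r\<^sup>2 * v x + 4 * r ^ 3 * u x
        + (r ^ 4 + 3 * r\<^sup>2 * (p\<^sup>2 + q\<^sup>2) + 3 / 8 * (p\<^sup>2 + q\<^sup>2)\<^sup>2))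
      has_integral (0 + (p\<^sup>2 + q\<^sup>2) * 0) + 4 * r * 0 + 6 * r\<^sup>2 * 0 + 4 * r ^ 3 * 0
        + l * (r ^ 4 + 3 * r\<^sup>2 * (p\<^sup>2 + q\<^sup>2) + 3 / 8 * (p\<^sup>2 + q\<^sup>2)\<^sup>2)) {0..l}"
    by (intro has_integral_add has_integral_mult_right iu iv iv4 iu3 ic)
  moreover have "(v4 x + (p\<^sup>2 + q\<^sup>2) * v x) + 4 * r * (u x) ^ 3 + 6 * r\<^sup>2 * v x + 4 * r ^ 3 * u x
        + (r ^ 4 + 3 * r\<^sup>2 * (p\<^sup>2 + q\<^sup>2) + 3 / 8 * (p\<^sup>2 + q\<^sup>2)\<^sup>2) = (u x + r) ^ 4" for x
  proof -
    have "(u x + r) ^ 4 = ((u x)\<^sup>2)\<^sup>2 + 4 * r * (u x) ^ 3 + 6 * r\<^sup>2 * (u x)\<^sup>2 + 4 * r ^ 3 * u x + r ^ 4"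
      by (simp add: power2_eq_square power3_eq_cube power4_eq_xxxx algebra_simps)
    moreover have "((p\<^sup>2 + q\<^sup>2) / 2 + v x)\<^sup>2 = 3 / 8 * (p\<^sup>2 + q\<^sup>2)\<^sup>2 + v4 x + (p\<^sup>2 + q\<^sup>2) * v x"
      unfolding power2_sum[of "(p\<^sup>2 + q\<^sup>2) / 2"] v2 by (simp add: power_divide)
    ultimately show ?thesis unfolding u2 by (simp add: algebra_simps)
  qed
  ultimately show "integral {0..l} (\<lambda>x. (u x + r) ^ 4) = l * (r ^ 4 + 3 * r\<^sup>2 * (p\<^sup>2 + q\<^sup>2) + 3 / 8 * (p\<^sup>2 + q\<^sup>2)\<^sup>2)"
    by (simp add: integral_unique)
qed

lemma tendsto_zero_if_eventually_le:
  fixes f :: "nat \<Rightarrow> real"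
  assumes "\<And>\<theta>. 0 < \<theta> \<Longrightarrow> eventually (\<lambda>n. \<bar>f n\<bar> \<le> \<theta>) sequentially"
  shows "f \<longlonglongrightarrow> 0"
proof (rule tendstoI)
  fix e :: real assume "0 < e"
  from assms[of "e / 2"] this show "eventually (\<lambda>n. dist (f n) 0 < e) sequentially"
    by (auto elim!: eventually_mono)
qed

lemma tendsto_zero_squeeze:
  fixes f g :: "nat \<Rightarrow> real"
  assumes "\<And>n. 0 \<le> f n" "\<And>n. f n \<le> g n" "g \<longlonglongrightarrow> 0"
  shows "f \<longlonglongrightarrow> 0"
  using assms by (intro tendsto_sandwich[of "\<lambda>_. 0" f sequentially g 0]) (auto intro!: always_eventually)

lemma power_diff_bound:
  fixes M :: real
  assumes "0 \<le> M"
  shows "\<exists>C\<ge>0. \<forall>x y. \<bar>x\<bar> \<le> M \<longrightarrow> \<bar>y\<bar> \<le> M \<longrightarrow> \<bar>x ^ n - y ^ n\<bar> \<le> C * \<bar>x - y\<bar>"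
proof (induction n)
  case 0
  then show ?case by (intro exI[of _ 0]) auto
next
  case (Suc n)
  then obtain C where C: "C \<ge> 0" "\<And>x y. \<bar>x\<bar> \<le> M \<Longrightarrow> \<bar>y\<bar> \<le> M \<Longrightarrow> \<bar>x ^ n - y ^ n\<bar> \<le> C * \<bar>x - y\<bar>" by blast
  show ?case
  proof (intro exI[of _ "M * C + M ^ n"] conjI allI impI)
    show "0 \<le> M * C + M ^ n" using assms C by simp
    fix x y assume xy: "\<bar>x\<bar> \<le> M" "\<bar>y\<bar> \<le> M"
    have "x ^ Suc n - y ^ Suc n = x * (x ^ n - y ^ n) + (x - y) * y ^ n" by (simp add: algebra_simps)
    then have "\<bar>x ^ Suc n - y ^ Suc n\<bar> \<le> \<bar>x\<bar> * \<bar>x ^ n - y ^ n\<bar> + \<bar>x - y\<bar> * \<bar>y\<bar> ^ n"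
      by (metis abs_mult abs_triangle_ineq power_abs)
    also have "\<dots> \<le> M * (C * \<bar>x - y\<bar>) + \<bar>x - y\<bar> * M ^ n"
      using C xy assms by (intro add_mono mult_mono power_mono) auto
    finally show "\<bar>x ^ Suc n - y ^ Suc n\<bar> \<le> (M * C + M ^ n) * \<bar>x - y\<bar>" by (simp add: algebra_simps)
  qed
qed

context periodic_cell
begin

text \<open>\<open>a\<close> and \<open>b\<close> are the amplitudes of the given waves,
  \<open>c\<close> that of the x1-independent mode even about the middle of the channel. The odd
  mode sin (2 pi x2 / H) is kept apart, since the impulse removes it before any moment is
  taken.\<close>

definition wave :: "real \<Rightarrow> real \<Rightarrow> real \<Rightarrow> real \<times> real \<Rightarrow> real" where
  "wave a b c z = (a * cos (2 * pi / L * fst z) + b * sin (2 * pi / L * fst z)) * sin (pi / H * snd z)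
     + c * cos (2 * pi / H * snd z)"

lemma cont_wave [continuous_intros]: "continuous_on S (wave a b c)"
  unfolding wave_def by (intro continuous_intros)

text \<open>At fixed x2 this is a trigonometric polynomial in x1 with constant term c cos (2 pi x2 /
  H). Since sin^2 (pi x2 / H) = (1 - cos (2 pi x2 / H)) / 2, what remains in x2 are moments of a
  single cosine. The third moment is the product that rules out a mixture of waves and cosine
  mode.\<close>

lemma wave_moments:
  shows "J (\<lambda>z. (wave a b c z)\<^sup>2) = L * H * ((a\<^sup>2 + b\<^sup>2) / 4 + c\<^sup>2 / 2)"
    and "J (\<lambda>z. (wave a b c z) ^ 3) = - (L * H * (3 / 8 * (a\<^sup>2 + b\<^sup>2) * c))"
    and "J (\<lambda>z. (wave a b c z) ^ 4) = L * H * (9 / 64 * (a\<^sup>2 + b\<^sup>2)\<^sup>2 + 3 / 4 * (a\<^sup>2 + b\<^sup>2) * c\<^sup>2 + 3 / 8 * c ^ 4)"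
proof -
  define R where "R = a\<^sup>2 + b\<^sup>2"
  let ?C = "\<lambda>y. cos (2 * pi / H * y)" and ?s = "\<lambda>y. sin (pi / H * y)"
  have s2: "(?s y)\<^sup>2 = (1 - ?C y) / 2" for y
  proof -
    have "2 * pi / H * y = 2 * (pi / H * y)" by simp
    then show ?thesis by (simp only: cos_double_sin) simp
  qed
  have w: "wave a b c (x, y) = a * ?s y * cos (2 * pi / L * x) + b * ?s y * sin (2 * pi / L * x) + c * ?C y" for x y
    by (simp add: wave_def algebra_simps)
  have R: "(a * ?s y)\<^sup>2 + (b * ?s y)\<^sup>2 = R * ((1 - ?C y) / 2)" for y
    unfolding power_mult_distrib s2 R_def by (simp add: field_simps)
  have hi: "(f has_integral k) {0..H}" if "continuous_on {0..H} f" "integral {0..H} f = k" for f :: "real \<Rightarrow> real" and k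
    using that integrable_integral[OF integrable_continuous_real] by metis
  have i1: "(?C has_integral 0) {0..H}"
    by (intro hi continuous_intros) (use trig_moments(1)[OF H, of 1 0 0] in simp)
  have i2: "((\<lambda>y. (?C y)\<^sup>2) has_integral H / 2) {0..H}"
    by (intro hi continuous_intros) (use trig_moments(2)[OF H, of 1 0 0] in simp)
  have i3: "((\<lambda>y. (?C y) ^ 3) has_integral 0) {0..H}"
    by (intro hi continuous_intros) (use trig_moments(3)[OF H, of 1 0 0] in simp)
  have i4: "((\<lambda>y. (?C y) ^ 4) has_integral 3 / 8 * H) {0..H}"
    by (intro hi continuous_intros) (use trig_moments(4)[OF H, of 1 0 0] in simp)
  have ic: "((\<lambda>x. k) has_integral H * k) {0..H}" for k :: real
    using has_integral_const_real[of k 0 H] H by simp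
  have "J (\<lambda>z. (wave a b c z)\<^sup>2) = integral {0..H} (\<lambda>y. L * (R / 4 - R / 4 * ?C y + c\<^sup>2 * (?C y)\<^sup>2))"
    by (subst J_iter1, intro continuous_intros, rule integral_cong)
      (simp only: w trig_moments(2)[OF L] R, simp add: field_simps)
  also have "\<dots> = L * (H * (R / 4) - R / 4 * 0 + c\<^sup>2 * (H / 2))"
    by (rule integral_unique) (intro has_integral_add has_integral_diff has_integral_mult_right i1 i2 ic)
  finally show "J (\<lambda>z. (wave a b c z)\<^sup>2) = L * H * ((a\<^sup>2 + b\<^sup>2) / 4 + c\<^sup>2 / 2)"
    by (simp add: R_def algebra_simps)
  have "J (\<lambda>z. (wave a b c z) ^ 3) = integral {0..H} (\<lambda>y. L * (c ^ 3 * (?C y) ^ 3 + 3 / 4 * c * R * ?C y - 3 / 4 * c * R * (?C y)\<^sup>2))"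
    by (subst J_iter1, intro continuous_intros, rule integral_cong)
      (simp only: w trig_moments(3)[OF L] R, simp add: field_simps power2_eq_square power3_eq_cube)
  also have "\<dots> = L * (c ^ 3 * 0 + 3 / 4 * c * R * 0 - 3 / 4 * c * R * (H / 2))"
    by (rule integral_unique) (intro has_integral_add has_integral_diff has_integral_mult_right i1 i2 i3)
  finally show "J (\<lambda>z. (wave a b c z) ^ 3) = - (L * H * (3 / 8 * (a\<^sup>2 + b\<^sup>2) * c))"
    by (simp add: R_def algebra_simps)
  have "J (\<lambda>z. (wave a b c z) ^ 4) = integral {0..H} (\<lambda>y. L * (c ^ 4 * (?C y) ^ 4 + 3 / 2 * c\<^sup>2 * R * (?C y)\<^sup>2 - 3 / 2 * c\<^sup>2 * R * (?C y) ^ 3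
       + (3 / 32 * R\<^sup>2 - 3 / 16 * R\<^sup>2 * ?C y + 3 / 32 * R\<^sup>2 * (?C y)\<^sup>2)))"
    by (subst J_iter1, intro continuous_intros, rule integral_cong)
      (simp only: w trig_moments(4)[OF L] R, simp add: field_simps power2_eq_square power3_eq_cube power4_eq_xxxx)
  also have "\<dots> = L * (c ^ 4 * (3 / 8 * H) + 3 / 2 * c\<^sup>2 * R * (H / 2) - 3 / 2 * c\<^sup>2 * R * 0
       + (H * (3 / 32 * R\<^sup>2) - 3 / 16 * R\<^sup>2 * 0 + 3 / 32 * R\<^sup>2 * (H / 2)))"
    by (rule integral_unique) (intro has_integral_add has_integral_diff has_integral_mult_right i1 i2 i3 i4 ic)
  finally show "J (\<lambda>z. (wave a b c z) ^ 4) = L * H * (9 / 64 * (a\<^sup>2 + b\<^sup>2)\<^sup>2 + 3 / 4 * (a\<^sup>2 + b\<^sup>2) * c\<^sup>2 + 3 / 8 * c ^ 4)"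
    by (simp add: R_def algebra_simps)
qed

text \<open>Averaging over x1 removes the waves, and over the channel x2 has zero integral against
  cos (2 pi x2 / H) but not against the sine. The impulse thus reads off the coefficient
  \<open>s\<close> alone.\<close>

lemma wave_mean: "J (wave a b c) = 0"
  and wave_impulse: "J (\<lambda>z. snd z * (wave a b c z + s * sin (2 * pi / H * snd z))) = - (L * H\<^sup>2 / (2 * pi)) * s"
proof -
  let ?C = "\<lambda>y. cos (2 * pi / H * y)" and ?S = "\<lambda>y. sin (2 * pi / H * y)"
  have w: "wave a b c (x, y) = a * sin (pi / H * y) * cos (2 * pi / L * x) + b * sin (pi / H * y) * sin (2 * pi / L * x) + c * ?C y" for x y
    by (simp add: wave_def algebra_simps)
  have x0: "integral {0..L} (\<lambda>x. wave a b c (x, y)) = L * (c * ?C y)" for y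
    unfolding w by (rule trig_moments(1)[OF L])
  have "J (wave a b c) = integral {0..H} (\<lambda>y. L * (c * ?C y))"
    by (subst J_iter1, intro continuous_intros, rule integral_cong) (simp add: x0)
  also have "\<dots> = L * (c * integral {0..H} ?C)" by simp
  also have "integral {0..H} ?C = 0" using trig_moments(1)[OF H, of 1 0 0] by simp
  finally show "J (wave a b c) = 0" by simp
  define \<nu> where "\<nu> = 2 * pi / H"
  have \<nu>: "\<nu> \<noteq> 0" "\<nu> * H = 2 * pi" using H by (auto simp: \<nu>_def)
  have ic: "((\<lambda>y. y * cos (\<nu> * y)) has_integral
     (H * sin (\<nu> * H) / \<nu> + cos (\<nu> * H) / \<nu>\<^sup>2) - (0 * sin (\<nu> * 0) / \<nu> + cos (\<nu> * 0) / \<nu>\<^sup>2)) {0..H}"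
    using H \<nu>(1) by (intro fundamental_theorem_of_calculus)
      (auto intro!: derivative_eq_intros simp: has_real_derivative_iff_has_vector_derivative[symmetric] power2_eq_square add_divide_distrib diff_divide_distrib)
  have isn: "((\<lambda>y. y * sin (\<nu> * y)) has_integral
     (- H * cos (\<nu> * H) / \<nu> + sin (\<nu> * H) / \<nu>\<^sup>2) - (- 0 * cos (\<nu> * 0) / \<nu> + sin (\<nu> * 0) / \<nu>\<^sup>2)) {0..H}"
    using H \<nu>(1) by (intro fundamental_theorem_of_calculus)
      (auto intro!: derivative_eq_intros simp: has_real_derivative_iff_has_vector_derivative[symmetric] power2_eq_square add_divide_distrib diff_divide_distrib)
  have xi: "integral {0..L} (\<lambda>x. y * (wave a b c (x, y) + s * sin (\<nu> * y))) = L * (c * (y * cos (\<nu> * y)) + s * (y * sin (\<nu> * y)))" for y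
  proof -
    have "integral {0..L} (\<lambda>x. wave a b c (x, y) + s * sin (\<nu> * y)) = integral {0..L} (\<lambda>x. wave a b c (x, y)) + integral {0..L} (\<lambda>x. s * sin (\<nu> * y))"
      by (intro integral_add integrable_continuous_real continuous_on_compose2[OF cont_wave[of UNIV]] continuous_intros) auto
    then have "y * integral {0..L} (\<lambda>x. wave a b c (x, y) + s * sin (\<nu> * y)) = L * (c * (y * cos (\<nu> * y)) + s * (y * sin (\<nu> * y)))"
      using L by (simp add: x0 \<nu>_def algebra_simps)
    then show ?thesis by (simp only: integral_mult_right)
  qed
  have "J (\<lambda>z. snd z * (wave a b c z + s * sin (\<nu> * snd z))) = integral {0..H} (\<lambda>y. L * (c * (y * cos (\<nu> * y)) + s * (y * sin (\<nu> * y))))"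
    by (subst J_iter1, intro continuous_intros, rule integral_cong) (simp only: fst_conv snd_conv xi)
  also have "\<dots> = L * (c * 0 + s * (- H / \<nu>))"
    using ic isn unfolding \<nu>(2) by (intro integral_unique has_integral_mult_right has_integral_add) auto
  finally show "J (\<lambda>z. snd z * (wave a b c z + s * sin (2 * pi / H * snd z))) = - (L * H\<^sup>2 / (2 * pi)) * s"
    unfolding \<nu>_def using H by (simp add: power2_eq_square)
qed

lemma abs_wave_le: "\<bar>wave a b c z\<bar> \<le> \<bar>a\<bar> + \<bar>b\<bar> + \<bar>c\<bar>"
proof -
  have m: "\<bar>k * t\<bar> \<le> \<bar>k\<bar>" if "\<bar>t\<bar> \<le> 1" for k t :: real
    using mult_left_mono[OF that, of "\<bar>k\<bar>"] by (simp add: abs_mult)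
  have "\<bar>wave a b c z\<bar> \<le> \<bar>(a * cos (2 * pi / L * fst z) + b * sin (2 * pi / L * fst z)) * sin (pi / H * snd z)\<bar>
      + \<bar>c * cos (2 * pi / H * snd z)\<bar>"
    unfolding wave_def by (rule abs_triangle_ineq)
  also have "\<dots> \<le> \<bar>a * cos (2 * pi / L * fst z) + b * sin (2 * pi / L * fst z)\<bar> + \<bar>c\<bar>"
    by (intro add_mono m) auto
  also have "\<bar>a * cos (2 * pi / L * fst z) + b * sin (2 * pi / L * fst z)\<bar> \<le> \<bar>a\<bar> + \<bar>b\<bar>"
    by (rule order_trans[OF abs_triangle_ineq]) (intro add_mono m, auto)
  finally show ?thesis by simp
qed


section \<open>Null sequences in L^p and the approach to the null space\<close>

lemma J_abs_le_sqrt: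
  assumes [continuous_intros]: "continuous_on Q f"
  shows "J (\<lambda>z. \<bar>f z\<bar>) \<le> sqrt (L * H * J (\<lambda>z. (f z)\<^sup>2))"
proof -
  have "(J (\<lambda>z. 1 * \<bar>f z\<bar>))\<^sup>2 \<le> J (\<lambda>z. 1\<^sup>2) * J (\<lambda>z. \<bar>f z\<bar>\<^sup>2)"
    by (intro J_Cauchy_Schwarz continuous_intros)
  then show ?thesis using J_const[of 1] by (intro real_le_rsqrt) simp
qed

lemma J_square_sum_le:
  assumes [continuous_intros]: "continuous_on Q f" "continuous_on Q g"
  shows "J (\<lambda>z. (f z + g z)\<^sup>2) \<le> 2 * J (\<lambda>z. (f z)\<^sup>2) + 2 * J (\<lambda>z. (g z)\<^sup>2)"
proof -
  have "J (\<lambda>z. (f z + g z)\<^sup>2) \<le> J (\<lambda>z. 2 * (f z)\<^sup>2 + 2 * (g z)\<^sup>2)"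
  proof (intro J_mono continuous_intros)
    show "(f z + g z)\<^sup>2 \<le> 2 * (f z)\<^sup>2 + 2 * (g z)\<^sup>2" for z
      using sum_squares_bound[of "f z" "g z"] by (simp add: power2_sum)
  qed
  also have "\<dots> = 2 * J (\<lambda>z. (f z)\<^sup>2) + 2 * J (\<lambda>z. (g z)\<^sup>2)"
    by (subst J_add) (auto intro!: continuous_intros simp: J_cmult)
  finally show ?thesis .
qed

lemma cont_powr: "0 < p \<Longrightarrow> continuous_on S f \<Longrightarrow> continuous_on S (\<lambda>z. \<bar>f z\<bar> powr p)" for f :: "real \<times> real \<Rightarrow> real"
  by (intro continuous_on_powr' continuous_intros) auto

text \<open>Young's inequality with first factor 1 stands in for Hoelder's inequality on the bounded
  cell.\<close>

lemma J_abs_tendsto_zero: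
  assumes p: "1 < p" and c: "\<And>n. continuous_on Q (\<rho> n)"
    and lim: "(\<lambda>n. J (\<lambda>z. \<bar>\<rho> n z\<bar> powr p)) \<longlonglongrightarrow> 0"
  shows "(\<lambda>n. J (\<lambda>z. \<bar>\<rho> n z\<bar>)) \<longlonglongrightarrow> 0"
proof (rule tendsto_zero_if_eventually_le)
  fix \<theta> :: real assume \<theta>: "0 < \<theta>"
  obtain m where m: "p / (p - 1) \<le> real m" using real_arch_simple by blast
  define \<tau> where "\<tau> = \<theta> / (4 * (L * H))"
  have \<tau>: "0 < \<tau>" "\<tau> * (2 * (L * H)) = \<theta> / 2" using \<theta> L H by (auto simp: \<tau>_def)
  have bd: "J (\<lambda>z. \<bar>\<rho> n z\<bar>) \<le> \<theta> / 2 + \<tau> powr (1 - p) * J (\<lambda>z. \<bar>\<rho> n z\<bar> powr p)" for n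
  proof -
    note cp = cont_powr[of p, OF _ c]
    have "J (\<lambda>z. \<bar>\<rho> n z\<bar>) \<le> J (\<lambda>z. \<tau> * 2 + \<tau> powr (1 - p) * \<bar>\<rho> n z\<bar> powr p)"
      using abs_mult_le_Young[OF p \<tau>(1) m, of 1] p
      by (intro J_mono continuous_intros c cp) auto
    also have "\<dots> = J (\<lambda>z. \<tau> * 2) + \<tau> powr (1 - p) * J (\<lambda>z. \<bar>\<rho> n z\<bar> powr p)"
      using p by (subst J_add) (auto intro!: continuous_intros cp simp: J_cmult)
    also have "J (\<lambda>z. \<tau> * 2) = \<theta> / 2" using \<tau>(2) by (simp add: J_const)
    finally show ?thesis .
  qed
  have "(\<lambda>n. \<tau> powr (1 - p) * J (\<lambda>z. \<bar>\<rho> n z\<bar> powr p)) \<longlonglongrightarrow> \<tau> powr (1 - p) * 0"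
    by (intro tendsto_intros lim)
  then have "eventually (\<lambda>n. \<tau> powr (1 - p) * J (\<lambda>z. \<bar>\<rho> n z\<bar> powr p) < \<theta> / 2) sequentially"
    by (rule order_tendstoD) (use \<theta> in simp)
  then show "eventually (\<lambda>n. \<bar>J (\<lambda>z. \<bar>\<rho> n z\<bar>)\<bar> \<le> \<theta>) sequentially"
  proof eventually_elim
    case (elim n)
    have "0 \<le> J (\<lambda>z. \<bar>\<rho> n z\<bar>)" by (intro J_nonneg continuous_intros c) auto
    then show ?case using bd[of n] elim by linarith
  qed
qed

lemma pairing_tendsto_zero:
  assumes p: "1 < p" and c: "\<And>n. continuous_on Q (\<rho> n)"
    and lim: "(\<lambda>n. J (\<lambda>z. \<bar>\<rho> n z\<bar> powr p)) \<longlonglongrightarrow> 0"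
    and s: "\<And>n. stream_fun (\<psi> n) (\<psi>x n) (\<psi>y n)"
    and K: "\<And>n. dirichlet (\<psi>x n) (\<psi>y n) \<le> K"
  shows "(\<lambda>n. J (\<lambda>z. \<bar>\<psi> n z * \<rho> n z\<bar>)) \<longlonglongrightarrow> 0"
proof (rule tendsto_zero_if_eventually_le)
  fix \<theta> :: real assume \<theta>: "0 < \<theta>"
  define K' where "K' = max K 1"
  have K': "K \<le> K'" "0 < K'" by (auto simp: K'_def)
  define \<theta>' where "\<theta>' = \<theta> / sqrt K'"
  have \<theta>': "0 < \<theta>'" "\<theta>' * sqrt K' = \<theta>" using \<theta> K' by (auto simp: \<theta>'_def)
  obtain \<delta> where \<delta>: "0 < \<delta>" and pair: "\<And>\<rho> \<psi> \<psi>x \<psi>y. continuous_on Q \<rho> \<Longrightarrow> stream_fun \<psi> \<psi>x \<psi>y \<Longrightarrow>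
     J (\<lambda>z. \<bar>\<rho> z\<bar> powr p) < \<delta> \<Longrightarrow> J (\<lambda>z. \<bar>\<psi> z * \<rho> z\<bar>) \<le> \<theta>' * sqrt (dirichlet \<psi>x \<psi>y)"
    using pairing_small[OF p \<theta>'(1)] by blast
  from order_tendstoD(2)[OF lim \<delta>]
  show "eventually (\<lambda>n. \<bar>J (\<lambda>z. \<bar>\<psi> n z * \<rho> n z\<bar>)\<bar> \<le> \<theta>) sequentially"
  proof eventually_elim
    case (elim n)
    have "J (\<lambda>z. \<bar>\<psi> n z * \<rho> n z\<bar>) \<le> \<theta>' * sqrt (dirichlet (\<psi>x n) (\<psi>y n))"
      by (rule pair[OF c s elim])
    also have "\<dots> \<le> \<theta>' * sqrt K'" using K[of n] K' \<theta>' by (intro mult_left_mono real_sqrt_le_mono) auto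
    finally have "J (\<lambda>z. \<bar>\<psi> n z * \<rho> n z\<bar>) \<le> \<theta>" by (simp add: \<theta>')
    moreover have "0 \<le> J (\<lambda>z. \<bar>\<psi> n z * \<rho> n z\<bar>)"
      by (intro J_nonneg continuous_intros c stream_funD(1)[OF s]) auto
    ultimately show ?case by simp
  qed
qed

text \<open>Let \<phi> be \<psi> minus its mean, X the Dirichlet integral and \<Lambda> the
  eigenvalue. Up to errors that tend to zero, J (g^2) - \<Lambda> X is the sum of J ((g - \<Lambda>
  \<phi>)^2) and \<Lambda> times the Poincare deficit X - \<Lambda> J (\<phi>^2). Both summands are
  nonnegative, so both tend to zero: \<open>g\<close> approaches \<Lambda> \<phi>, and \<phi>
  approaches the span of the four modes.\<close>

lemma kernel_approximation:
  assumes spectral: "(2 * pi / L)\<^sup>2 + (pi / H)\<^sup>2 \<le> (2 * pi / H)\<^sup>2" and p: "1 < p"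
    and s: "\<And>n. stream_fun (\<psi> n) (\<psi>x n) (\<psi>y n)"
    and cg: "\<And>n. continuous_on Q (g n)" and cr: "\<And>n. continuous_on Q (r n)"
    and K: "\<And>n. dirichlet (\<psi>x n) (\<psi>y n) \<le> K"
    and energy: "\<And>n. dirichlet (\<psi>x n) (\<psi>y n) = J (\<lambda>z. \<psi> n z * (g n z + r n z))"
    and lim1: "(\<lambda>n. J (\<lambda>z. (g n z)\<^sup>2) - ((2 * pi / L)\<^sup>2 + (pi / H)\<^sup>2) * dirichlet (\<psi>x n) (\<psi>y n)) \<longlonglongrightarrow> 0"
    and lim2: "(\<lambda>n. J (\<lambda>z. g n z + r n z)) \<longlonglongrightarrow> 0"
    and lim3: "(\<lambda>n. J (\<lambda>z. \<bar>r n z\<bar> powr p)) \<longlonglongrightarrow> 0"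
  shows "\<exists>a b c d. (\<lambda>n. J (\<lambda>z. (g n z - (wave (a n) (b n) (c n) z + d n * sin (2 * pi / H * snd z)))\<^sup>2)) \<longlonglongrightarrow> 0"
proof -
  define \<Lambda> where "\<Lambda> = (2 * pi / L)\<^sup>2 + (pi / H)\<^sup>2"
  have \<Lambda>: "0 < \<Lambda>" using L by (auto simp: \<Lambda>_def intro!: add_pos_nonneg)
  define X where "X = (\<lambda>n. dirichlet (\<psi>x n) (\<psi>y n))"
  define \<mu> where "\<mu> = (\<lambda>n. J (\<psi> n) / (L * H))"
  define \<phi> where "\<phi> = (\<lambda>n z. \<psi> n z - \<mu> n)"
  define P where "P = (\<lambda>a1 a2 a3 a4 z. a1 * cos (2 * pi / L * fst z) * sin (pi / H * snd z) + a2 * sin (2 * pi / L * fst z) * sin (pi / H * snd z)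
            + a3 * cos (2 * pi / H * snd z) + a4 * sin (2 * pi / H * snd z))"
  note cs = stream_funD(1)[OF s]
  have c\<phi> [continuous_intros]: "continuous_on Q (\<phi> n)" for n unfolding \<phi>_def by (intro continuous_intros cs)
  note cg [continuous_intros] cr [continuous_intros] cs [continuous_intros]
  have cP [continuous_intros]: "continuous_on Q (P a1 a2 a3 a4)" for a1 a2 a3 a4
    unfolding P_def by (intro continuous_intros)
  from poincare_deficit[OF spectral]
  obtain c0 where c0: "0 < c0" and deficit: "\<forall>\<psi> \<psi>x \<psi>y. stream_fun \<psi> \<psi>x \<psi>y \<longrightarrow> (\<exists>a1 a2 a3 a4.
     c0 * J (\<lambda>z. (\<psi> z - J \<psi> / (L * H) - P a1 a2 a3 a4 z)\<^sup>2)
     \<le> dirichlet \<psi>x \<psi>y - \<Lambda> * J (\<lambda>z. (\<psi> z - J \<psi> / (L * H))\<^sup>2))"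
    unfolding P_def \<Lambda>_def by (elim exE conjE)
  have "\<exists>a1 a2 a3 a4. c0 * J (\<lambda>z. (\<phi> n z - P a1 a2 a3 a4 z)\<^sup>2) \<le> X n - \<Lambda> * J (\<lambda>z. (\<phi> n z)\<^sup>2)" for n
    using deficit[rule_format, OF s[of n]] unfolding \<phi>_def \<mu>_def X_def .
  then have deficit': "\<forall>n. \<exists>a1 a2 a3 a4. c0 * J (\<lambda>z. (\<phi> n z - P a1 a2 a3 a4 z)\<^sup>2) \<le> X n - \<Lambda> * J (\<lambda>z. (\<phi> n z)\<^sup>2)" ..
  obtain a1 a2 a3 a4 where "\<forall>n. c0 * J (\<lambda>z. (\<phi> n z - P (a1 n) (a2 n) (a3 n) (a4 n) z)\<^sup>2) \<le> X n - \<Lambda> * J (\<lambda>z. (\<phi> n z)\<^sup>2)"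
    using deficit'[unfolded choice_iff]
    apply (elim exE)
    subgoal premises prems by (rule prems(1)[OF prems(2)])
    done
  then have def: "c0 * J (\<lambda>z. (\<phi> n z - P (a1 n) (a2 n) (a3 n) (a4 n) z)\<^sup>2) \<le> X n - \<Lambda> * J (\<lambda>z. (\<phi> n z)\<^sup>2)" for n ..
  obtain D where bD: "\<And>\<psi> \<psi>x \<psi>y. stream_fun \<psi> \<psi>x \<psi>y \<Longrightarrow>
     J (\<lambda>z. (\<psi> z)\<^sup>2) \<le> D * dirichlet \<psi>x \<psi>y" and D: "0 \<le> D"
    using power_integral_bound[of 1] by auto
  \<comment> \<open>The means of \<psi> stay bounded because the energies do, so that their product
    with a null sequence is again a null sequence.\<close>
  define B where "B = sqrt (L * H * (D * K)) / (L * H)"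
  have \<mu>B: "\<bar>\<mu> n\<bar> \<le> B" for n
  proof -
    have "\<bar>J (\<psi> n)\<bar> \<le> sqrt (L * H * J (\<lambda>z. (\<psi> n z)\<^sup>2))"
      by (rule order_trans[OF J_abs_le J_abs_le_sqrt]) (intro cs)+
    also have "\<dots> \<le> sqrt (L * H * (D * K))"
      using L H D K[of n] by (intro real_sqrt_le_mono mult_left_mono order_trans[OF bD[OF s]]) auto
    finally show ?thesis using L H unfolding \<mu>_def B_def by (simp add: divide_right_mono)
  qed
  \<comment> \<open>The corrections arise from replacing \<psi> by \<phi> and \<open>g + r\<close>
    by \<open>g\<close> in the energy: they are the mean of \<psi> times the integral of
    \<open>g\<close>, and the pairing of \<psi> with \<open>r\<close>.\<close>
  define E where "E = (\<lambda>n. (J (\<lambda>z. (g n z)\<^sup>2) - \<Lambda> * X n)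
      + 2 * \<Lambda> * (\<mu> n * (J (\<lambda>z. g n z + r n z) - J (r n)) + J (\<lambda>z. \<psi> n z * r n z)))"
  have Jr: "(\<lambda>n. J (r n)) \<longlonglongrightarrow> 0"
    by (rule Lim_null_comparison[OF always_eventually J_abs_tendsto_zero[OF p cr lim3]])
      (simp add: J_abs_le cr)
  have J\<psi>r: "(\<lambda>n. J (\<lambda>z. \<psi> n z * r n z)) \<longlonglongrightarrow> 0"
    by (rule Lim_null_comparison[OF always_eventually pairing_tendsto_zero[OF p cr lim3 s K]])
      (auto intro!: J_abs_le continuous_intros)
  have "(\<lambda>n. J (\<lambda>z. g n z + r n z) - J (r n)) \<longlonglongrightarrow> 0" using tendsto_diff[OF lim2 Jr] by simp
  then have "(\<lambda>n. B * \<bar>J (\<lambda>z. g n z + r n z) - J (r n)\<bar>) \<longlonglongrightarrow> 0"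
    by (intro tendsto_mult_right_zero tendsto_rabs_zero)
  then have "(\<lambda>n. \<mu> n * (J (\<lambda>z. g n z + r n z) - J (r n))) \<longlonglongrightarrow> 0"
    by (rule Lim_null_comparison[rotated]) (auto simp: abs_mult intro!: always_eventually mult_right_mono \<mu>B)
  from tendsto_add[OF lim1 tendsto_mult_right_zero[OF tendsto_add_zero[OF this J\<psi>r], of "2 * \<Lambda>"]]
  have E0: "E \<longlonglongrightarrow> 0" unfolding E_def X_def \<Lambda>_def by simp
  have main: "J (\<lambda>z. (g n z - \<Lambda> * \<phi> n z)\<^sup>2) = E n - \<Lambda> * (X n - \<Lambda> * J (\<lambda>z. (\<phi> n z)\<^sup>2))" for n
  proof -
    have "J (\<lambda>z. (g n z - \<Lambda> * \<phi> n z)\<^sup>2) = J (\<lambda>z. (g n z)\<^sup>2 - (2 * \<Lambda> * (g n z * \<phi> n z) - \<Lambda>\<^sup>2 * (\<phi> n z)\<^sup>2))"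
      by (intro J_cong) (simp add: power2_eq_square algebra_simps)
    also have "\<dots> = J (\<lambda>z. (g n z)\<^sup>2) - (2 * \<Lambda> * J (\<lambda>z. g n z * \<phi> n z) - \<Lambda>\<^sup>2 * J (\<lambda>z. (\<phi> n z)\<^sup>2))"
      by (subst J_diff, (intro continuous_intros)+, subst J_diff, (intro continuous_intros)+, simp only: J_cmult)
    also have "J (\<lambda>z. g n z * \<phi> n z) = J (\<lambda>z. \<psi> n z * (g n z + r n z) - (\<psi> n z * r n z + \<mu> n * (g n z + r n z - r n z)))"
      by (intro J_cong) (simp add: \<phi>_def algebra_simps)
    also have "\<dots> = J (\<lambda>z. \<psi> n z * (g n z + r n z)) - (J (\<lambda>z. \<psi> n z * r n z) + \<mu> n * (J (\<lambda>z. g n z + r n z) - J (r n)))"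
      by (subst J_diff, (intro continuous_intros)+, subst J_add, (intro continuous_intros)+, simp only: J_cmult,
          subst J_diff, (intro continuous_intros)+, simp)
    also have "J (\<lambda>z. \<psi> n z * (g n z + r n z)) = X n" using energy by (simp add: X_def)
    finally show ?thesis by (simp add: E_def power2_eq_square algebra_simps)
  qed
  let ?V = "\<lambda>n. J (\<lambda>z. (g n z - \<Lambda> * P (a1 n) (a2 n) (a3 n) (a4 n) z)\<^sup>2)"
  have V: "?V n \<le> (2 + 2 * \<Lambda> / c0) * E n" for n
  proof -
    let ?d = "J (\<lambda>z. (\<phi> n z - P (a1 n) (a2 n) (a3 n) (a4 n) z)\<^sup>2)" and ?G = "J (\<lambda>z. (g n z - \<Lambda> * \<phi> n z)\<^sup>2)"
    let ?def = "X n - \<Lambda> * J (\<lambda>z. (\<phi> n z)\<^sup>2)"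
    have nn: "0 \<le> ?d" "0 \<le> ?G" by (auto intro!: J_nonneg continuous_intros)
    have d0: "0 \<le> c0 * ?d" using nn c0 by simp
    have dd: "c0 * ?d \<le> ?def" by (rule def)
    have "0 \<le> ?def" using d0 dd by linarith
    then have G: "?G \<le> E n" using main[of n] \<Lambda> by simp
    have "\<Lambda> * ?def \<le> E n" using main[of n] nn by simp
    with mult_left_mono[OF dd less_imp_le[OF \<Lambda>]] have "\<Lambda> * (c0 * ?d) \<le> E n" by linarith
    then have "\<Lambda> * ?d \<le> E n / c0" using c0 by (simp add: field_simps)
    from mult_left_mono[OF this less_imp_le[OF \<Lambda>]] have d: "\<Lambda>\<^sup>2 * ?d \<le> \<Lambda> / c0 * E n"
      by (simp add: power2_eq_square mult_ac)
    have "?V n = J (\<lambda>z. ((g n z - \<Lambda> * \<phi> n z) + \<Lambda> * (\<phi> n z - P (a1 n) (a2 n) (a3 n) (a4 n) z))\<^sup>2)"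
      by (intro J_cong) (simp add: algebra_simps)
    also have "\<dots> \<le> 2 * ?G + 2 * J (\<lambda>z. (\<Lambda> * (\<phi> n z - P (a1 n) (a2 n) (a3 n) (a4 n) z))\<^sup>2)"
      by (intro J_square_sum_le continuous_intros)
    also have "J (\<lambda>z. (\<Lambda> * (\<phi> n z - P (a1 n) (a2 n) (a3 n) (a4 n) z))\<^sup>2) = \<Lambda>\<^sup>2 * ?d"
      by (simp only: power_mult_distrib J_cmult)
    finally have "?V n \<le> 2 * ?G + 2 * (\<Lambda>\<^sup>2 * ?d)" .
    also have "\<dots> \<le> 2 * E n + 2 * (\<Lambda> / c0 * E n)" using G d by (intro add_mono mult_left_mono) auto
    also have "\<dots> = (2 + 2 * \<Lambda> / c0) * E n" by (simp add: distrib_right)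
    finally show ?thesis .
  qed
  have "(\<lambda>n. (2 + 2 * \<Lambda> / c0) * E n) \<longlonglongrightarrow> 0" using E0 by (intro tendsto_mult_right_zero)
  then have "?V \<longlonglongrightarrow> 0"
    by (rule tendsto_zero_squeeze[rotated 2])
      (auto intro!: V J_nonneg continuous_intros)
  moreover have "\<Lambda> * P (a1 n) (a2 n) (a3 n) (a4 n) z = wave (\<Lambda> * a1 n) (\<Lambda> * a2 n) (\<Lambda> * a3 n) z + \<Lambda> * a4 n * sin (2 * pi / H * snd z)" for n z
    by (simp add: P_def wave_def algebra_simps)
  ultimately show ?thesis
    by (intro exI[of _ "\<lambda>n. \<Lambda> * a1 n"] exI[of _ "\<lambda>n. \<Lambda> * a2 n"] exI[of _ "\<lambda>n. \<Lambda> * a3 n"] exI[of _ "\<lambda>n. \<Lambda> * a4 n"]) simp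
qed

lemma J_power_diff_tendsto_zero:
  assumes f: "\<And>n. continuous_on Q (f n)" and h: "\<And>n. continuous_on Q (h n)"
    and bf: "\<And>n z. z \<in> Q \<Longrightarrow> \<bar>f n z\<bar> \<le> M" and bh: "\<And>n z. z \<in> Q \<Longrightarrow> \<bar>h n z\<bar> \<le> M"
    and lim: "(\<lambda>n. J (\<lambda>z. \<bar>f n z - h n z\<bar>)) \<longlonglongrightarrow> 0"
  shows "(\<lambda>n. J (\<lambda>z. (f n z) ^ k) - J (\<lambda>z. (h n z) ^ k)) \<longlonglongrightarrow> 0"
proof -
  note f [continuous_intros] h [continuous_intros]
  have "0 \<le> M" using bf[of "(0, 0)" 0] L H by (simp add: order_trans[OF abs_ge_zero])
  then obtain C where C: "\<And>x y. \<bar>x\<bar> \<le> M \<Longrightarrow> \<bar>y\<bar> \<le> M \<Longrightarrow> \<bar>x ^ k - y ^ k\<bar> \<le> C * \<bar>x - y\<bar>"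
    using power_diff_bound[of M k] by blast
  have "\<bar>J (\<lambda>z. (f n z) ^ k) - J (\<lambda>z. (h n z) ^ k)\<bar> \<le> C * J (\<lambda>z. \<bar>f n z - h n z\<bar>)" for n
  proof -
    have "J (\<lambda>z. (f n z) ^ k) - J (\<lambda>z. (h n z) ^ k) = J (\<lambda>z. (f n z) ^ k - (h n z) ^ k)"
      by (intro J_diff[symmetric] continuous_intros)
    also have "\<bar>\<dots>\<bar> \<le> J (\<lambda>z. \<bar>(f n z) ^ k - (h n z) ^ k\<bar>)" by (intro J_abs_le continuous_intros)
    also have "\<dots> \<le> J (\<lambda>z. C * \<bar>f n z - h n z\<bar>)" by (intro J_mono continuous_intros C bf bh)
    finally show ?thesis by (simp only: J_cmult)
  qed
  then show ?thesis
    by (intro Lim_null_comparison[OF always_eventually tendsto_mult_right_zero[OF lim, of C]]) simp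
qed

end

text \<open>With \<open>u = c\<^sup>2\<close>, the second and fourth moments give \<open>u (x - u) \<rightarrow> 0\<close>, the third one gives \<open>x\<^sup>2 u \<rightarrow> 0\<close>, and
  \<open>u\<^sup>3 = x\<^sup>2 u - u (x - u) (x + u)\<close>.\<close>

lemma circle_moment_limit:
  fixes x c :: "nat \<Rightarrow> real"
  assumes x: "\<And>n. 0 \<le> x n"
    and m2: "(\<lambda>n. x n / 4 + (c n)\<^sup>2 / 2) \<longlonglongrightarrow> A\<^sup>2 / 4"
    and m3: "(\<lambda>n. x n * c n) \<longlonglongrightarrow> 0"
    and m4: "(\<lambda>n. 9 / 64 * (x n)\<^sup>2 + 3 / 4 * x n * (c n)\<^sup>2 + 3 / 8 * (c n) ^ 4) \<longlonglongrightarrow> 9 / 64 * (A\<^sup>2)\<^sup>2"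
  shows "x \<longlonglongrightarrow> A\<^sup>2" and "(\<lambda>n. (c n)\<^sup>2) \<longlonglongrightarrow> 0"
proof -
  define u where "u = (\<lambda>n. (c n)\<^sup>2)"
  define T where "T = (\<lambda>n. x n + 2 * u n)"
  have u: "0 \<le> u n" for n by (simp add: u_def)
  have T: "T \<longlonglongrightarrow> A\<^sup>2"
    using tendsto_mult_left[OF m2, of 4] by (simp add: T_def u_def algebra_simps)
  have e: "(\<lambda>n. u n * (x n - u n)) \<longlonglongrightarrow> 0"
  proof -
    \<comment> \<open>The multiples 64 and 9 make the terms with \<open>(x n)^2\<close> cancel; what
      is left is 12 u (x - u).\<close>
    have "(\<lambda>n. 64 * (9 / 64 * (x n)\<^sup>2 + 3 / 4 * x n * (c n)\<^sup>2 + 3 / 8 * (c n) ^ 4) - 9 * (T n)\<^sup>2)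
        \<longlonglongrightarrow> 64 * (9 / 64 * (A\<^sup>2)\<^sup>2) - 9 * (A\<^sup>2)\<^sup>2"
      by (intro tendsto_intros m4 T)
    moreover have "64 * (9 / 64 * (x n)\<^sup>2 + 3 / 4 * x n * (c n)\<^sup>2 + 3 / 8 * (c n) ^ 4) - 9 * (T n)\<^sup>2 = 12 * (u n * (x n - u n))" for n
    proof -
      have "(c n) ^ 4 = (u n)\<^sup>2" by (simp add: u_def power_mult[symmetric])
      then show ?thesis by (simp add: T_def u_def[symmetric] power2_eq_square algebra_simps) (simp add: u_def power2_eq_square)
    qed
    ultimately have "(\<lambda>n. 12 * (u n * (x n - u n))) \<longlonglongrightarrow> 0" by simp
    from tendsto_mult_right_zero[OF this, of "1 / 12"] show ?thesis by simp
  qed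
  have "(\<lambda>n. (x n * c n)\<^sup>2 - u n * (x n - u n) * T n + u n * (x n - u n) * u n) \<longlonglongrightarrow> 0"
  proof -
    have "(\<lambda>n. \<bar>u n * (x n - u n)\<bar> * T n) \<longlonglongrightarrow> 0 * A\<^sup>2"
      by (intro tendsto_mult T tendsto_rabs_zero e)
    then have l: "(\<lambda>n. \<bar>u n * (x n - u n)\<bar> * T n) \<longlonglongrightarrow> 0" by simp
    \<comment> \<open>Since \<open>x n\<close> is nonnegative, the convergent sequence
      \<open>T\<close> dominates \<open>u\<close>, so boundedness of \<open>u\<close> needs no
      separate argument.\<close>
    have "norm (u n * (x n - u n) * u n) \<le> \<bar>u n * (x n - u n)\<bar> * T n" for n
    proof -
      have "norm (u n * (x n - u n) * u n) = \<bar>u n * (x n - u n)\<bar> * u n"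
        using u[of n] by (simp add: abs_mult)
      also have "\<dots> \<le> \<bar>u n * (x n - u n)\<bar> * T n"
        using u[of n] x[of n] by (intro mult_left_mono) (auto simp: T_def)
      finally show ?thesis .
    qed
    then have "(\<lambda>n. u n * (x n - u n) * u n) \<longlonglongrightarrow> 0"
      by (intro Lim_null_comparison[OF always_eventually l]) blast
    moreover have "(\<lambda>n. (x n * c n)\<^sup>2 - u n * (x n - u n) * T n) \<longlonglongrightarrow> 0\<^sup>2 - 0 * A\<^sup>2"
      by (intro tendsto_diff tendsto_mult tendsto_power m3 e T)
    ultimately show ?thesis using tendsto_add[of _ 0 _ _ 0] by fastforce
  qed
  moreover have "(x n * c n)\<^sup>2 - u n * (x n - u n) * T n + u n * (x n - u n) * u n = (u n) ^ 3" for n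
  proof -
    have "(x n * c n)\<^sup>2 = (x n)\<^sup>2 * u n" by (simp add: u_def power_mult_distrib)
    then show ?thesis by (simp add: T_def power2_eq_square power3_eq_cube algebra_simps)
  qed
  ultimately have "(\<lambda>n. (u n) ^ 3) \<longlonglongrightarrow> 0" by simp
  then have "(\<lambda>n. root 3 ((u n) ^ 3)) \<longlonglongrightarrow> root 3 0" by (rule tendsto_real_root)
  then have u0: "u \<longlonglongrightarrow> 0" using u by (simp add: real_root_power_cancel)
  then show "(\<lambda>n. (c n)\<^sup>2) \<longlonglongrightarrow> 0" by (simp add: u_def)
  have "(\<lambda>n. T n - 2 * u n) \<longlonglongrightarrow> A\<^sup>2 - 2 * 0" by (intro tendsto_intros T u0)
  then show "x \<longlonglongrightarrow> A\<^sup>2" by (simp add: T_def)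
qed

section \<open>From the null space to the orbit\<close>

context periodic_cell
begin

lemma wave_diff: "wave a b c z - wave a' b' c' z = wave (a - a') (b - b') (c - c') z"
  by (simp add: wave_def algebra_simps)

text \<open>The coefficients supplied by the null space may be unbounded and far from the circle of
  radius \<open>A\<close>. The impulse sends \<open>d\<close> to zero, the bound of \<open>g\<close>
  then bounds the other coefficients, and the moments of \<open>g\<close> pass to the wave and force
  a^2 + b^2 to tend to A^2 and c to 0.\<close>

lemma orbit_approximation:
  assumes cg: "\<And>n. continuous_on Q (g n)" and bg: "\<And>n z. z \<in> Q \<Longrightarrow> \<bar>g n z\<bar> \<le> M" and A: "0 \<le> A"
    and lim: "(\<lambda>n. J (\<lambda>z. (g n z - (wave (a n) (b n) (c n) z + d n * sin (2 * pi / H * snd z)))\<^sup>2)) \<longlonglongrightarrow> 0"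
    and imp: "(\<lambda>n. J (\<lambda>z. snd z * g n z)) \<longlonglongrightarrow> 0"
    and m: "\<And>k. k \<in> {2, 3, 4} \<Longrightarrow> (\<lambda>n. J (\<lambda>z. (g n z) ^ k)) \<longlonglongrightarrow> J (\<lambda>z. (wave A 0 0 z) ^ k)"
  shows "\<exists>a' b'. (\<forall>n. (a' n)\<^sup>2 + (b' n)\<^sup>2 = A\<^sup>2) \<and> (\<lambda>n. J (\<lambda>z. (g n z - wave (a' n) (b' n) 0 z)\<^sup>2)) \<longlonglongrightarrow> 0"
proof -
  note cg [continuous_intros]
  have LH: "0 < L * H" using L H by simp
  define W where "W = (\<lambda>n. wave (a n) (b n) (c n))"
  have cW [continuous_intros]: "continuous_on Q (W n)" for n unfolding W_def by (intro continuous_intros)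
  define F where "F = (\<lambda>n z. g n z - (W n z + d n * sin (2 * pi / H * snd z)))"
  have cF [continuous_intros]: "continuous_on Q (F n)" for n unfolding F_def by (intro continuous_intros)
  have F2: "(\<lambda>n. J (\<lambda>z. (F n z)\<^sup>2)) \<longlonglongrightarrow> 0" using lim by (simp add: F_def W_def)
  have sq_to_abs: "(\<lambda>n. J (\<lambda>z. \<bar>h n z\<bar>)) \<longlonglongrightarrow> 0"
    if "(\<lambda>n. J (\<lambda>z. (h n z)\<^sup>2)) \<longlonglongrightarrow> 0" and c: "\<And>n. continuous_on Q (h n)" for h
  proof -
    have "(\<lambda>n. sqrt (L * H * J (\<lambda>z. (h n z)\<^sup>2))) \<longlonglongrightarrow> sqrt (L * H * 0)"
      by (intro tendsto_intros that)
    then have "(\<lambda>n. sqrt (L * H * J (\<lambda>z. (h n z)\<^sup>2))) \<longlonglongrightarrow> 0" by simp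
    then show ?thesis
      by (rule tendsto_zero_squeeze[rotated 2])
        (auto intro!: J_abs_le_sqrt c J_nonneg continuous_intros)
  qed
  have d0: "d \<longlonglongrightarrow> 0"
  proof -
    have "(\<lambda>n. J (\<lambda>z. snd z * F n z)) \<longlonglongrightarrow> 0"
    proof (rule Lim_null_comparison[OF always_eventually tendsto_mult_right_zero[OF sq_to_abs[OF F2 cF], of H]], rule allI)
      fix n
      have "\<bar>J (\<lambda>z. snd z * F n z)\<bar> \<le> J (\<lambda>z. \<bar>snd z * F n z\<bar>)" by (intro J_abs_le continuous_intros)
      also have "\<dots> \<le> J (\<lambda>z. H * \<bar>F n z\<bar>)"
        by (intro J_mono continuous_intros) (auto simp: abs_mult intro!: mult_right_mono)
      finally show "norm (J (\<lambda>z. snd z * F n z)) \<le> H * J (\<lambda>z. \<bar>F n z\<bar>)" by (simp add: J_cmult)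
    qed
    from tendsto_diff[OF imp this] have "(\<lambda>n. J (\<lambda>z. snd z * g n z) - J (\<lambda>z. snd z * F n z)) \<longlonglongrightarrow> 0" by simp
    moreover have "J (\<lambda>z. snd z * g n z) - J (\<lambda>z. snd z * F n z) = - (L * H\<^sup>2 / (2 * pi)) * d n" for n
    proof -
      have "J (\<lambda>z. snd z * g n z) - J (\<lambda>z. snd z * F n z) = J (\<lambda>z. snd z * g n z - snd z * F n z)"
        by (intro J_diff[symmetric] continuous_intros)
      also have "\<dots> = J (\<lambda>z. snd z * (W n z + d n * sin (2 * pi / H * snd z)))"
        by (intro J_cong) (simp add: F_def algebra_simps)
      finally show ?thesis by (simp only: W_def wave_impulse)
    qed
    ultimately have "(\<lambda>n. - (L * H\<^sup>2 / (2 * pi)) * d n) \<longlonglongrightarrow> 0" by simp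
    from tendsto_mult_right_zero[OF this, of "- (2 * pi / (L * H\<^sup>2))"] show ?thesis using L H by simp
  qed
  have e0: "(\<lambda>n. J (\<lambda>z. (g n z - W n z)\<^sup>2)) \<longlonglongrightarrow> 0"
  proof (rule tendsto_zero_squeeze)
    show "0 \<le> J (\<lambda>z. (g n z - W n z)\<^sup>2)" for n
      by (auto intro!: J_nonneg continuous_intros)
    have "(\<lambda>n. 2 * J (\<lambda>z. (F n z)\<^sup>2) + 2 * ((d n)\<^sup>2 * (L * H))) \<longlonglongrightarrow> 2 * 0 + 2 * (0\<^sup>2 * (L * H))"
      by (intro tendsto_intros F2 d0)
    then show "(\<lambda>n. 2 * J (\<lambda>z. (F n z)\<^sup>2) + 2 * ((d n)\<^sup>2 * (L * H))) \<longlonglongrightarrow> 0" by simp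
    show "J (\<lambda>z. (g n z - W n z)\<^sup>2) \<le> 2 * J (\<lambda>z. (F n z)\<^sup>2) + 2 * ((d n)\<^sup>2 * (L * H))" for n
    proof -
      have "J (\<lambda>z. (g n z - W n z)\<^sup>2) = J (\<lambda>z. (F n z + d n * sin (2 * pi / H * snd z))\<^sup>2)"
        by (intro J_cong) (simp add: F_def)
      also have "\<dots> \<le> 2 * J (\<lambda>z. (F n z)\<^sup>2) + 2 * J (\<lambda>z. (d n * sin (2 * pi / H * snd z))\<^sup>2)"
        by (intro J_square_sum_le continuous_intros)
      also have "J (\<lambda>z. (d n * sin (2 * pi / H * snd z))\<^sup>2) \<le> J (\<lambda>z. (d n)\<^sup>2 * 1)"
        unfolding power_mult_distrib by (intro J_mono continuous_intros mult_left_mono) (auto simp: abs_square_le_1)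
      finally show ?thesis by (simp add: J_const)
    qed
  qed
  have gW: "(\<lambda>n. J (\<lambda>z. \<bar>g n z - W n z\<bar>)) \<longlonglongrightarrow> 0"
    by (rule sq_to_abs[OF e0]) (intro continuous_intros)
  obtain K where K: "\<And>n. J (\<lambda>z. (g n z - W n z)\<^sup>2) \<le> K"
    using Bseq_eq_bounded convergent_imp_Bseq[OF convergentI[OF e0]] unfolding Bseq_def real_norm_def by (meson abs_le_D1)
  \<comment> \<open>The second moment bounds the coefficients and with them the sup norm of
    \<open>W n\<close>. This is needed to compare higher powers of \<open>g n\<close> and
    \<open>W n\<close> through their L^1 distance.\<close>
  define R where "R = 2 * (M\<^sup>2 * (L * H)) + 2 * K"
  have "J (\<lambda>z. (W n z)\<^sup>2) \<le> R" for n
  proof -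
    have "J (\<lambda>z. (W n z)\<^sup>2) = J (\<lambda>z. (g n z + - (g n z - W n z))\<^sup>2)" by simp
    also have "\<dots> \<le> 2 * J (\<lambda>z. (g n z)\<^sup>2) + 2 * J (\<lambda>z. (- (g n z - W n z))\<^sup>2)"
      by (intro J_square_sum_le continuous_intros)
    also have "J (\<lambda>z. (g n z)\<^sup>2) \<le> J (\<lambda>z. M\<^sup>2)"
      by (intro J_mono continuous_intros) (use bg in \<open>auto simp: abs_le_square_iff[symmetric] intro: order_trans[OF _ abs_ge_self]\<close>)
    also have "J (\<lambda>z. (- (g n z - W n z))\<^sup>2) \<le> K" using K[of n] by (simp only: power2_minus)
    finally show ?thesis by (simp add: R_def J_const)
  qed
  then have R: "(a n)\<^sup>2 + (b n)\<^sup>2 + (c n)\<^sup>2 \<le> 4 * R / (L * H)" for n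
  proof -
    have "L * H * (((a n)\<^sup>2 + (b n)\<^sup>2) / 4 + (c n)\<^sup>2 / 2) \<le> R"
      using \<open>\<And>n. J (\<lambda>z. (W n z)\<^sup>2) \<le> R\<close>[of n] by (simp add: W_def wave_moments)
    then have "((a n)\<^sup>2 + (b n)\<^sup>2) / 4 + (c n)\<^sup>2 / 2 \<le> R / (L * H)" using LH by (simp add: field_simps)
    moreover have "0 \<le> (c n)\<^sup>2" by simp
    moreover have "u + v \<le> 4 * w" if "u / 4 + v / 2 \<le> w" "0 \<le> v" for u v w :: real
      using that by simp
    ultimately have "(a n)\<^sup>2 + (b n)\<^sup>2 + (c n)\<^sup>2 \<le> 4 * (R / (L * H))" by blast
    then show ?thesis by simp
  qed
  define N where "N = max M (3 * sqrt (4 * R / (L * H)))"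
  have bW: "\<bar>W n z\<bar> \<le> N" for n z
  proof -
    have "\<bar>t\<bar> \<le> sqrt (4 * R / (L * H))" if "t\<^sup>2 \<le> 4 * R / (L * H)" for t
      using real_sqrt_le_mono[OF that] by simp
    moreover have "(a n)\<^sup>2 \<le> 4 * R / (L * H)" "(b n)\<^sup>2 \<le> 4 * R / (L * H)" "(c n)\<^sup>2 \<le> 4 * R / (L * H)"
      using R[of n] by (smt (verit) zero_le_power2)+
    ultimately have "\<bar>a n\<bar> + \<bar>b n\<bar> + \<bar>c n\<bar> \<le> 3 * sqrt (4 * R / (L * H))" by (smt (verit))
    then show ?thesis using abs_wave_le[of "a n" "b n" "c n" z] unfolding W_def N_def by linarith
  qed
  have bgN: "\<bar>g n z\<bar> \<le> N" if "z \<in> Q" for n z using bg[OF that] by (simp add: N_def le_max_iff_disj)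
  have mW: "(\<lambda>n. J (\<lambda>z. (W n z) ^ k)) \<longlonglongrightarrow> J (\<lambda>z. (wave A 0 0 z) ^ k)" if "k \<in> {2, 3, 4}" for k
    using tendsto_diff[OF m[OF that] J_power_diff_tendsto_zero[OF cg cW bgN bW gW, of k]] by simp
  define x where "x = (\<lambda>n. (a n)\<^sup>2 + (b n)\<^sup>2)"
  have scale: "f \<longlonglongrightarrow> l" if "(\<lambda>n. L * H * f n) \<longlonglongrightarrow> L * H * l" for f l
    using tendsto_mult_left[OF that, of "1 / (L * H)"] L H by simp
  have m2: "(\<lambda>n. x n / 4 + (c n)\<^sup>2 / 2) \<longlonglongrightarrow> A\<^sup>2 / 4"
    by (rule scale) (use mW[of 2] in \<open>simp add: W_def wave_moments x_def\<close>)
  have m3: "(\<lambda>n. x n * c n) \<longlonglongrightarrow> 0"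
  proof -
    have "(\<lambda>n. - (3 / 8 * x n * c n)) \<longlonglongrightarrow> 0"
      by (rule scale) (use mW[of 3] in \<open>simp add: W_def wave_moments x_def\<close>)
    from tendsto_mult_right_zero[OF this, of "- 8 / 3"] show ?thesis by (simp add: mult.commute)
  qed
  have m4: "(\<lambda>n. 9 / 64 * (x n)\<^sup>2 + 3 / 4 * x n * (c n)\<^sup>2 + 3 / 8 * (c n) ^ 4) \<longlonglongrightarrow> 9 / 64 * (A\<^sup>2)\<^sup>2"
    by (rule scale) (use mW[of 4] in \<open>simp add: W_def wave_moments x_def\<close>)
  have x0: "0 \<le> x n" for n by (simp add: x_def)
  note lims = circle_moment_limit[OF x0 m2 m3 m4]
  have "(\<lambda>n. sqrt (x n)) \<longlonglongrightarrow> sqrt (A\<^sup>2)" by (intro tendsto_intros lims)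
  then have \<rho>: "(\<lambda>n. sqrt (x n)) \<longlonglongrightarrow> A" using A by simp
  \<comment> \<open>Radial projection of (a, b) to the circle of radius \<open>A\<close>; at the
    origin, where there is no direction to follow, the point (A, 0) is taken. In both cases the
    distance moved is |sqrt (x n) - A|.\<close>
  define a' where "a' = (\<lambda>n. if x n = 0 then A else A * (a n / sqrt (x n)))"
  define b' where "b' = (\<lambda>n. if x n = 0 then 0 else A * (b n / sqrt (x n)))"
  have on: "(a' n)\<^sup>2 + (b' n)\<^sup>2 = A\<^sup>2" for n
  proof (cases "x n = 0")
    case False
    then have "(a n)\<^sup>2 / x n + (b n)\<^sup>2 / x n = 1" by (simp add: x_def add_divide_distrib[symmetric])
    then have "A\<^sup>2 * ((a n)\<^sup>2 / x n + (b n)\<^sup>2 / x n) = A\<^sup>2" by simp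
    then show ?thesis using False x0[of n]
      by (simp add: a'_def b'_def power_mult_distrib power_divide distrib_left)
  qed (simp add: a'_def b'_def)
  have dist: "(a n - a' n)\<^sup>2 + (b n - b' n)\<^sup>2 = (sqrt (x n) - A)\<^sup>2" for n
  proof (cases "x n = 0")
    case True
    then have "a n = 0" "b n = 0" by (auto simp: x_def sum_power2_eq_zero_iff)
    then show ?thesis using True by (simp add: a'_def b'_def)
  next
    case False
    then have pos: "0 < x n" using x0[of n] by simp
    have "a n - a' n = (1 - A / sqrt (x n)) * a n" "b n - b' n = (1 - A / sqrt (x n)) * b n"
      using False by (auto simp: a'_def b'_def algebra_simps)
    then have "(a n - a' n)\<^sup>2 + (b n - b' n)\<^sup>2 = (1 - A / sqrt (x n))\<^sup>2 * x n"
      by (simp add: x_def power_mult_distrib distrib_left)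
    also have "\<dots> = ((1 - A / sqrt (x n)) * sqrt (x n))\<^sup>2" using pos by (simp add: power_mult_distrib)
    also have "(1 - A / sqrt (x n)) * sqrt (x n) = sqrt (x n) - A" using pos by (simp add: field_simps)
    finally show ?thesis .
  qed
  have "(\<lambda>n. J (\<lambda>z. (g n z - wave (a' n) (b' n) 0 z)\<^sup>2)) \<longlonglongrightarrow> 0"
  proof (rule tendsto_zero_squeeze)
    show "0 \<le> J (\<lambda>z. (g n z - wave (a' n) (b' n) 0 z)\<^sup>2)" for n
      by (auto intro!: J_nonneg continuous_intros)
    let ?u = "\<lambda>n. 2 * J (\<lambda>z. (g n z - W n z)\<^sup>2) + 2 * (L * H * ((sqrt (x n) - A)\<^sup>2 / 4 + (c n)\<^sup>2 / 2))"
    have "?u \<longlonglongrightarrow> 2 * 0 + 2 * (L * H * ((A - A)\<^sup>2 / 4 + 0 / 2))"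
      by (intro tendsto_intros e0 \<rho> lims) auto
    then show "?u \<longlonglongrightarrow> 0" by simp
    show "J (\<lambda>z. (g n z - wave (a' n) (b' n) 0 z)\<^sup>2) \<le> ?u n" for n
    proof -
      have "J (\<lambda>z. (g n z - wave (a' n) (b' n) 0 z)\<^sup>2) = J (\<lambda>z. ((g n z - W n z) + wave (a n - a' n) (b n - b' n) (c n - 0) z)\<^sup>2)"
        by (simp only: wave_diff[symmetric]) (simp add: W_def)
      also have "\<dots> \<le> 2 * J (\<lambda>z. (g n z - W n z)\<^sup>2) + 2 * J (\<lambda>z. (wave (a n - a' n) (b n - b' n) (c n - 0) z)\<^sup>2)"
        by (intro J_square_sum_le continuous_intros)
      finally show ?thesis by (simp add: wave_moments dist)
    qed
  qed
  then show ?thesis using on by blast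
qed

text \<open>For bounded functions L^2 convergence gives L^p convergence for every p: differences
  below a threshold \<open>t\<close> contribute at most \<theta> / 2, and above it v^2 / t^2 \<ge> 1
  absorbs the bounded p-th power.\<close>

lemma Lp_tendsto_zero:
  assumes p: "1 < p" and cg: "\<And>n. continuous_on Q (g n)" and cr: "\<And>n. continuous_on Q (r n)" and cw: "\<And>n. continuous_on Q (w n)"
    and bg: "\<And>n z. z \<in> Q \<Longrightarrow> \<bar>g n z\<bar> \<le> M" and bw: "\<And>n z. z \<in> Q \<Longrightarrow> \<bar>w n z\<bar> \<le> M"
    and lim: "(\<lambda>n. J (\<lambda>z. (g n z - w n z)\<^sup>2)) \<longlonglongrightarrow> 0"
    and limr: "(\<lambda>n. J (\<lambda>z. \<bar>r n z\<bar> powr p)) \<longlonglongrightarrow> 0"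
  shows "(\<lambda>n. J (\<lambda>z. \<bar>g n z + r n z - w n z\<bar> powr p)) \<longlonglongrightarrow> 0"
proof -
  note cg [continuous_intros] cr [continuous_intros] cw [continuous_intros]
  have LH: "0 < L * H" using L H by simp
  have p0: "0 < p" using p by simp
  note cp = cont_powr[OF p0]
  have 1: "(\<lambda>n. J (\<lambda>z. \<bar>g n z - w n z\<bar> powr p)) \<longlonglongrightarrow> 0"
  proof (rule tendsto_zero_if_eventually_le)
    fix \<theta> :: real assume \<theta>: "0 < \<theta>"
    define t where "t = (\<theta> / (2 * (L * H))) powr (1 / p)"
    have t: "0 < t" "t powr p = \<theta> / (2 * (L * H))" using \<theta> LH p by (auto simp: t_def powr_powr)
    define C where "C = (2 * M) powr p / t\<^sup>2"
    have pt: "\<bar>v\<bar> powr p \<le> t powr p + C * v\<^sup>2" if v: "\<bar>v\<bar> \<le> 2 * M" for v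
    proof (cases "\<bar>v\<bar> \<le> t")
      case True
      then have "\<bar>v\<bar> powr p \<le> t powr p" using p by (intro powr_mono2) auto
      moreover have "0 \<le> C * v\<^sup>2" by (simp add: C_def)
      ultimately show ?thesis by linarith
    next
      case False
      then have "t\<^sup>2 \<le> v\<^sup>2" using t by (simp add: abs_le_square_iff[symmetric])
      then have "1 \<le> v\<^sup>2 / t\<^sup>2" using t by simp
      have "\<bar>v\<bar> powr p \<le> (2 * M) powr p * 1" using v p by (simp add: powr_mono2)
      also have "\<dots> \<le> (2 * M) powr p * (v\<^sup>2 / t\<^sup>2)" using \<open>1 \<le> v\<^sup>2 / t\<^sup>2\<close> by (intro mult_left_mono) auto
      also have "\<dots> = C * v\<^sup>2" by (simp add: C_def)
      finally show ?thesis by (smt (verit) powr_ge_zero)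
    qed
    have bd: "J (\<lambda>z. \<bar>g n z - w n z\<bar> powr p) \<le> \<theta> / 2 + C * J (\<lambda>z. (g n z - w n z)\<^sup>2)" for n
    proof -
      have "J (\<lambda>z. \<bar>g n z - w n z\<bar> powr p) \<le> J (\<lambda>z. t powr p + C * (g n z - w n z)\<^sup>2)"
      proof (intro J_mono cp continuous_intros pt)
        fix z assume "z \<in> Q"
        then show "\<bar>g n z - w n z\<bar> \<le> 2 * M" using bg[of z n] bw[of z n] by linarith
      qed
      also have "\<dots> = J (\<lambda>z. t powr p) + C * J (\<lambda>z. (g n z - w n z)\<^sup>2)"
        by (subst J_add) (auto intro!: continuous_intros simp: J_cmult)
      also have "J (\<lambda>z. t powr p) = \<theta> / 2" unfolding J_const t(2) using L H by simp
      finally show ?thesis .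
    qed
    have "eventually (\<lambda>n. C * J (\<lambda>z. (g n z - w n z)\<^sup>2) < \<theta> / 2) sequentially"
      by (rule order_tendstoD(2)[OF tendsto_mult_right_zero[OF lim]]) (use \<theta> in simp)
    then show "eventually (\<lambda>n. \<bar>J (\<lambda>z. \<bar>g n z - w n z\<bar> powr p)\<bar> \<le> \<theta>) sequentially"
    proof eventually_elim
      case (elim n)
      have "0 \<le> J (\<lambda>z. \<bar>g n z - w n z\<bar> powr p)" by (intro J_nonneg cp continuous_intros) auto
      then show ?case using bd[of n] elim by linarith
    qed
  qed
  have tri: "\<bar>u + v\<bar> powr p \<le> 2 powr p * (\<bar>u\<bar> powr p + \<bar>v\<bar> powr p)" for u v
  proof -
    have "\<bar>u + v\<bar> powr p \<le> (2 * max \<bar>u\<bar> \<bar>v\<bar>) powr p" using p by (intro powr_mono2) auto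
    also have "\<dots> = 2 powr p * (max \<bar>u\<bar> \<bar>v\<bar>) powr p" by (simp add: powr_mult)
    also have "\<dots> \<le> 2 powr p * (\<bar>u\<bar> powr p + \<bar>v\<bar> powr p)" by (intro mult_left_mono) (auto simp: max_def)
    finally show ?thesis .
  qed
  show ?thesis
  proof (rule tendsto_zero_squeeze)
    let ?u = "\<lambda>n. 2 powr p * (J (\<lambda>z. \<bar>g n z - w n z\<bar> powr p) + J (\<lambda>z. \<bar>r n z\<bar> powr p))"
    show "0 \<le> J (\<lambda>z. \<bar>g n z + r n z - w n z\<bar> powr p)" for n
      by (auto intro!: J_nonneg cp continuous_intros)
    show "?u \<longlonglongrightarrow> 0" using tendsto_mult_right_zero[OF tendsto_add_zero[OF 1 limr]] .
    show "J (\<lambda>z. \<bar>g n z + r n z - w n z\<bar> powr p) \<le> ?u n" for n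
    proof -
      have "J (\<lambda>z. \<bar>g n z + r n z - w n z\<bar> powr p) \<le> J (\<lambda>z. 2 powr p * (\<bar>g n z - w n z\<bar> powr p + \<bar>r n z\<bar> powr p))"
      proof (intro J_mono cp continuous_intros)
        show "\<bar>g n z + r n z - w n z\<bar> powr p \<le> 2 powr p * (\<bar>g n z - w n z\<bar> powr p + \<bar>r n z\<bar> powr p)" for z
          using tri[of "g n z - w n z" "r n z"] by (simp add: algebra_simps)
      qed
      also have "\<dots> = ?u n" by (simp only: J_cmult) (subst J_add, (intro cp continuous_intros)+, simp)
      finally show ?thesis .
    qed
  qed
qed

end

subsection \<open>Conservation laws of the Euler flow\<close>

lemma has_real_derivative_transform:
  fixes f g :: "real \<Rightarrow> real"
  assumes "x \<in> S" "\<And>y. y \<in> S \<Longrightarrow> g y = f y" "(f has_real_derivative d) (at x within S)"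
  shows "(g has_real_derivative d) (at x within S)"
  using assms has_vector_derivative_transform[of x S g f d]
  by (simp add: has_real_derivative_iff_has_vector_derivative)

text \<open>Up to its value at the lower end, f is the integral of \<open>fb\<close>;
  differentiation under the integral exhibits \<open>fba\<close> as the b-derivative of
  \<open>fa\<close>. Continuity is asked of one mixed derivative. This suits the pressure, which is
  C^1 and whose mixed derivatives become known through the momentum equation. The closed interval
  carries the identity up to the walls.\<close>

lemma schwarz_mixed_derivatives:
  fixes f fa fb fab fba :: "real \<Rightarrow> real \<Rightarrow> real"
  assumes cd: "c < d"
    and fa: "\<And>a b. b \<in> {c..d} \<Longrightarrow> ((\<lambda>a. f a b) has_real_derivative fa a b) (at a)"
    and fb: "\<And>a b. b \<in> {c..d} \<Longrightarrow> (f a has_real_derivative fb a b) (at b within {c..d})"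
    and fab: "\<And>a b. b \<in> {c..d} \<Longrightarrow> (fa a has_real_derivative fab a b) (at b within {c..d})"
    and fba: "\<And>a b. b \<in> {c..d} \<Longrightarrow> ((\<lambda>a. fb a b) has_real_derivative fba a b) (at a)"
    and cfb: "\<And>a. continuous_on {c..d} (fb a)"
    and cfba: "continuous_on (UNIV \<times> {c..d}) (\<lambda>(a, b). fba a b)"
    and b: "b \<in> {c..d}"
  shows "fab a b = fba a b"
proof -
  have eq: "fa a b = fa a c + integral {c..b} (fba a)" if "b \<in> {c..d}" for b
  proof -
    have sub: "{c..b} \<subseteq> {c..d}" using that by auto
    have ftc: "integral {c..b} (fb a) = f a b - f a c" for a
      using that by (intro integral_unique fundamental_theorem_of_calculus)
        (auto simp: has_real_derivative_iff_has_vector_derivative[symmetric]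
          intro!: has_field_derivative_subset[OF fb sub])
    have "((\<lambda>a. integral (cbox c b) (fb a)) has_real_derivative integral (cbox c b) (fba a)) (at a)"
      by (rule leibniz_rule_field_derivative[where U = UNIV and fx = fba])
        (use that in \<open>auto intro!: fba integrable_continuous_real continuous_on_subset[OF cfb] continuous_on_subset[OF cfba]\<close>)
    moreover have "((\<lambda>a. f a b - f a c) has_real_derivative fa a b - fa a c) (at a)"
      using that cd by (intro DERIV_diff fa) auto
    ultimately show ?thesis unfolding cbox_interval ftc using DERIV_unique by fastforce
  qed
  have cs: "continuous_on {c..d} (fba a)"
    by (rule continuous_on_compose2[OF cfba, of _ "\<lambda>b. (a, b)", simplified]) (auto intro!: continuous_intros)
  have "((\<lambda>b. fa a c + integral {c..b} (fba a)) has_real_derivative 0 + fba a b) (at b within {c..d})"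
    by (intro DERIV_add DERIV_const integral_has_real_derivative cs b)
  then have "((\<lambda>b. fa a c + integral {c..b} (fba a)) has_real_derivative fba a b) (at b within {c..d})"
    by simp
  from has_real_derivative_transform[OF b eq this]
  have "(fa a has_real_derivative fba a b) (at b within {c..d})" .
  moreover have "at b within {c..d} \<noteq> bot"
    using b cd by (simp add: trivial_limit_within islimpt_Icc)
  ultimately show ?thesis
    using fab[OF b] by (meson has_real_derivative_iff_has_vector_derivative vector_derivative_unique_within)
qed

text \<open>C^1 regularity of a scalar function of time and position in terms of its partial
  derivatives, which in x2 are one-sided at the walls. As triples are nested pairs,
  \<open>u (t, x, y)\<close> can also be read as \<open>u (t, z)\<close> with a point
  \<open>z\<close> of the cell.\<close>

definition grad3 :: "real \<Rightarrow> (real \<times> real \<times> real \<Rightarrow> real) \<Rightarrow> (real \<times> real \<times> real \<Rightarrow> real) \<Rightarrow>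
    (real \<times> real \<times> real \<Rightarrow> real) \<Rightarrow> (real \<times> real \<times> real \<Rightarrow> real) \<Rightarrow> bool" where
  "grad3 H u ut ux uy \<longleftrightarrow>
     continuous_on (UNIV \<times> closed_channel H) u \<and> continuous_on (UNIV \<times> closed_channel H) ut \<and>
     continuous_on (UNIV \<times> closed_channel H) ux \<and> continuous_on (UNIV \<times> closed_channel H) uy \<and>
     (\<forall>t x. \<forall>y\<in>{0..H}. ((\<lambda>s. u (s, x, y)) has_real_derivative ut (t, x, y)) (at t) \<and>
        ((\<lambda>s. u (t, s, y)) has_real_derivative ux (t, x, y)) (at x) \<and>
        ((\<lambda>s. u (t, x, s)) has_real_derivative uy (t, x, y)) (at y within {0..H}))"

lemma grad3D:
  assumes "grad3 H u ut ux uy"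
  shows "continuous_on (UNIV \<times> closed_channel H) u" "continuous_on (UNIV \<times> closed_channel H) ut"
    "continuous_on (UNIV \<times> closed_channel H) ux" "continuous_on (UNIV \<times> closed_channel H) uy"
    "\<And>t x y. y \<in> {0..H} \<Longrightarrow> ((\<lambda>s. u (s, x, y)) has_real_derivative ut (t, x, y)) (at t)"
    "\<And>t x y. y \<in> {0..H} \<Longrightarrow> ((\<lambda>s. u (t, s, y)) has_real_derivative ux (t, x, y)) (at x)"
    "\<And>t x y. y \<in> {0..H} \<Longrightarrow> ((\<lambda>s. u (t, x, s)) has_real_derivative uy (t, x, y)) (at y within {0..H})"
  using assms unfolding grad3_def by blast+

lemma derivative_along_lines:
  fixes f :: "real \<times> real \<times> real \<Rightarrow> 'b::real_normed_vector"
  assumes d: "\<And>z. z \<in> UNIV \<times> closed_channel H \<Longrightarrow> (f has_derivative A z) (at z within UNIV \<times> closed_channel H)"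
    and y: "y \<in> {0..H}"
  shows "((\<lambda>s. f (s, x, y)) has_vector_derivative A (t, x, y) (1, 0, 0)) (at t)"
    and "((\<lambda>s. f (t, s, y)) has_vector_derivative A (t, x, y) (0, 1, 0)) (at x)"
    and "((\<lambda>s. f (t, x, s)) has_vector_derivative A (t, x, y) (0, 0, 1)) (at y within {0..H})"
proof -
  have chain: "((\<lambda>s. f (\<gamma> s)) has_vector_derivative A (\<gamma> s) e) (at s within T)"
    if "(\<gamma> has_vector_derivative e) (at s within T)" "s \<in> T" "\<gamma> ` T \<subseteq> UNIV \<times> closed_channel H" for \<gamma> e s T
    using vector_derivative_diff_chain_within[OF that(1) has_derivative_subset[OF d that(3)]] that
    by (auto simp: o_def)
  have 1: "((\<lambda>s. (s, x, y)) has_vector_derivative (1, 0, 0)) (at t)"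
    and 2: "((\<lambda>s. (t, s, y)) has_vector_derivative (0, 1, 0)) (at x)"
    and 3: "((\<lambda>s. (t, x, s)) has_vector_derivative (0, 0, 1)) (at y within {0..H})"
    by (rule has_vector_derivative_eq_rhs, (rule has_vector_derivative_Pair has_vector_derivative_id
        has_vector_derivative_const)+, simp add: zero_prod_def)+
  show "((\<lambda>s. f (s, x, y)) has_vector_derivative A (t, x, y) (1, 0, 0)) (at t)"
    by (rule chain[OF 1]) (use y in \<open>auto simp: closed_channel_def\<close>)
  show "((\<lambda>s. f (t, s, y)) has_vector_derivative A (t, x, y) (0, 1, 0)) (at x)"
    by (rule chain[OF 2]) (use y in \<open>auto simp: closed_channel_def\<close>)
  show "((\<lambda>s. f (t, x, s)) has_vector_derivative A (t, x, y) (0, 0, 1)) (at y within {0..H})"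
    by (rule chain[OF 3]) (use y in \<open>auto simp: closed_channel_def\<close>)
qed

text \<open>The bounded linear map \<open>l\<close> covers both the components of the velocity and
  the evaluation of a derivative in a direction, so that second derivatives come from the same
  lemma.\<close>

lemma C1_on_grad3:
  fixes f :: "real \<times> real \<times> real \<Rightarrow> 'b::real_normed_vector"
  assumes d: "\<And>z. z \<in> UNIV \<times> closed_channel H \<Longrightarrow> (f has_derivative blinfun_apply (f' z)) (at z within UNIV \<times> closed_channel H)"
    and c: "continuous_on (UNIV \<times> closed_channel H) f'" and l: "bounded_linear l"
  shows "grad3 H (\<lambda>z. l (f z)) (\<lambda>z. l (f' z (1, 0, 0))) (\<lambda>z. l (f' z (0, 1, 0))) (\<lambda>z. l (f' z (0, 0, 1)))"
proof -
  have cf: "continuous_on (UNIV \<times> closed_channel H) f"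
    using d by (meson continuous_on_eq_continuous_within has_derivative_continuous)
  have cl: "continuous_on UNIV l" by (rule linear_continuous_on[OF l])
  note dl = bounded_linear.has_vector_derivative[OF l]
  show ?thesis
    unfolding grad3_def has_real_derivative_iff_has_vector_derivative
    by (intro conjI allI ballI dl derivative_along_lines(1)[OF d] derivative_along_lines(2)[OF d] derivative_along_lines(3)[OF d]
        continuous_on_compose2[OF cl] cf blinfun.continuous_on c continuous_on_const) auto
qed

lemma C1_on_imp_grad3:
  assumes "C1_on (UNIV \<times> closed_channel H) f" "bounded_linear l"
  shows "\<exists>ut ux uy. grad3 H (\<lambda>z. l (f z)) ut ux uy"
  using assms C1_on_grad3 unfolding C1_on_def by metis

lemma C2_on_imp_grad3:
  fixes f :: "real \<times> real \<times> real \<Rightarrow> 'b::real_normed_vector"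
  assumes "C2_on (UNIV \<times> closed_channel H) f" and l: "bounded_linear l"
  shows "\<exists>ut ux uy utt utx uty uxt uxx uxy uyt uyx uyy.
     grad3 H (\<lambda>z. l (f z)) ut ux uy \<and> grad3 H ut utt utx uty \<and> grad3 H ux uxt uxx uxy \<and> grad3 H uy uyt uyx uyy"
proof -
  obtain f' where d: "\<And>z. z \<in> UNIV \<times> closed_channel H \<Longrightarrow> (f has_derivative blinfun_apply (f' z)) (at z within UNIV \<times> closed_channel H)"
    and c: "C1_on (UNIV \<times> closed_channel H) f'"
    using assms(1) unfolding C2_on_def by blast
  have "continuous_on (UNIV \<times> closed_channel H) f'"
    using c unfolding C1_on_def by (meson continuous_on_eq_continuous_within has_derivative_continuous)
  note g = C1_on_grad3[OF d this l]
  have bl: "bounded_linear (\<lambda>A. l (blinfun_apply A e))" for e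
    by (rule bounded_linear_compose[OF l blinfun.bounded_linear_left])
  show ?thesis
    using g C1_on_imp_grad3[OF c bl[of "(1, 0, 0)"]] C1_on_imp_grad3[OF c bl[of "(0, 1, 0)"]]
      C1_on_imp_grad3[OF c bl[of "(0, 0, 1)"]]
    by metis
qed

lemma continuous_channel_slice:
  assumes "continuous_on (UNIV \<times> closed_channel H) u"
  shows "continuous_on (UNIV \<times> {0..H}) (\<lambda>(t, y). u (t, x, y))" "continuous_on (UNIV \<times> {0..H}) (\<lambda>(x, y). u (t, x, y))"
    "continuous_on {0..H} (\<lambda>y. u (t, x, y))"
    "y \<in> {0..H} \<Longrightarrow> continuous_on (UNIV \<times> T) (\<lambda>(t, x). u (t, x, y))"
    "y \<in> {0..H} \<Longrightarrow> continuous_on T (\<lambda>x. u (t, x, y))"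
  unfolding split_beta
  by (rule continuous_on_compose2[OF assms], (intro continuous_intros), force simp: closed_channel_def)+

text \<open>The Euler equations are given in the open channel; continuity carries them to the walls,
  where the conservation laws need them too.\<close>

lemma eq_on_closed_channel:
  fixes u w :: "real \<times> real \<times> real \<Rightarrow> real"
  assumes H: "0 < H" and c: "continuous_on (UNIV \<times> closed_channel H) u" "continuous_on (UNIV \<times> closed_channel H) w"
    and eq: "\<And>t x y. 0 < y \<Longrightarrow> y < H \<Longrightarrow> u (t, x, y) = w (t, x, y)" and y: "y \<in> {0..H}"
  shows "u (t, x, y) = w (t, x, y)"
proof -
  have cl: "closure {0<..<H} = {0..H}" using H by simp
  have "continuous_on (closure {0<..<H}) (\<lambda>y. u (t, x, y) - w (t, x, y))"
    unfolding cl by (intro continuous_intros continuous_channel_slice(3) c)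
  then have "u (t, x, y) - w (t, x, y) = 0"
    by (rule continuous_constant_on_closure) (use y eq cl in auto)
  then show ?thesis by simp
qed

lemma grad3_mixed:
  assumes H: "0 < H" and u: "grad3 H u ut ux uy" and ut: "grad3 H ut utt utx uty"
    and ux: "grad3 H ux uxt uxx uxy" and uy: "grad3 H uy uyt uyx uyy" and y: "y \<in> {0..H}"
  shows "uty (t, x, y) = uyt (t, x, y)" "uxy (t, x, y) = uyx (t, x, y)" "utx (t, x, y) = uxt (t, x, y)"
proof -
  note uD = grad3D[OF u] and utD = grad3D[OF ut] and uxD = grad3D[OF ux] and uyD = grad3D[OF uy]
  show "uty (t, x, y) = uyt (t, x, y)"
    by (rule schwarz_mixed_derivatives[OF H, where f = "\<lambda>t y. u (t, x, y)" and fa = "\<lambda>t y. ut (t, x, y)"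
        and fb = "\<lambda>t y. uy (t, x, y)" and a = t and b = y])
      (rule uD utD uyD y continuous_channel_slice | assumption)+
  show "uxy (t, x, y) = uyx (t, x, y)"
    by (rule schwarz_mixed_derivatives[OF H, where f = "\<lambda>x y. u (t, x, y)" and fa = "\<lambda>x y. ux (t, x, y)"
        and fb = "\<lambda>x y. uy (t, x, y)" and a = x and b = y])
      (rule uD uxD uyD y continuous_channel_slice | assumption)+
  \<comment> \<open>The lemma on mixed derivatives wants a compact interval in its second variable;
    any interval around \<open>x\<close> serves.\<close>
  have lt: "x - 1 < x + 1" and x: "x \<in> {x - 1..x + 1}" by auto
  show "utx (t, x, y) = uxt (t, x, y)"
    by (rule schwarz_mixed_derivatives[OF lt, where f = "\<lambda>t x. u (t, x, y)" and fa = "\<lambda>t x. ut (t, x, y)"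
        and fb = "\<lambda>t x. ux (t, x, y)" and a = t and b = x])
      (rule uD(5-7)[OF y] utD(5-7)[OF y] uxD(5-7)[OF y] has_field_derivative_at_within[OF uD(6)[OF y]]
        has_field_derivative_at_within[OF utD(6)[OF y]] continuous_channel_slice(4)[OF _ y] continuous_channel_slice(5)[OF _ y]
        uD(1-4) utD(1-4) uxD(1-4) x)+
qed

lemma grad3_periodic:
  assumes H: "0 < H" and u: "grad3 H u ut ux uy" and per: "\<And>t x y. y \<in> {0..H} \<Longrightarrow> u (t, x + L, y) = u (t, x, y)"
    and y: "y \<in> {0..H}"
  shows "ux (t, x + L, y) = ux (t, x, y)" "uy (t, x + L, y) = uy (t, x, y)"
proof -
  note uD = grad3D[OF u]
  have "((\<lambda>s. u (t, s + L, y)) has_real_derivative ux (t, x + L, y)) (at x)"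
    using uD(6)[OF y, of t "x + L"] by (simp add: DERIV_shift)
  then show "ux (t, x + L, y) = ux (t, x, y)"
    unfolding per[OF y] using uD(6)[OF y, of t x] DERIV_unique by blast
  have "((\<lambda>s. u (t, x, s)) has_real_derivative uy (t, x + L, y)) (at y within {0..H})"
    by (rule has_real_derivative_transform[OF y _ uD(7)[OF y, of t "x + L"]]) (simp add: per)
  moreover have "at y within {0..H} \<noteq> bot" using y H by (simp add: trivial_limit_within islimpt_Icc)
  ultimately show "uy (t, x + L, y) = uy (t, x, y)"
    using uD(7)[OF y, of t x] by (meson has_real_derivative_iff_has_vector_derivative vector_derivative_unique_within)
qed

section \<open>Integral conservation laws and the stream function\<close>

context periodic_cell
begin

lemma cont_channel_Q: "continuous_on (UNIV \<times> closed_channel H) u \<Longrightarrow> continuous_on Q (\<lambda>z. u (t, z))"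
  for u :: "real \<times> real \<times> real \<Rightarrow> real"
  by (rule continuous_on_compose2[where g = u]) (auto intro!: continuous_intros simp: closed_channel_def)

lemma conservation_law:
  fixes q :: "real \<times> real \<times> real \<Rightarrow> real"
  assumes cq: "continuous_on (UNIV \<times> closed_channel H) q" and cFx: "continuous_on (UNIV \<times> closed_channel H) Fx"
    and cGy: "continuous_on (UNIV \<times> closed_channel H) Gy"
    and dq: "\<And>t x y. y \<in> {0..H} \<Longrightarrow> ((\<lambda>s. q (s, x, y)) has_real_derivative - (Fx (t, x, y) + Gy (t, x, y))) (at t)"
    and dF: "\<And>t x y. y \<in> {0..H} \<Longrightarrow> ((\<lambda>s. F (t, s, y)) has_real_derivative Fx (t, x, y)) (at x)"
    and dG: "\<And>t x y. y \<in> {0..H} \<Longrightarrow> ((\<lambda>s. G (t, x, s)) has_real_derivative Gy (t, x, y)) (at y within {0..H})"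
    and per: "\<And>t y. y \<in> {0..H} \<Longrightarrow> F (t, L, y) = F (t, 0, y)"
    and bd: "\<And>t x. G (t, x, H) = G (t, x, 0)"
  shows "J (\<lambda>z. q (t, z)) = J (\<lambda>z. q (0, z))"
proof -
  have "((\<lambda>t. integral (cbox (0, 0) (L, H)) (\<lambda>z. q (t, z))) has_real_derivative
      integral (cbox (0, 0) (L, H)) (\<lambda>z. - (Fx (t, z) + Gy (t, z)))) (at t)" for t
  proof (rule leibniz_rule_field_derivative[where U = UNIV and fx = "\<lambda>t z. - (Fx (t, z) + Gy (t, z))"])
    show "((\<lambda>t. q (t, z)) has_real_derivative - (Fx (t, z) + Gy (t, z))) (at t)"
      if "t \<in> UNIV" "z \<in> cbox (0, 0) (L, H)" for t z
      using that dq[of "snd z" "fst z" t] by (auto simp: cbox_Pair_eq)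
    show "(\<lambda>z. q (t, z)) integrable_on cbox (0, 0) (L, H)" for t
      using integrable_Q[OF cont_channel_Q[OF cq]] by (simp only: Q_cbox)
    have "continuous_on (UNIV \<times> closed_channel H) (\<lambda>z. - (Fx z + Gy z))"
      by (intro continuous_intros cFx cGy)
    then show "continuous_on (UNIV \<times> cbox (0, 0) (L, H)) (\<lambda>(t, z). - (Fx (t, z) + Gy (t, z)))"
      unfolding split_beta prod.collapse
      by (rule continuous_on_subset) (auto simp: closed_channel_def cbox_Pair_eq)
  qed auto
  moreover have "J (\<lambda>z. - (Fx (t, z) + Gy (t, z))) = 0" for t
  proof -
    have "J (\<lambda>z. Fx (t, z)) = 0"
      by (rule J_dx_zero[where F = "\<lambda>z. F (t, z)"])
        (auto intro!: cont_channel_Q cFx per has_field_derivative_at_within[OF dF])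
    moreover have "J (\<lambda>z. Gy (t, z)) = 0"
      by (rule J_dy_zero[where F = "\<lambda>z. G (t, z)"]) (auto intro!: cont_channel_Q cGy dG bd)
    moreover have "J (\<lambda>z. Fx (t, z) + Gy (t, z)) = J (\<lambda>z. Fx (t, z)) + J (\<lambda>z. Gy (t, z))"
      by (intro J_add cont_channel_Q cFx cGy)
    ultimately have "J (\<lambda>z. Fx (t, z) + Gy (t, z)) = 0" by simp
    then show ?thesis by (simp only: integral_neg neg_0_equal_iff_equal)
  qed
  ultimately have "((\<lambda>t. J (\<lambda>z. q (t, z))) has_real_derivative 0) (at t)" for t
    unfolding Q_cbox by simp
  then show ?thesis by (intro DERIV_isconst_all) auto
qed


text \<open>The stream function of a flow will be an integral in x2, whose joint continuity is not
  immediate. Its partial derivatives are continuous, hence bounded on the compact cell, and make it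
  Lipschitz.\<close>

lemma continuous_on_Q_if_C1:
  assumes cx: "continuous_on Q fx" and cy: "continuous_on Q fy"
    and dx: "\<And>x y. x \<in> {0..L} \<Longrightarrow> y \<in> {0..H} \<Longrightarrow> ((\<lambda>s. f (s, y)) has_real_derivative fx (x, y)) (at x within {0..L})"
    and dy: "\<And>x y. x \<in> {0..L} \<Longrightarrow> y \<in> {0..H} \<Longrightarrow> ((\<lambda>s. f (x, s)) has_real_derivative fy (x, y)) (at y within {0..H})"
  shows "continuous_on Q f"
proof -
  have "compact Q" unfolding Q_cbox by (rule compact_cbox)
  then have "bounded (fx ` Q)" "bounded (fy ` Q)" by (intro compact_imp_bounded compact_continuous_image cx cy; simp)+
  then obtain Kx Ky where "\<forall>z\<in>Q. \<bar>fx z\<bar> \<le> Kx" "\<forall>z\<in>Q. \<bar>fy z\<bar> \<le> Ky"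
    unfolding bounded_iff real_norm_def by blast
  then have K: "\<And>z. z \<in> Q \<Longrightarrow> \<bar>fx z\<bar> \<le> Kx" "\<And>z. z \<in> Q \<Longrightarrow> \<bar>fy z\<bar> \<le> Ky" by blast+
  have lip: "\<bar>f (x, y) - f (x', y')\<bar> \<le> Kx * \<bar>x - x'\<bar> + Ky * \<bar>y - y'\<bar>"
    if "x \<in> {0..L}" "y \<in> {0..H}" "x' \<in> {0..L}" "y' \<in> {0..H}" for x y x' y'
  proof -
    have "\<bar>f (x, y) - f (x', y)\<bar> \<le> Kx * \<bar>x - x'\<bar>"
      using field_differentiable_bound[of "{0..L}" "\<lambda>s. f (s, y)" "\<lambda>s. fx (s, y)" Kx x x'] that dx K by simp
    moreover have "\<bar>f (x', y) - f (x', y')\<bar> \<le> Ky * \<bar>y - y'\<bar>"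
      using field_differentiable_bound[of "{0..H}" "\<lambda>s. f (x', s)" "\<lambda>s. fy (x', s)" Ky y y'] that dy K by simp
    ultimately show ?thesis by linarith
  qed
  show ?thesis unfolding continuous_on_def
  proof
    fix z assume "z \<in> Q"
    have "((\<lambda>u. Kx * \<bar>fst u - fst z\<bar> + Ky * \<bar>snd u - snd z\<bar>) \<longlongrightarrow> Kx * \<bar>fst z - fst z\<bar> + Ky * \<bar>snd z - snd z\<bar>) (at z within Q)"
      by (intro tendsto_intros)
    then have "((\<lambda>u. Kx * \<bar>fst u - fst z\<bar> + Ky * \<bar>snd u - snd z\<bar>) \<longlongrightarrow> 0) (at z within Q)" by simp
    then have "((\<lambda>u. f u - f z) \<longlongrightarrow> 0) (at z within Q)"
    proof (rule Lim_null_comparison[rotated])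
      show "\<forall>\<^sub>F u in at z within Q. norm (f u - f z) \<le> Kx * \<bar>fst u - fst z\<bar> + Ky * \<bar>snd u - snd z\<bar>"
        unfolding eventually_at_filter
        using lip[of "fst _" "snd _" "fst z" "snd z"] \<open>z \<in> Q\<close> by (intro always_eventually) auto
    qed
    then show "(f \<longlongrightarrow> f z) (at z within Q)" by (simp add: LIM_zero_iff)
  qed
qed

text \<open>The weak form of the equation that w is minus the Laplacian of \<psi>. Test functions
  vanish on the walls, so no boundary term appears. A stream function \<psi> may be tested with
  itself, which turns its Dirichlet integral into J (\<psi> w).\<close>

definition weak_vorticity ::
  "(real \<times> real \<Rightarrow> real) \<Rightarrow> (real \<times> real \<Rightarrow> real) \<Rightarrow> (real \<times> real \<Rightarrow> real) \<Rightarrow> bool" where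
  "weak_vorticity \<psi>x \<psi>y w \<longleftrightarrow> (\<forall>f fx fy. stream_fun f fx fy \<longrightarrow>
     J (\<lambda>z. fx z * \<psi>x z + fy z * \<psi>y z) = J (\<lambda>z. f z * w z))"

lemma weak_vorticityI:
  assumes c: "continuous_on Q \<psi>x" "continuous_on Q \<psi>y" "continuous_on Q \<psi>xx" "continuous_on Q \<psi>yy"
    and dx: "\<And>x y. x \<in> {0..L} \<Longrightarrow> y \<in> {0..H} \<Longrightarrow> ((\<lambda>s. \<psi>x (s, y)) has_real_derivative \<psi>xx (x, y)) (at x within {0..L})"
    and dy: "\<And>x y. x \<in> {0..L} \<Longrightarrow> y \<in> {0..H} \<Longrightarrow> ((\<lambda>s. \<psi>y (x, s)) has_real_derivative \<psi>yy (x, y)) (at y within {0..H})"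
    and per: "\<And>y. y \<in> {0..H} \<Longrightarrow> \<psi>x (L, y) = \<psi>x (0, y)"
    and w: "\<And>z. z \<in> Q \<Longrightarrow> w z = - (\<psi>xx z + \<psi>yy z)"
  shows "weak_vorticity \<psi>x \<psi>y w"
  unfolding weak_vorticity_def
proof (intro allI impI)
  fix f fx fy assume s: "stream_fun f fx fy"
  note sD = stream_funD[OF s]
  note c [continuous_intros] sD(1-3) [continuous_intros]
  have 1: "J (\<lambda>z. fx z * \<psi>x z + f z * \<psi>xx z) = 0"
    by (rule J_dx_zero[where F = "\<lambda>z. f z * \<psi>x z"])
      (auto intro!: continuous_intros derivative_eq_intros sD dx simp: sD per)
  have 2: "J (\<lambda>z. fy z * \<psi>y z + f z * \<psi>yy z) = 0"
    by (rule J_dy_zero[where F = "\<lambda>z. f z * \<psi>y z"])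
      (auto intro!: continuous_intros derivative_eq_intros sD dy simp: sD)
  have "J (\<lambda>z. fx z * \<psi>x z + fy z * \<psi>y z) - J (\<lambda>z. f z * - (\<psi>xx z + \<psi>yy z))
      = J (\<lambda>z. (fx z * \<psi>x z + fy z * \<psi>y z) - f z * - (\<psi>xx z + \<psi>yy z))"
    by (intro J_diff[symmetric] continuous_intros)
  also have "\<dots> = J (\<lambda>z. (fx z * \<psi>x z + f z * \<psi>xx z) + (fy z * \<psi>y z + f z * \<psi>yy z))"
    by (intro J_cong) (simp add: algebra_simps)
  also have "\<dots> = 0" using 1 2 by (subst J_add) (auto intro!: continuous_intros)
  finally show "J (\<lambda>z. fx z * \<psi>x z + fy z * \<psi>y z) = J (\<lambda>z. f z * w z)"
    using J_cong[of "\<lambda>z. f z * w z" "\<lambda>z. f z * - (\<psi>xx z + \<psi>yy z)"] w by simp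
qed

text \<open>All that the stability argument uses of an Euler flow. The function \<open>w\<close>
  stands in for \<open>vorticity\<close>, from which it may differ on the walls: there the two-sided
  derivatives in \<open>vorticity\<close> depend on values of the velocity outside the
  channel.\<close>

definition conserved_flow where
  "conserved_flow v w \<Psi> \<Psi>x \<Psi>y \<longleftrightarrow> (\<forall>t. continuous_on Q (w t)) \<and>
     (\<forall>t x y. 0 < y \<longrightarrow> y < H \<longrightarrow> w t (x, y) = vorticity (v t) (x, y)) \<and>
     (\<forall>t k. J (\<lambda>z. (w t z) ^ k) = J (\<lambda>z. (w 0 z) ^ k)) \<and>
     (\<forall>t. J (\<lambda>z. snd z * w t z) = J (\<lambda>z. snd z * w 0 z)) \<and>
     (\<forall>t. stream_fun (\<Psi> t) (\<Psi>x t) (\<Psi>y t)) \<and> (\<forall>t. weak_vorticity (\<Psi>x t) (\<Psi>y t) (w t)) \<and>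
     (\<forall>t. dirichlet (\<Psi>x t) (\<Psi>y t) = dirichlet (\<Psi>x 0) (\<Psi>y 0))"
  for v :: "real \<Rightarrow> real \<times> real \<Rightarrow> real \<times> real" and w \<Psi> \<Psi>x \<Psi>y :: "real \<Rightarrow> real \<times> real \<Rightarrow> real"

text \<open>Subtracting the mean of the first velocity component amounts to passing to a moving frame, in
  which the stream function vanishes on both walls; this is why the constant \<open>c\<close> of the traveling wave plays no role.\<close>

lemma euler_flow_conservation:
  assumes euler: "euler_flow L H v P"
  shows "\<exists>w \<Psi> \<Psi>x \<Psi>y. conserved_flow v w \<Psi> \<Psi>x \<Psi>y"
proof -
  note eD = euler[unfolded euler_flow_def]
  have C2: "C2_on (UNIV \<times> closed_channel H) (\<lambda>z. v (fst z) (snd z))"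
    and C1: "C1_on (UNIV \<times> closed_channel H) (\<lambda>z. P (fst z) (snd z))"
    using eD unfolding split_beta' by blast+
  define V1 where "V1 = (\<lambda>z. fst (v (fst z) (snd z)))"
  define V2 where "V2 = (\<lambda>z. snd (v (fst z) (snd z)))"
  define p where "p = (\<lambda>z. P (fst z) (snd z))"
  obtain V1t V1x V1y V1tt V1tx V1ty V1xt V1xx V1xy V1yt V1yx V1yy where
    g1: "grad3 H V1 V1t V1x V1y" and g1t: "grad3 H V1t V1tt V1tx V1ty"
    and g1x: "grad3 H V1x V1xt V1xx V1xy" and g1y: "grad3 H V1y V1yt V1yx V1yy"
    using C2_on_imp_grad3[OF C2 bounded_linear_fst] unfolding V1_def by blast
  obtain V2t V2x V2y V2tt V2tx V2ty V2xt V2xx V2xy V2yt V2yx V2yy where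
    g2: "grad3 H V2 V2t V2x V2y" and g2t: "grad3 H V2t V2tt V2tx V2ty"
    and g2x: "grad3 H V2x V2xt V2xx V2xy" and g2y: "grad3 H V2y V2yt V2yx V2yy"
    using C2_on_imp_grad3[OF C2 bounded_linear_snd] unfolding V2_def by blast
  obtain pt px py where gp: "grad3 H p pt px py"
    using C1_on_imp_grad3[OF C1 bounded_linear_ident] unfolding p_def by blast
  note V1D = grad3D[OF g1] and V2D = grad3D[OF g2] and pD = grad3D[OF gp]
  note V1tD = grad3D[OF g1t] and V1xD = grad3D[OF g1x] and V1yD = grad3D[OF g1y]
  note V2tD = grad3D[OF g2t] and V2xD = grad3D[OF g2x] and V2yD = grad3D[OF g2y]
  note V1D(1-4)[continuous_intros] V2D(1-4)[continuous_intros] pD(1-4)[continuous_intros]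
    V1tD(2-4)[continuous_intros] V1xD(2-4)[continuous_intros] V1yD(2-4)[continuous_intros]
    V2tD(2-4)[continuous_intros] V2xD(2-4)[continuous_intros] V2yD(2-4)[continuous_intros]
  \<comment> \<open>In the open channel the two-sided derivatives of the definitions agree with
    those taken within the closed channel.\<close>
  have interior: "V1t (t, x, y) + V1 (t, x, y) * V1x (t, x, y) + V2 (t, x, y) * V1y (t, x, y) = - px (t, x, y)"
    "V2t (t, x, y) + V1 (t, x, y) * V2x (t, x, y) + V2 (t, x, y) * V2y (t, x, y) = - py (t, x, y)"
    "V1x (t, x, y) + V2y (t, x, y) = 0"
    "vorticity (v t) (x, y) = V2x (t, x, y) - V1y (t, x, y)"
    if y: "0 < y" "y < H" for t x y
  proof -
    have yI: "y \<in> {0..H}" and at_y: "at y within {0..H} = at y" using y by (auto simp: at_within_Icc_at)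
    note v1 = V1D(5-7)[OF yI, unfolded V1_def at_y has_real_derivative_iff_has_vector_derivative fst_conv snd_conv]
    note v2 = V2D(5-7)[OF yI, unfolded V2_def at_y has_real_derivative_iff_has_vector_derivative fst_conv snd_conv]
    note pr = pD(5-7)[OF yI, unfolded p_def at_y has_real_derivative_iff_has_vector_derivative fst_conv snd_conv]
    have t: "vector_derivative (\<lambda>s. v s (x, y)) (at t) = (V1t (t, x, y), V2t (t, x, y))"
      using has_vector_derivative_Pair[OF v1(1)[where x = x and t = t] v2(1)[where x = x and t = t]] by (intro vector_derivative_at) simp
    have d1: "pd1 (v t) (x, y) = (V1x (t, x, y), V2x (t, x, y))"
      unfolding pd1_def using has_vector_derivative_Pair[OF v1(2)[where x = x and t = t] v2(2)[where x = x and t = t]] by (intro vector_derivative_at) simp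
    have d2: "pd2 (v t) (x, y) = (V1y (t, x, y), V2y (t, x, y))"
      unfolding pd2_def using has_vector_derivative_Pair[OF v1(3)[where x = x and t = t] v2(3)[where x = x and t = t]] by (intro vector_derivative_at) simp
    have dp: "pd1 (P t) (x, y) = px (t, x, y)" "pd2 (P t) (x, y) = py (t, x, y)"
      unfolding pd1_def pd2_def using pr(2,3) by (auto intro!: vector_derivative_at)
    have ch: "(x, y) \<in> channel H" using y by (simp add: channel_def)
    have "vector_derivative (\<lambda>s. v s (x, y)) (at t)
          + fst (v t (x, y)) *\<^sub>R pd1 (v t) (x, y) + snd (v t (x, y)) *\<^sub>R pd2 (v t) (x, y)
          = - (pd1 (P t) (x, y), pd2 (P t) (x, y))"
      using eD ch by blast
    then show "V1t (t, x, y) + V1 (t, x, y) * V1x (t, x, y) + V2 (t, x, y) * V1y (t, x, y) = - px (t, x, y)"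
      "V2t (t, x, y) + V1 (t, x, y) * V2x (t, x, y) + V2 (t, x, y) * V2y (t, x, y) = - py (t, x, y)"
      unfolding t d1 d2 dp by (simp_all add: V1_def V2_def)
    have s1: "pd1 (\<lambda>y. fst (v t y)) (x, y) = V1x (t, x, y)" "pd2 (\<lambda>y. fst (v t y)) (x, y) = V1y (t, x, y)"
      "pd1 (\<lambda>y. snd (v t y)) (x, y) = V2x (t, x, y)" "pd2 (\<lambda>y. snd (v t y)) (x, y) = V2y (t, x, y)"
      unfolding pd1_def pd2_def using v1(2,3) v2(2,3) by (auto intro!: vector_derivative_at)
    have "pd1 (\<lambda>y. fst (v t y)) (x, y) + pd2 (\<lambda>y. snd (v t y)) (x, y) = 0"
      using eD ch by blast
    then show "V1x (t, x, y) + V2y (t, x, y) = 0" unfolding s1 .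
    show "vorticity (v t) (x, y) = V2x (t, x, y) - V1y (t, x, y)" unfolding vorticity_def s1 ..
  qed
  have E1: "px (t, x, y) = - (V1t (t, x, y) + V1 (t, x, y) * V1x (t, x, y) + V2 (t, x, y) * V1y (t, x, y))" if "y \<in> {0..H}" for t x y
    by (rule eq_on_closed_channel[OF H, where w = "\<lambda>z. - (V1t z + V1 z * V1x z + V2 z * V1y z)"])
      (use that interior(1) in \<open>auto intro!: continuous_intros\<close>)
  have E2: "py (t, x, y) = - (V2t (t, x, y) + V1 (t, x, y) * V2x (t, x, y) + V2 (t, x, y) * V2y (t, x, y))" if "y \<in> {0..H}" for t x y
    by (rule eq_on_closed_channel[OF H, where w = "\<lambda>z. - (V2t z + V1 z * V2x z + V2 z * V2y z)"])
      (use that interior(2) in \<open>auto intro!: continuous_intros\<close>)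
  have div: "V2y (t, x, y) = - V1x (t, x, y)" if "y \<in> {0..H}" for t x y
    by (rule eq_on_closed_channel[OF H, where w = "\<lambda>z. - V1x z"])
      (use that interior(3) in \<open>auto intro!: continuous_intros simp: add_eq_0_iff\<close>)
  have wall: "V2 (t, x, 0) = 0" "V2 (t, x, H) = 0" for t x
    using eD by (auto simp: V2_def)
  have perV1: "V1 (t, x + L, y) = V1 (t, x, y)" and perV2: "V2 (t, x + L, y) = V2 (t, x, y)"
    and perp: "p (t, x + L, y) = p (t, x, y)" if "y \<in> {0..H}" for t x y
    using eD that unfolding x1_periodic_on_def closed_channel_def V1_def V2_def p_def by simp_all
  note perV2x = grad3_periodic(1)[OF H g2 perV2] and perV1y = grad3_periodic(2)[OF H g1 perV1]
  define w where "w = (\<lambda>z. V2x z - V1y z)"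
  define wt where "wt = (\<lambda>z. V2xt z - V1yt z)"
  define wx where "wx = (\<lambda>z. V2xx z - V1yx z)"
  define wy where "wy = (\<lambda>z. V2xy z - V1yy z)"
  have gw: "grad3 H w wt wx wy"
    unfolding grad3_def w_def wt_def wx_def wy_def
    by (auto intro!: continuous_intros derivative_eq_intros V2xD V1yD)
  note wD = grad3D[OF gw]
  note wD(1-4)[continuous_intros]
  note mix1 = grad3_mixed[OF H g1 g1t g1x g1y] and mix2 = grad3_mixed[OF H g2 g2t g2x g2y]
  \<comment> \<open>The curl of the momentum equation. The pressure is only C^1, but
    \<open>E1\<close> and \<open>E2\<close> express its gradient by differentiable functions, so its
    mixed derivatives exist up to the walls and agree.\<close>
  have transport: "wt (t, x, y) = - (V1 (t, x, y) * wx (t, x, y) + V2 (t, x, y) * wy (t, x, y))" if y: "y \<in> {0..H}" for t x y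
  proof -
    let ?a = "\<lambda>x y. - (V1ty (t, x, y) + (V1y (t, x, y) * V1x (t, x, y) + V1 (t, x, y) * V1xy (t, x, y))
        + (V2y (t, x, y) * V1y (t, x, y) + V2 (t, x, y) * V1yy (t, x, y)))"
    let ?b = "\<lambda>z. - (V2tx z + (V1x z * V2x z + V1 z * V2xx z) + (V2x z * V2y z + V2 z * V2yx z))"
    have "?a x y = ?b (t, x, y)"
    proof (rule schwarz_mixed_derivatives[OF H, where f = "\<lambda>x y. p (t, x, y)" and fa = "\<lambda>x y. px (t, x, y)"
        and fb = "\<lambda>x y. py (t, x, y)" and fab = ?a and fba = "\<lambda>x y. ?b (t, x, y)" and a = x and b = y])
      fix x y assume y: "y \<in> {0..H}"
      show "((\<lambda>x. p (t, x, y)) has_real_derivative px (t, x, y)) (at x)" by (rule pD(6)[OF y])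
      show "((\<lambda>y. p (t, x, y)) has_real_derivative py (t, x, y)) (at y within {0..H})" by (rule pD(7)[OF y])
      have "((\<lambda>y. - (V1t (t, x, y) + V1 (t, x, y) * V1x (t, x, y) + V2 (t, x, y) * V1y (t, x, y))) has_real_derivative ?a x y) (at y within {0..H})"
        by (rule derivative_eq_intros V1tD(7)[OF y] V1D(7)[OF y] V2D(7)[OF y] V1xD(7)[OF y] V1yD(7)[OF y] refl)+ simp
      then show "((\<lambda>y. px (t, x, y)) has_real_derivative ?a x y) (at y within {0..H})"
        by (rule has_real_derivative_transform[OF y, rotated]) (rule E1)
      have "((\<lambda>x. - (V2t (t, x, y) + V1 (t, x, y) * V2x (t, x, y) + V2 (t, x, y) * V2y (t, x, y))) has_real_derivative ?b (t, x, y)) (at x)"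
        by (rule derivative_eq_intros V2tD(6)[OF y] V1D(6)[OF y] V2D(6)[OF y] V2xD(6)[OF y] V2yD(6)[OF y] refl)+ simp
      then show "((\<lambda>x. py (t, x, y)) has_real_derivative ?b (t, x, y)) (at x)"
        unfolding E2[OF y] .
    next
      show "continuous_on {0..H} (\<lambda>y. py (t, x, y))" for x by (rule continuous_channel_slice(3)[OF pD(4)])
      show "continuous_on (UNIV \<times> {0..H}) (\<lambda>(x, y). ?b (t, x, y))"
        by (rule continuous_channel_slice(2)) (intro continuous_intros)
    qed (rule y)
    then have "V2tx (t, x, y) + (V1x (t, x, y) * V2x (t, x, y) + V1 (t, x, y) * V2xx (t, x, y))
         + (V2x (t, x, y) * V2y (t, x, y) + V2 (t, x, y) * V2yx (t, x, y))
       = V1ty (t, x, y) + (V1y (t, x, y) * V1x (t, x, y) + V1 (t, x, y) * V1xy (t, x, y))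
        + (V2y (t, x, y) * V1y (t, x, y) + V2 (t, x, y) * V1yy (t, x, y))" by simp
    then show ?thesis
      unfolding w_def wt_def wx_def wy_def mix1[OF y] mix2[OF y] div[OF y] by (simp add: algebra_simps)
  qed
  have perL: "V1 (t, L, y) = V1 (t, 0, y)" "V2 (t, L, y) = V2 (t, 0, y)" "p (t, L, y) = p (t, 0, y)" "w (t, L, y) = w (t, 0, y)"
    if "y \<in> {0..H}" for t y
    using perV1[OF that, of t 0] perV2[OF that, of t 0] perp[OF that, of t 0] perV2x[OF _ that, of t 0] perV1y[OF _ that, of t 0]
    by (simp_all add: w_def)
  have cons_V1: "J (\<lambda>z. V1 (t, z)) = J (\<lambda>z. V1 (0, z))" for t
  proof (rule conservation_law[where F = "\<lambda>z. p z + (V1 z)\<^sup>2" and Fx = "\<lambda>z. px z + 2 * V1 z * V1x z"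
        and G = "\<lambda>z. V1 z * V2 z" and Gy = "\<lambda>z. V1y z * V2 z + V1 z * V2y z"])
    fix t x y assume y: "y \<in> {0..H}"
    show "((\<lambda>s. V1 (s, x, y)) has_real_derivative - (px (t, x, y) + 2 * V1 (t, x, y) * V1x (t, x, y)
        + (V1y (t, x, y) * V2 (t, x, y) + V1 (t, x, y) * V2y (t, x, y)))) (at t)"
      by (rule DERIV_cong[OF V1D(5)[OF y]]) (simp add: E1[OF y] div[OF y])
    show "((\<lambda>s. p (t, s, y) + (V1 (t, s, y))\<^sup>2) has_real_derivative px (t, x, y) + 2 * V1 (t, x, y) * V1x (t, x, y)) (at x)"
      by (rule derivative_eq_intros pD(6)[OF y] V1D(6)[OF y] refl)+ simp
    show "((\<lambda>s. V1 (t, x, s) * V2 (t, x, s)) has_real_derivative V1y (t, x, y) * V2 (t, x, y) + V1 (t, x, y) * V2y (t, x, y)) (at y within {0..H})"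
      by (rule derivative_eq_intros V2D(7)[OF y] V1D(7)[OF y] refl)+ simp
  qed (auto intro!: continuous_intros simp: perL wall)
  have cons_E: "J (\<lambda>z. (V1 (t, z))\<^sup>2 + (V2 (t, z))\<^sup>2) = J (\<lambda>z. (V1 (0, z))\<^sup>2 + (V2 (0, z))\<^sup>2)" for t
  proof (rule conservation_law[where q = "\<lambda>z. (V1 z)\<^sup>2 + (V2 z)\<^sup>2" and F = "\<lambda>z. V1 z * ((V1 z)\<^sup>2 + (V2 z)\<^sup>2 + 2 * p z)"
        and Fx = "\<lambda>z. V1x z * ((V1 z)\<^sup>2 + (V2 z)\<^sup>2 + 2 * p z) + V1 z * (2 * V1 z * V1x z + 2 * V2 z * V2x z + 2 * px z)"
        and G = "\<lambda>z. V2 z * ((V1 z)\<^sup>2 + (V2 z)\<^sup>2 + 2 * p z)"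
        and Gy = "\<lambda>z. V2y z * ((V1 z)\<^sup>2 + (V2 z)\<^sup>2 + 2 * p z) + V2 z * (2 * V1 z * V1y z + 2 * V2 z * V2y z + 2 * py z)"])
    fix t x y assume y: "y \<in> {0..H}"
    have "((\<lambda>s. (V1 (s, x, y))\<^sup>2 + (V2 (s, x, y))\<^sup>2) has_real_derivative 2 * V1 (t, x, y) * V1t (t, x, y) + 2 * V2 (t, x, y) * V2t (t, x, y)) (at t)"
      by (rule derivative_eq_intros V1D(5)[OF y] V2D(5)[OF y] refl)+ simp
    then show "((\<lambda>s. (V1 (s, x, y))\<^sup>2 + (V2 (s, x, y))\<^sup>2) has_real_derivative
        - (V1x (t, x, y) * ((V1 (t, x, y))\<^sup>2 + (V2 (t, x, y))\<^sup>2 + 2 * p (t, x, y))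
          + V1 (t, x, y) * (2 * V1 (t, x, y) * V1x (t, x, y) + 2 * V2 (t, x, y) * V2x (t, x, y) + 2 * px (t, x, y))
        + (V2y (t, x, y) * ((V1 (t, x, y))\<^sup>2 + (V2 (t, x, y))\<^sup>2 + 2 * p (t, x, y))
          + V2 (t, x, y) * (2 * V1 (t, x, y) * V1y (t, x, y) + 2 * V2 (t, x, y) * V2y (t, x, y) + 2 * py (t, x, y))))) (at t)"
      by (rule DERIV_cong) (simp add: E1[OF y] E2[OF y] div[OF y] algebra_simps)
    show "((\<lambda>s. V1 (t, s, y) * ((V1 (t, s, y))\<^sup>2 + (V2 (t, s, y))\<^sup>2 + 2 * p (t, s, y))) has_real_derivative
        V1x (t, x, y) * ((V1 (t, x, y))\<^sup>2 + (V2 (t, x, y))\<^sup>2 + 2 * p (t, x, y))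
          + V1 (t, x, y) * (2 * V1 (t, x, y) * V1x (t, x, y) + 2 * V2 (t, x, y) * V2x (t, x, y) + 2 * px (t, x, y))) (at x)"
      by (rule derivative_eq_intros V1D(6)[OF y] V2D(6)[OF y] pD(6)[OF y] refl)+ simp
    show "((\<lambda>s. V2 (t, x, s) * ((V1 (t, x, s))\<^sup>2 + (V2 (t, x, s))\<^sup>2 + 2 * p (t, x, s))) has_real_derivative
        V2y (t, x, y) * ((V1 (t, x, y))\<^sup>2 + (V2 (t, x, y))\<^sup>2 + 2 * p (t, x, y))
          + V2 (t, x, y) * (2 * V1 (t, x, y) * V1y (t, x, y) + 2 * V2 (t, x, y) * V2y (t, x, y) + 2 * py (t, x, y))) (at y within {0..H})"
      by (rule derivative_eq_intros V1D(7)[OF y] V2D(7)[OF y] pD(7)[OF y] refl)+ simp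
  qed (auto intro!: continuous_intros simp: perL wall)
  \<comment> \<open>For k = 0 the exponent \<open>k - 1\<close> is truncated to 0, which is harmless
    because of the factor \<open>real k\<close>.\<close>
  have cons_w: "J (\<lambda>z. (w (t, z)) ^ k) = J (\<lambda>z. (w (0, z)) ^ k)" for t k
  proof (rule conservation_law[where q = "\<lambda>z. (w z) ^ k" and F = "\<lambda>z. V1 z * (w z) ^ k"
        and Fx = "\<lambda>z. V1x z * (w z) ^ k + V1 z * (real k * (w z) ^ (k - 1) * wx z)" and G = "\<lambda>z. V2 z * (w z) ^ k"
        and Gy = "\<lambda>z. V2y z * (w z) ^ k + V2 z * (real k * (w z) ^ (k - 1) * wy z)"])
    fix t x y assume y: "y \<in> {0..H}"
    have "((\<lambda>s. (w (s, x, y)) ^ k) has_real_derivative real k * (w (t, x, y)) ^ (k - 1) * wt (t, x, y)) (at t)"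
      by (rule derivative_eq_intros wD(5)[OF y] refl)+ simp
    then show "((\<lambda>s. (w (s, x, y)) ^ k) has_real_derivative
        - (V1x (t, x, y) * (w (t, x, y)) ^ k + V1 (t, x, y) * (real k * (w (t, x, y)) ^ (k - 1) * wx (t, x, y))
          + (V2y (t, x, y) * (w (t, x, y)) ^ k + V2 (t, x, y) * (real k * (w (t, x, y)) ^ (k - 1) * wy (t, x, y))))) (at t)"
      by (rule DERIV_cong) (simp add: transport[OF y] div[OF y] algebra_simps)
    show "((\<lambda>s. V1 (t, s, y) * (w (t, s, y)) ^ k) has_real_derivative
        V1x (t, x, y) * (w (t, x, y)) ^ k + V1 (t, x, y) * (real k * (w (t, x, y)) ^ (k - 1) * wx (t, x, y))) (at x)"
      by (rule derivative_eq_intros V1D(6)[OF y] wD(6)[OF y] refl)+ simp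
    show "((\<lambda>s. V2 (t, x, s) * (w (t, x, s)) ^ k) has_real_derivative
        V2y (t, x, y) * (w (t, x, y)) ^ k + V2 (t, x, y) * (real k * (w (t, x, y)) ^ (k - 1) * wy (t, x, y))) (at y within {0..H})"
      by (rule derivative_eq_intros V2D(7)[OF y] wD(7)[OF y] refl)+ simp
  qed (auto intro!: continuous_intros simp: perL wall)
  \<comment> \<open>The weight x2 leaves the source V2 w in the transport equation. By
    incompressibility it is a divergence: the x1-derivative of (V2^2 - V1^2) / 2 minus the
    x2-derivative of V1 V2.\<close>
  have cons_yw: "J (\<lambda>z. snd z * w (t, z)) = J (\<lambda>z. snd z * w (0, z))" for t
  proof -
    have "J (\<lambda>z. (\<lambda>u. snd (snd u) * w u) (t, z)) = J (\<lambda>z. (\<lambda>u. snd (snd u) * w u) (0, z))"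
    proof (rule conservation_law[where F = "\<lambda>z. snd (snd z) * (V1 z * w z) - ((V2 z)\<^sup>2 - (V1 z)\<^sup>2) / 2"
        and Fx = "\<lambda>z. snd (snd z) * (V1x z * w z + V1 z * wx z) - (V2 z * V2x z - V1 z * V1x z)"
        and G = "\<lambda>z. snd (snd z) * (V2 z * w z) + V1 z * V2 z"
        and Gy = "\<lambda>z. V2 z * w z + snd (snd z) * (V2y z * w z + V2 z * wy z) + (V1y z * V2 z + V1 z * V2y z)"], unfold snd_conv)
      fix t x y assume y: "y \<in> {0..H}"
      have "((\<lambda>s. y * w (s, x, y)) has_real_derivative y * wt (t, x, y)) (at t)"
        by (intro DERIV_cmult wD(5)[OF y])
      then show "((\<lambda>s. y * w (s, x, y)) has_real_derivative
        - (y * (V1x (t, x, y) * w (t, x, y) + V1 (t, x, y) * wx (t, x, y)) - (V2 (t, x, y) * V2x (t, x, y) - V1 (t, x, y) * V1x (t, x, y))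
         + (V2 (t, x, y) * w (t, x, y) + y * (V2y (t, x, y) * w (t, x, y) + V2 (t, x, y) * wy (t, x, y))
           + (V1y (t, x, y) * V2 (t, x, y) + V1 (t, x, y) * V2y (t, x, y))))) (at t)"
        by (rule DERIV_cong) (simp add: transport[OF y] div[OF y] algebra_simps, simp add: w_def algebra_simps)
      show "((\<lambda>s. y * (V1 (t, s, y) * w (t, s, y)) - ((V2 (t, s, y))\<^sup>2 - (V1 (t, s, y))\<^sup>2) / 2) has_real_derivative
        y * (V1x (t, x, y) * w (t, x, y) + V1 (t, x, y) * wx (t, x, y)) - (V2 (t, x, y) * V2x (t, x, y) - V1 (t, x, y) * V1x (t, x, y))) (at x)"
        by (auto intro!: derivative_eq_intros V1D(6)[OF y] V2D(6)[OF y] wD(6)[OF y] simp: field_simps)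
      show "((\<lambda>s. s * (V2 (t, x, s) * w (t, x, s)) + V1 (t, x, s) * V2 (t, x, s)) has_real_derivative
        V2 (t, x, y) * w (t, x, y) + y * (V2y (t, x, y) * w (t, x, y) + V2 (t, x, y) * wy (t, x, y))
           + (V1y (t, x, y) * V2 (t, x, y) + V1 (t, x, y) * V2y (t, x, y))) (at y within {0..H})"
        by (rule derivative_eq_intros V1D(7)[OF y] V2D(7)[OF y] wD(7)[OF y] refl)+ (simp add: algebra_simps)
    qed (auto intro!: continuous_intros simp: perL wall)
    then show ?thesis by simp
  qed
  define m where "m = J (\<lambda>z. V1 (0, z)) / (L * H)"
  have mt: "J (\<lambda>z. V1 (t, z)) = m * (L * H)" for t unfolding cons_V1[of t] m_def using L H by simp
  define \<Psi> where "\<Psi> = (\<lambda>t z. integral {0..snd z} (\<lambda>s. V1 (t, fst z, s) - m))"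
  define \<Psi>x where "\<Psi>x = (\<lambda>t z. - V2 (t, z))"
  define \<Psi>y where "\<Psi>y = (\<lambda>t z. V1 (t, z) - m)"
  have c\<Psi>: "continuous_on Q (\<Psi>x t)" "continuous_on Q (\<Psi>y t)" for t
    unfolding \<Psi>x_def \<Psi>y_def by (intro continuous_intros cont_channel_Q V1D V2D)+
  have dx: "((\<lambda>s. \<Psi> t (s, y)) has_real_derivative \<Psi>x t (x, y)) (at x)" if y: "y \<in> {0..H}" for t x y
  proof -
    have sub: "{0..y} \<subseteq> {0..H}" using y by auto
    have "((\<lambda>x. integral (cbox 0 y) (\<lambda>s. V1 (t, x, s) - m)) has_real_derivative integral (cbox 0 y) (\<lambda>s. V1x (t, x, s))) (at x)"
    proof (rule leibniz_rule_field_derivative[where U = UNIV and fx = "\<lambda>x s. V1x (t, x, s)"])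
      show "((\<lambda>x. V1 (t, x, s) - m) has_real_derivative V1x (t, x, s)) (at x)" if "x \<in> UNIV" "s \<in> cbox 0 y" for x s
        using that sub by (auto intro!: derivative_eq_intros V1D(6))
      show "(\<lambda>s. V1 (t, x, s) - m) integrable_on cbox 0 y" for x
        using continuous_on_subset[OF continuous_channel_slice(3)[OF V1D(1)] sub, of t x]
        by (auto intro!: integrable_continuous_real continuous_intros)
      show "continuous_on (UNIV \<times> cbox 0 y) (\<lambda>(x, s). V1x (t, x, s))"
        using sub by (intro continuous_on_subset[OF continuous_channel_slice(2)[OF V1D(3)]]) auto
    qed auto
    moreover have "integral (cbox 0 y) (\<lambda>s. V1x (t, x, s)) = - V2 (t, x, y)"
    proof -
      have "((\<lambda>s. V1x (t, x, s)) has_integral - V2 (t, x, y) - - V2 (t, x, 0)) {0..y}"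
      proof (rule fundamental_theorem_of_calculus)
        fix s assume "s \<in> {0..y}"
        then have s: "s \<in> {0..H}" using sub by auto
        have "((\<lambda>s. - V2 (t, x, s)) has_real_derivative V1x (t, x, s)) (at s within {0..H})"
          using DERIV_minus[OF V2D(7)[OF s, of t x]] div[OF s] by simp
        then show "((\<lambda>s. - V2 (t, x, s)) has_vector_derivative V1x (t, x, s)) (at s within {0..y})"
          unfolding has_real_derivative_iff_has_vector_derivative[symmetric]
          by (rule has_field_derivative_subset[OF _ sub])
      qed (use y in auto)
      then show ?thesis by (simp add: wall integral_unique)
    qed
    ultimately show ?thesis unfolding \<Psi>_def \<Psi>x_def by simp
  qed
  have dy: "((\<lambda>s. \<Psi> t (x, s)) has_real_derivative \<Psi>y t (x, y)) (at y within {0..H})" if y: "y \<in> {0..H}" for t x y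
    unfolding \<Psi>_def \<Psi>y_def fst_conv snd_conv
    by (rule integral_has_real_derivative[where g = "\<lambda>s. V1 (t, x, s) - m", OF _ y])
      (intro continuous_intros continuous_channel_slice(3)[OF V1D(1)])
  \<comment> \<open>On the upper wall \<Psi> is constant in x1, because its x1-derivative is minus
    V2 there. Its mean over x1 is the integral of V1 - m over the cell divided by L, which is zero
    by the choice of \<open>m\<close>.\<close>
  have top: "\<Psi> t (x, H) = 0" for t x
  proof -
    have const: "\<Psi> t (x, H) = \<Psi> t (0, H)" for x
      using DERIV_isconst_all[of "\<lambda>x. \<Psi> t (x, H)" x 0] dx[of H t] H by (simp add: \<Psi>x_def wall)
    have "J (\<Psi>y t) = integral {0..L} (\<lambda>x. \<Psi> t (x, H))"
      by (subst J_iter2[OF c\<Psi>(2)]) (simp add: \<Psi>_def \<Psi>y_def)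
    also have "\<dots> = integral {0..L} (\<lambda>x. \<Psi> t (0, H))" by (rule integral_cong) (rule const)
    also have "\<dots> = L * \<Psi> t (0, H)" using L by simp
    also have "J (\<Psi>y t) = J (\<lambda>z. V1 (t, z)) - J (\<lambda>z. m)"
      unfolding \<Psi>y_def by (intro J_diff cont_channel_Q V1D continuous_intros)
    finally have "\<Psi> t (0, H) = 0" using L by (simp add: mt J_const)
    then show ?thesis using const by simp
  qed
  have stream: "stream_fun (\<Psi> t) (\<Psi>x t) (\<Psi>y t)" for t
    unfolding stream_fun_def
  proof (intro conjI ballI c\<Psi> dy)
    show "continuous_on Q (\<Psi> t)"
      by (rule continuous_on_Q_if_C1[OF c\<Psi>]) (auto intro: has_field_derivative_at_within[OF dx] dy)
    show "((\<lambda>s. \<Psi> t (s, y)) has_real_derivative \<Psi>x t (x, y)) (at x within {0..L})" if "y \<in> {0..H}" for x y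
      by (rule has_field_derivative_at_within[OF dx[OF that]])
    show "\<Psi> t (L, y) = \<Psi> t (0, y)" if y: "y \<in> {0..H}" for y
      unfolding \<Psi>_def using y by (auto intro!: integral_cong simp: perL)
  qed (auto simp: top, simp add: \<Psi>_def)
  have weak: "weak_vorticity (\<Psi>x t) (\<Psi>y t) (\<lambda>z. w (t, z))" for t
  proof (rule weak_vorticityI[OF c\<Psi>, where \<psi>xx = "\<lambda>z. - V2x (t, z)" and \<psi>yy = "\<lambda>z. V1y (t, z)"])
    show "continuous_on Q (\<lambda>z. - V2x (t, z))" "continuous_on Q (\<lambda>z. V1y (t, z))"
      by (intro continuous_intros cont_channel_Q V2D V1D)+
    fix x y assume y: "y \<in> {0..H}"
    show "((\<lambda>s. \<Psi>x t (s, y)) has_real_derivative - V2x (t, x, y)) (at x within {0..L})"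
      unfolding \<Psi>x_def by (intro DERIV_minus has_field_derivative_at_within[OF V2D(6)[OF y]])
    show "((\<lambda>s. \<Psi>y t (x, s)) has_real_derivative V1y (t, x, y)) (at y within {0..H})"
      unfolding \<Psi>y_def by (auto intro!: derivative_eq_intros V1D(7)[OF y])
    show "\<Psi>x t (L, y) = \<Psi>x t (0, y)" using y by (simp add: \<Psi>x_def perL)
  qed (auto simp: w_def)
  \<comment> \<open>The Dirichlet integral is the integral of the squared speed minus the share of
    the mean flow, and both are conserved.\<close>
  have energy: "dirichlet (\<Psi>x t) (\<Psi>y t) = J (\<lambda>z. (V1 (t, z))\<^sup>2 + (V2 (t, z))\<^sup>2) - m\<^sup>2 * (L * H)" for t
  proof -
    note cQ = cont_channel_Q[OF V1D(1)] cont_channel_Q[OF V2D(1)]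
    have "dirichlet (\<Psi>x t) (\<Psi>y t) = J (\<lambda>z. ((V1 (t, z))\<^sup>2 + (V2 (t, z))\<^sup>2) - (2 * m * V1 (t, z) - m\<^sup>2))"
      by (intro J_cong) (simp add: \<Psi>x_def \<Psi>y_def power2_eq_square algebra_simps)
    also have "\<dots> = J (\<lambda>z. (V1 (t, z))\<^sup>2 + (V2 (t, z))\<^sup>2) - (2 * m * J (\<lambda>z. V1 (t, z)) - J (\<lambda>z. m\<^sup>2))"
      by (subst J_diff, (intro continuous_intros cQ)+, subst J_diff, (intro continuous_intros cQ)+, simp only: J_cmult)
    finally show ?thesis by (simp add: mt J_const power2_eq_square)
  qed
  show ?thesis unfolding conserved_flow_def
  proof (rule exI[of _ "\<lambda>t z. w (t, z)"], rule exI[of _ \<Psi>], rule exI[of _ \<Psi>x], rule exI[of _ \<Psi>y],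
      intro conjI allI impI stream weak cons_yw)
    show "continuous_on Q (\<lambda>z. w (t, z))" for t by (rule cont_channel_Q[OF wD(1)])
    show "w (t, x, y) = vorticity (v t) (x, y)" if "0 < y" "y < H" for t x y
      using interior(4)[OF that] by (simp add: w_def)
    show "J (\<lambda>z. (w (t, z)) ^ k) = J (\<lambda>z. (w (0, z)) ^ k)" for t k by (rule cons_w)
    show "dirichlet (\<Psi>x t) (\<Psi>y t) = dirichlet (\<Psi>x 0) (\<Psi>y 0)" for t
      unfolding energy cons_E[of t] ..
  qed
qed

end

subsection \<open>Orbital stability\<close>

lemma omega_bar_eq:
  "omega_bar L H a b c d z = ((2 * pi / L)\<^sup>2 + (pi / H)\<^sup>2) *
     ((a * cos (2 * pi / L * fst z) + b * sin (2 * pi / L * fst z)) * sin (pi / H * snd z))"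
proof -
  define \<kappa> \<eta> where "\<kappa> = 2 * pi / L" and "\<eta> = pi / H"
  have psi: "psi_bar L H a b c d = (\<lambda>z. (a * cos (\<kappa> * fst z) + b * sin (\<kappa> * fst z)) * sin (\<eta> * snd z) + c * snd z + d)"
    by (simp add: psi_bar_def \<kappa>_def \<eta>_def fun_eq_iff algebra_simps)
  have 1: "pd1 (psi_bar L H a b c d) = (\<lambda>z. \<kappa> * (b * cos (\<kappa> * fst z) - a * sin (\<kappa> * fst z)) * sin (\<eta> * snd z))"
  proof
    fix z :: "real \<times> real"
    show "pd1 (psi_bar L H a b c d) z = \<kappa> * (b * cos (\<kappa> * fst z) - a * sin (\<kappa> * fst z)) * sin (\<eta> * snd z)"
      unfolding pd1_def psi
      by (rule vector_derivative_at, unfold has_real_derivative_iff_has_vector_derivative[symmetric])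
        (auto intro!: derivative_eq_intros simp: algebra_simps)
  qed
  have 11: "pd1 (pd1 (psi_bar L H a b c d)) z = - \<kappa>\<^sup>2 * ((a * cos (\<kappa> * fst z) + b * sin (\<kappa> * fst z)) * sin (\<eta> * snd z))"
    unfolding 1 pd1_def
    by (rule vector_derivative_at, unfold has_real_derivative_iff_has_vector_derivative[symmetric])
      (auto intro!: derivative_eq_intros simp: algebra_simps power2_eq_square)
  have 2: "pd2 (psi_bar L H a b c d) = (\<lambda>z. \<eta> * (a * cos (\<kappa> * fst z) + b * sin (\<kappa> * fst z)) * cos (\<eta> * snd z) + c)"
  proof
    fix z :: "real \<times> real"
    show "pd2 (psi_bar L H a b c d) z = \<eta> * (a * cos (\<kappa> * fst z) + b * sin (\<kappa> * fst z)) * cos (\<eta> * snd z) + c"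
      unfolding pd2_def psi
      by (rule vector_derivative_at, unfold has_real_derivative_iff_has_vector_derivative[symmetric])
        (auto intro!: derivative_eq_intros simp: algebra_simps)
  qed
  have 22: "pd2 (pd2 (psi_bar L H a b c d)) z = - \<eta>\<^sup>2 * ((a * cos (\<kappa> * fst z) + b * sin (\<kappa> * fst z)) * sin (\<eta> * snd z))"
    unfolding 2 pd2_def
    by (rule vector_derivative_at, unfold has_real_derivative_iff_has_vector_derivative[symmetric])
      (auto intro!: derivative_eq_intros simp: algebra_simps power2_eq_square)
  show ?thesis
    unfolding omega_bar_def laplacian_def 11 22 by (simp add: \<kappa>_def \<eta>_def algebra_simps)
qed

section \<open>The orbit as a circle and the distance to it\<close>

context periodic_cell
begin

lemma omega_bar_wave:
  "omega_bar L H a b c d = wave (((2 * pi / L)\<^sup>2 + (pi / H)\<^sup>2) * a) (((2 * pi / L)\<^sup>2 + (pi / H)\<^sup>2) * b) 0"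
  by (simp add: omega_bar_eq wave_def fun_eq_iff algebra_simps)

text \<open>Translation by \<alpha> rotates the pair (a, b) through an angle of size 2 pi \<alpha> /
  L, and rotations act transitively on the circle. The distance to the orbit thereby becomes a
  minimum over a compact set of parameters.\<close>

lemma orbit_wave: "orbit (wave a b 0) = {wave a' b' 0 | a' b'. a'\<^sup>2 + b'\<^sup>2 = a\<^sup>2 + b\<^sup>2}"
proof -
  define \<kappa> where "\<kappa> = 2 * pi / L"
  have \<kappa>: "\<kappa> \<noteq> 0" using L by (simp add: \<kappa>_def)
  have w: "wave a b 0 z = (a * cos (\<kappa> * fst z) + b * sin (\<kappa> * fst z)) * sin (pi / H * snd z)" for a b z
    by (simp add: wave_def \<kappa>_def)
  have shift: "(\<lambda>(x1, x2). wave a b 0 (x1 + \<alpha>, x2)) =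
      wave (a * cos (\<kappa> * \<alpha>) + b * sin (\<kappa> * \<alpha>)) (b * cos (\<kappa> * \<alpha>) - a * sin (\<kappa> * \<alpha>)) 0" for a b \<alpha>
    unfolding w split_beta fst_conv snd_conv distrib_left cos_add sin_add
    by (rule ext) (simp add: algebra_simps)
  have polar: "\<exists>t. a = sqrt (a\<^sup>2 + b\<^sup>2) * cos t \<and> b = sqrt (a\<^sup>2 + b\<^sup>2) * sin t" for a b :: real
  proof (cases "a\<^sup>2 + b\<^sup>2 = 0")
    case True
    then show ?thesis by (simp add: sum_power2_eq_zero_iff)
  next
    case False
    then have pos: "0 < a\<^sup>2 + b\<^sup>2" by (simp add: sum_power2_gt_zero_iff sum_power2_eq_zero_iff)
    have "(a / sqrt (a\<^sup>2 + b\<^sup>2))\<^sup>2 + (b / sqrt (a\<^sup>2 + b\<^sup>2))\<^sup>2 = 1"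
      using pos False by (simp add: power_divide add_divide_distrib[symmetric])
    then obtain t where t: "a / sqrt (a\<^sup>2 + b\<^sup>2) = cos t" "b / sqrt (a\<^sup>2 + b\<^sup>2) = sin t"
      by (rule sincos_total_2pi)
    have ne: "sqrt (a\<^sup>2 + b\<^sup>2) \<noteq> 0"
      by (rule less_imp_neq[OF real_sqrt_gt_zero[OF pos], THEN not_sym])
    have cancel: "s * (u / s) = u" if "s \<noteq> 0" for s u :: real using that by simp
    show ?thesis
      by (intro exI[of _ t] conjI; unfold t[symmetric]) (rule cancel[OF ne, symmetric])+
  qed
  show ?thesis
  proof (intro equalityI subsetI)
    fix u assume "u \<in> orbit (wave a b 0)"
    then obtain \<alpha> where u: "u = wave (a * cos (\<kappa> * \<alpha>) + b * sin (\<kappa> * \<alpha>)) (b * cos (\<kappa> * \<alpha>) - a * sin (\<kappa> * \<alpha>)) 0"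
      unfolding orbit_def shift by blast
    have "(a * cos (\<kappa> * \<alpha>) + b * sin (\<kappa> * \<alpha>))\<^sup>2 + (b * cos (\<kappa> * \<alpha>) - a * sin (\<kappa> * \<alpha>))\<^sup>2
       = (a\<^sup>2 + b\<^sup>2) * ((sin (\<kappa> * \<alpha>))\<^sup>2 + (cos (\<kappa> * \<alpha>))\<^sup>2)"
      by (simp only: power2_eq_square) (simp only: algebra_simps)
    then show "u \<in> {wave a' b' 0 | a' b'. a'\<^sup>2 + b'\<^sup>2 = a\<^sup>2 + b\<^sup>2}" using u by auto
  next
    fix u assume "u \<in> {wave a' b' 0 | a' b'. a'\<^sup>2 + b'\<^sup>2 = a\<^sup>2 + b\<^sup>2}"
    then obtain a' b' where u: "u = wave a' b' 0" and eq: "a'\<^sup>2 + b'\<^sup>2 = a\<^sup>2 + b\<^sup>2" by blast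
    define R where "R = sqrt (a\<^sup>2 + b\<^sup>2)"
    obtain t where t: "a = R * cos t" "b = R * sin t" using polar[of a b] unfolding R_def by blast
    obtain t' where t': "a' = R * cos t'" "b' = R * sin t'" using polar[of a' b'] unfolding R_def eq by blast
    have k: "\<kappa> * ((t - t') / \<kappa>) = t - t'" using \<kappa> by simp
    have "a * cos (t - t') + b * sin (t - t') = a'"
    proof -
      have "a * cos (t - t') + b * sin (t - t') = R * cos (t - (t - t'))"
        unfolding t cos_diff[of t "t - t'"] by (simp add: algebra_simps)
      then show ?thesis by (simp add: t')
    qed
    moreover have "b * cos (t - t') - a * sin (t - t') = b'"
    proof -
      have "b * cos (t - t') - a * sin (t - t') = R * sin (t - (t - t'))"
        unfolding t sin_diff[of t "t - t'"] by (simp add: algebra_simps)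
      then show ?thesis by (simp add: t')
    qed
    ultimately have "u = (\<lambda>(x1, x2). wave a b 0 (x1 + (t - t') / \<kappa>, x2))"
      unfolding u shift k by simp
    then show "u \<in> orbit (wave a b 0)" unfolding orbit_def by blast
  qed
qed

text \<open>Passage from the Lebesgue integral over the half-open cell to the integral over the
  closed rectangle, from which it differs by a negligible set. Agreement of the two functions
  between the walls is enough, as holds for a vorticity and its continuous representative.\<close>

lemma Lp_norm_eq:
  assumes p: "0 < p" and c: "continuous_on Q f" and eq: "\<And>x y. 0 < y \<Longrightarrow> y < H \<Longrightarrow> g (x, y) = f (x, y)"
  shows "Lp_norm L H p g = (J (\<lambda>z. \<bar>f z\<bar> powr p)) powr (1 / p)"
proof -
  let ?h = "\<lambda>z. \<bar>f z\<bar> powr p"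
  have ch: "continuous_on Q ?h" by (rule cont_powr[OF p c])
  have cell: "cell L H \<in> sets borel"
    unfolding cell_def by (intro borel_Times) auto
  have sub: "cell L H \<subseteq> Q" by (auto simp: cell_def)
  have bsub: "box (0, 0) (L, H) \<subseteq> cell L H" by (auto simp: cell_def mem_box Basis_prod_def)
  have "set_integrable lborel Q ?h"
    unfolding Q_cbox by (rule borel_integrable_compact[unfolded set_integrable_def[symmetric]]) (use ch in \<open>auto simp: Q_cbox\<close>)
  then have si: "set_integrable lborel (cell L H) ?h"
    by (rule set_integrable_subset) (use cell sub in auto)
  have "(LINT x:cell L H|lborel. \<bar>g x\<bar> powr p) = (LINT x:cell L H|lborel. ?h x)"
    by (rule set_lebesgue_integral_cong) (use cell eq in \<open>auto simp: cell_def\<close>)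
  also have "\<dots> = integral (cell L H) ?h" by (rule set_borel_integral_eq_integral(2)[OF si])
  also have "\<dots> = J ?h"
  proof (rule integral_spike_set)
    show "negligible {x \<in> cell L H - Q. ?h x \<noteq> 0}"
      using sub by (auto intro: negligible_subset[OF negligible_empty])
    show "negligible {x \<in> Q - cell L H. ?h x \<noteq> 0}"
      using bsub by (intro negligible_subset[OF negligible_frontier_interval[of "(0, 0)" "(L, H)"]]) (auto simp: Q_cbox)
  qed
  finally show ?thesis by (simp add: Lp_norm_def)
qed

text \<open>The p-th power of the distance depends continuously on the amplitudes, which run over a
  compact circle, so its minimum is attained.\<close>

lemma orbit_minimizer:
  assumes p: "0 < p" and c: "continuous_on Q f" and eq: "\<And>x y. 0 < y \<Longrightarrow> y < H \<Longrightarrow> g (x, y) = f (x, y)"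
  shows "\<exists>u. is_arg_min (\<lambda>u. Lp_norm L H p (\<lambda>x. g x - u x)) (\<lambda>u. u \<in> orbit (wave a b 0)) u"
proof -
  let ?N = "\<lambda>q. J (\<lambda>z. \<bar>f z - wave (fst q) (snd q) 0 z\<bar> powr p)"
  let ?S = "{q :: real \<times> real. (fst q)\<^sup>2 + (snd q)\<^sup>2 = a\<^sup>2 + b\<^sup>2}"
  have norm: "Lp_norm L H p (\<lambda>x. g x - wave a' b' 0 x) = ?N (a', b') powr (1 / p)" for a' b'
    by (rule Lp_norm_eq[OF p]) (auto intro!: continuous_intros c simp: eq)
  have nn: "0 \<le> ?N q" for q
    by (intro J_nonneg cont_powr[OF p] continuous_intros c) auto
  have "compact ?S"
  proof -
    have "closed ?S" by (intro closed_Collect_eq continuous_intros)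
    moreover have "\<forall>q\<in>?S. norm q \<le> sqrt (a\<^sup>2 + b\<^sup>2)"
      by (auto simp: norm_Pair)
    then have "bounded ?S" unfolding bounded_iff by blast
    ultimately show ?thesis by (simp only: compact_eq_bounded_closed)
  qed
  moreover have "?S \<noteq> {}" using exI[of _ "(a, b)"] by auto
  moreover have "continuous_on ?S ?N"
  proof -
    have "continuous_on UNIV (\<lambda>q. integral (cbox (0, 0) (L, H)) (\<lambda>z. \<bar>f z - wave (fst q) (snd q) 0 z\<bar> powr p))"
    proof (rule integral_continuous_on_param)
      have "continuous_on (UNIV \<times> cbox (0, 0) (L, H)) (\<lambda>u :: (real \<times> real) \<times> real \<times> real. f (snd u))"
        by (rule continuous_on_compose2[OF c]) (auto simp: Q_cbox intro!: continuous_intros)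
      then show "continuous_on (UNIV \<times> cbox (0, 0) (L, H)) (\<lambda>(q :: real \<times> real, z). \<bar>f z - wave (fst q) (snd q) 0 z\<bar> powr p)"
        unfolding split_beta wave_def using p by (intro continuous_on_powr' continuous_intros) auto
    qed
    then show ?thesis unfolding Q_cbox by (rule continuous_on_subset) auto
  qed
  ultimately obtain q where q: "q \<in> ?S" and min: "\<forall>q'\<in>?S. ?N q \<le> ?N q'"
    using continuous_attains_inf[of ?S ?N] by auto
  show ?thesis
  proof (intro exI[of _ "wave (fst q) (snd q) 0"])
    have "\<not> Lp_norm L H p (\<lambda>x. g x - u x) < Lp_norm L H p (\<lambda>x. g x - wave (fst q) (snd q) 0 x)"
      if "u \<in> orbit (wave a b 0)" for u
    proof -
      obtain a' b' where u: "u = wave a' b' 0" "a'\<^sup>2 + b'\<^sup>2 = a\<^sup>2 + b\<^sup>2"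
        using \<open>u \<in> orbit (wave a b 0)\<close> unfolding orbit_wave by blast
      have "?N q \<le> ?N (a', b')" using min u(2) by auto
      then have "?N q powr (1 / p) \<le> ?N (a', b') powr (1 / p)" using nn p by (intro powr_mono2) auto
      then show ?thesis unfolding u(1) norm by simp
    qed
    moreover have "wave (fst q) (snd q) 0 \<in> orbit (wave a b 0)" using q unfolding orbit_wave by blast
    ultimately show "is_arg_min (\<lambda>u. Lp_norm L H p (\<lambda>x. g x - u x)) (\<lambda>u. u \<in> orbit (wave a b 0)) (wave (fst q) (snd q) 0)"
      unfolding is_arg_min_def by blast
  qed
qed

text \<open>Weierstrass approximation on an interval containing all values of f and g. It yields
  conservation for functions of the vorticity that are not polynomials, such as its truncation, from
  the conservation of powers and without the particle trajectories.\<close>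

lemma casimirs_from_moments:
  fixes h :: "real \<Rightarrow> real"
  assumes c: "continuous_on Q f" "continuous_on Q g"
    and m: "\<And>k. J (\<lambda>z. (f z) ^ k) = J (\<lambda>z. (g z) ^ k)"
    and h: "continuous_on UNIV h"
  shows "J (\<lambda>z. h (f z)) = J (\<lambda>z. h (g z))"
proof -
  have "compact Q" unfolding Q_cbox by (rule compact_cbox)
  then have "bounded (f ` Q)" "bounded (g ` Q)" by (intro compact_imp_bounded compact_continuous_image c; simp)+
  then obtain B1 B2 where B: "\<forall>z\<in>Q. \<bar>f z\<bar> \<le> B1" "\<forall>z\<in>Q. \<bar>g z\<bar> \<le> B2"
    unfolding bounded_iff real_norm_def by blast
  define B where "B = max B1 B2"
  have fB: "f z \<in> {-B..B}" "g z \<in> {-B..B}" if "z \<in> Q" for z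
    using B(1)[rule_format, OF that] B(2)[rule_format, OF that] by (auto simp: B_def)
  have LH: "0 < L * H" using L H by simp
  have ch: "continuous_on Q (\<lambda>z. h (u z))" if "continuous_on Q u" for u
    by (rule continuous_on_compose2[OF h that]) auto
  have "\<bar>J (\<lambda>z. h (f z)) - J (\<lambda>z. h (g z))\<bar> \<le> e" if e: "0 < e" for e
  proof -
    define e' where "e' = e / (2 * (L * H))"
    have e': "0 < e'" "2 * (e' * (L * H)) = e" using e L H by (auto simp: e'_def)
    obtain q where q: "real_polynomial_function q" "\<And>x. x \<in> {-B..B} \<Longrightarrow> \<bar>h x - q x\<bar> < e'"
      using Stone_Weierstrass_real_polynomial_function[of "{-B..B}" h e'] continuous_on_subset[OF h] e'(1) by auto
    then obtain a n where qs: "q = (\<lambda>x. \<Sum>i\<le>n. a i * x ^ i)"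
      unfolding real_polynomial_function_iff_sum by blast
    have Jq: "J (\<lambda>z. q (u z)) = (\<Sum>i\<le>n. a i * J (\<lambda>z. (u z) ^ i))" if "continuous_on Q u" for u
      unfolding qs by (subst integral_sum) (auto intro!: integrable_Q continuous_intros that)
    have near: "\<bar>J (\<lambda>z. h (u z)) - J (\<lambda>z. q (u z))\<bar> \<le> e' * (L * H)"
      if u: "continuous_on Q u" and uB: "\<And>z. z \<in> Q \<Longrightarrow> u z \<in> {-B..B}" for u
    proof -
      have cq: "continuous_on Q (\<lambda>z. q (u z))" unfolding qs by (intro continuous_intros u)
      have "J (\<lambda>z. h (u z)) - J (\<lambda>z. q (u z)) = J (\<lambda>z. h (u z) - q (u z))"
        by (intro J_diff[symmetric] ch u cq)
      also have "\<bar>\<dots>\<bar> \<le> J (\<lambda>z. \<bar>h (u z) - q (u z)\<bar>)" by (intro J_abs_le continuous_intros ch u cq)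
      also have "\<dots> \<le> J (\<lambda>z. e')"
        by (intro J_mono continuous_intros ch u cq less_imp_le q(2) uB)
      finally show ?thesis by (simp add: J_const)
    qed
    have "J (\<lambda>z. q (f z)) = J (\<lambda>z. q (g z))" by (simp add: Jq c m)
    then show ?thesis using near[OF c(1) fB(1)] near[OF c(2) fB(2)] e'(2) by linarith
  qed
  then show ?thesis using field_le_epsilon[of "\<bar>J (\<lambda>z. h (f z)) - J (\<lambda>z. h (g z))\<bar>" 0] by simp
qed

section \<open>Stability along sequences of flows and times\<close>

lemma stream_fun_diff:
  assumes f: "stream_fun f fx fy" and g: "stream_fun g gx gy"
  shows "stream_fun (\<lambda>z. f z - g z) (\<lambda>z. fx z - gx z) (\<lambda>z. fy z - gy z)"
  using stream_funD[OF f] stream_funD[OF g] unfolding stream_fun_def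
  by (auto intro!: continuous_intros DERIV_diff)

lemma weak_vorticityD:
  "weak_vorticity \<psi>x \<psi>y w \<Longrightarrow> stream_fun f fx fy \<Longrightarrow>
     J (\<lambda>z. fx z * \<psi>x z + fy z * \<psi>y z) = J (\<lambda>z. f z * w z)"
  unfolding weak_vorticity_def by blast

lemma weak_vorticity_diff:
  assumes f: "weak_vorticity fx fy w" and g: "weak_vorticity gx gy u"
    and c [continuous_intros]: "continuous_on Q fx" "continuous_on Q fy" "continuous_on Q gx" "continuous_on Q gy"
      "continuous_on Q w" "continuous_on Q u"
  shows "weak_vorticity (\<lambda>z. fx z - gx z) (\<lambda>z. fy z - gy z) (\<lambda>z. w z - u z)"
  unfolding weak_vorticity_def
proof (intro allI impI)
  fix h hx hy assume s: "stream_fun h hx hy"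
  note stream_funD(1-3)[OF s, continuous_intros]
  have "J (\<lambda>z. hx z * (fx z - gx z) + hy z * (fy z - gy z)) = J (\<lambda>z. (hx z * fx z + hy z * fy z) - (hx z * gx z + hy z * gy z))"
    by (intro J_cong) (simp add: algebra_simps)
  also have "\<dots> = J (\<lambda>z. hx z * fx z + hy z * fy z) - J (\<lambda>z. hx z * gx z + hy z * gy z)"
    by (intro J_diff continuous_intros)
  also have "\<dots> = J (\<lambda>z. h z * w z) - J (\<lambda>z. h z * u z)"
    by (simp only: weak_vorticityD[OF f s] weak_vorticityD[OF g s])
  also have "\<dots> = J (\<lambda>z. h z * w z - h z * u z)" by (intro J_diff[symmetric] continuous_intros)
  finally show "J (\<lambda>z. hx z * (fx z - gx z) + hy z * (fy z - gy z)) = J (\<lambda>z. h z * (w z - u z))"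
    by (simp add: right_diff_distrib)
qed

text \<open>The times \<open>\<tau> n\<close> are arbitrary: the hypotheses of the null space
  argument are integrals that conservation carries back to time 0, where closeness to the wave
  evaluates their limits. Sequences allow all error terms to be treated as null sequences without
  tracking constants.\<close>

lemma orbital_stability_sequence:
  assumes spectral: "(2 * pi / L)\<^sup>2 + (pi / H)\<^sup>2 \<le> (2 * pi / H)\<^sup>2" and p: "1 < p"
    and cw: "\<And>n t. continuous_on Q (w n t)"
    and moments: "\<And>n t k. J (\<lambda>z. (w n t z) ^ k) = J (\<lambda>z. (w n 0 z) ^ k)"
    and impulse: "\<And>n t. J (\<lambda>z. snd z * w n t z) = J (\<lambda>z. snd z * w n 0 z)"
    and stream: "\<And>n t. stream_fun (\<Psi> n t) (\<Psi>x n t) (\<Psi>y n t)"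
    and weak: "\<And>n t. weak_vorticity (\<Psi>x n t) (\<Psi>y n t) (w n t)"
    and energy: "\<And>n t. dirichlet (\<Psi>x n t) (\<Psi>y n t) = dirichlet (\<Psi>x n 0) (\<Psi>y n 0)"
    and lim: "(\<lambda>n. J (\<lambda>z. \<bar>w n 0 z - wave a b 0 z\<bar> powr p)) \<longlonglongrightarrow> 0"
  shows "\<exists>a' b'. (\<forall>n. (a' n)\<^sup>2 + (b' n)\<^sup>2 = a\<^sup>2 + b\<^sup>2) \<and>
     (\<lambda>n. J (\<lambda>z. \<bar>w n (\<tau> n) z - wave (a' n) (b' n) 0 z\<bar> powr p)) \<longlonglongrightarrow> 0"
proof -
  have p0: "0 < p" using p by simp
  note cp = cont_powr[OF p0]
  note cw [continuous_intros]
  define \<kappa> \<eta> where "\<kappa> = 2 * pi / L" and "\<eta> = pi / H"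
  define \<Lambda> where "\<Lambda> = \<kappa>\<^sup>2 + \<eta>\<^sup>2"
  have \<Lambda>: "0 < \<Lambda>" using L by (auto simp: \<Lambda>_def \<kappa>_def intro!: add_pos_nonneg)
  define W where "W = wave a b 0"
  have cW [continuous_intros]: "continuous_on S W" for S unfolding W_def by (intro continuous_intros)
  have W: "W z = (a * cos (\<kappa> * fst z) + b * sin (\<kappa> * fst z)) * sin (\<eta> * snd z)" for z
    by (simp add: W_def wave_def \<kappa>_def \<eta>_def)
  \<comment> \<open>The stream function of the wave in the frame of zero mean velocity:
    \<open>W\<close> vanishes on the walls and is an eigenfunction of the Laplacian with eigenvalue
    -\<Lambda>.\<close>
  define f where "f = (\<lambda>z. W z / \<Lambda>)"
  define fx where "fx = (\<lambda>z. \<kappa> * (b * cos (\<kappa> * fst z) - a * sin (\<kappa> * fst z)) * sin (\<eta> * snd z) / \<Lambda>)"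
  define fy where "fy = (\<lambda>z. \<eta> * (a * cos (\<kappa> * fst z) + b * sin (\<kappa> * fst z)) * cos (\<eta> * snd z) / \<Lambda>)"
  have cf [continuous_intros]: "continuous_on S f" "continuous_on S fx" "continuous_on S fy" for S
    unfolding f_def fx_def fy_def using \<Lambda> by (auto intro!: continuous_intros)
  have kL: "\<kappa> * L = 2 * pi" and eH: "\<eta> * H = pi" using L H by (auto simp: \<kappa>_def \<eta>_def)
  have sf: "stream_fun f fx fy"
    unfolding stream_fun_def
  proof (intro conjI ballI cf)
    show "((\<lambda>s. f (s, y)) has_real_derivative fx (x, y)) (at x within {0..L})" for x y
      unfolding f_def fx_def W by (auto intro!: derivative_eq_intros DERIV_cdivide simp: algebra_simps)
    show "((\<lambda>s. f (x, s)) has_real_derivative fy (x, y)) (at y within {0..H})" for x y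
      unfolding f_def fy_def W by (auto intro!: derivative_eq_intros DERIV_cdivide simp: algebra_simps)
  qed (auto simp: f_def W kL eH)
  have wf: "weak_vorticity fx fy W"
  proof (rule weak_vorticityI[OF cf(2,3), where \<psi>xx = "\<lambda>z. - \<kappa>\<^sup>2 * W z / \<Lambda>" and \<psi>yy = "\<lambda>z. - \<eta>\<^sup>2 * W z / \<Lambda>"])
    show "continuous_on Q (\<lambda>z. - \<kappa>\<^sup>2 * W z / \<Lambda>)" "continuous_on Q (\<lambda>z. - \<eta>\<^sup>2 * W z / \<Lambda>)"
      using \<Lambda> by (auto intro!: continuous_intros)
    show "((\<lambda>s. fx (s, y)) has_real_derivative - \<kappa>\<^sup>2 * W (x, y) / \<Lambda>) (at x within {0..L})" for x y
      unfolding fx_def W by (auto intro!: derivative_eq_intros DERIV_cdivide simp: algebra_simps power2_eq_square)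
    show "((\<lambda>s. fy (x, s)) has_real_derivative - \<eta>\<^sup>2 * W (x, y) / \<Lambda>) (at y within {0..H})" for x y
      unfolding fy_def W by (auto intro!: derivative_eq_intros DERIV_cdivide simp: algebra_simps power2_eq_square)
    show "fx (L, y) = fx (0, y)" for y by (simp add: fx_def kL)
    show "W z = - (- \<kappa>\<^sup>2 * W z / \<Lambda> + - \<eta>\<^sup>2 * W z / \<Lambda>)" for z
    proof -
      have "\<kappa>\<^sup>2 * W z / \<Lambda> + \<eta>\<^sup>2 * W z / \<Lambda> = \<Lambda> * W z / \<Lambda>"
        unfolding add_divide_distrib[symmetric] distrib_right[symmetric] \<Lambda>_def ..
      then show ?thesis using \<Lambda> by simp
    qed
  qed
  define X0 where "X0 = dirichlet fx fy"
  \<comment> \<open>At the wave the integral of the squared vorticity minus \<Lambda> times the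
    energy vanishes; this is the limit that \<open>kernel_approximation\<close> asks for.\<close>
  have X0: "\<Lambda> * X0 = J (\<lambda>z. (W z)\<^sup>2)"
  proof -
    have "X0 = J (\<lambda>z. f z * W z)"
      unfolding X0_def power2_eq_square by (rule weak_vorticityD[OF wf sf])
    also have "\<dots> = J (\<lambda>z. (1 / \<Lambda>) * (W z)\<^sup>2)" by (intro J_cong) (simp add: f_def power2_eq_square)
    finally show ?thesis using \<Lambda> by (simp only: J_cmult) simp
  qed
  define \<rho> where "\<rho> = (\<lambda>n z. w n 0 z - W z)"
  have c\<rho> [continuous_intros]: "continuous_on Q (\<rho> n)" for n unfolding \<rho>_def by (intro continuous_intros)
  have lim\<rho>: "(\<lambda>n. J (\<lambda>z. \<bar>\<rho> n z\<bar> powr p)) \<longlonglongrightarrow> 0" using lim by (simp add: \<rho>_def W_def)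
  have lim\<rho>1: "(\<lambda>n. J (\<lambda>z. \<bar>\<rho> n z\<bar>)) \<longlonglongrightarrow> 0" by (rule J_abs_tendsto_zero[OF p c\<rho> lim\<rho>])
  have pair_null: "(\<lambda>n. J (\<lambda>z. h z * \<rho> n z)) \<longlonglongrightarrow> 0"
    if h: "continuous_on Q h" and B: "\<And>z. z \<in> Q \<Longrightarrow> \<bar>h z\<bar> \<le> B" for h B
  proof (rule Lim_null_comparison[OF always_eventually tendsto_mult_right_zero[OF lim\<rho>1, of B]], rule allI)
    fix n
    have "\<bar>J (\<lambda>z. h z * \<rho> n z)\<bar> \<le> J (\<lambda>z. \<bar>h z * \<rho> n z\<bar>)" by (intro J_abs_le continuous_intros h)
    also have "\<dots> \<le> J (\<lambda>z. B * \<bar>\<rho> n z\<bar>)"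
      by (intro J_mono continuous_intros h) (use B in \<open>auto simp: abs_mult intro!: mult_right_mono\<close>)
    finally show "norm (J (\<lambda>z. h z * \<rho> n z)) \<le> B * J (\<lambda>z. \<bar>\<rho> n z\<bar>)" by (simp add: J_cmult)
  qed
  \<comment> \<open>Any bound of |W| serves as level of truncation; this one is read off from the
    amplitudes.\<close>
  define M where "M = \<bar>a\<bar> + \<bar>b\<bar>"
  have WM: "\<bar>W z\<bar> \<le> M" for z using abs_wave_le[of a b 0 z] by (simp add: W_def M_def)
  have M: "0 \<le> M" by (simp add: M_def)
  define E where "E = (\<lambda>n. dirichlet (\<Psi>x n 0) (\<Psi>y n 0))"
  have Elim: "E \<longlonglongrightarrow> X0"
  proof -
    define g gx gy where "g = (\<lambda>n z. \<Psi> n 0 z - f z)" and "gx = (\<lambda>n z. \<Psi>x n 0 z - fx z)"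
      and "gy = (\<lambda>n z. \<Psi>y n 0 z - fy z)"
    have sg: "stream_fun (g n) (gx n) (gy n)" for n
      unfolding g_def gx_def gy_def by (rule stream_fun_diff[OF stream sf])
    have wg: "weak_vorticity (gx n) (gy n) (\<rho> n)" for n
      unfolding gx_def gy_def \<rho>_def
      by (intro weak_vorticity_diff weak wf cw cW cf stream_funD(2,3)[OF stream])
    note cg = stream_funD(1-3)[OF sg]
    \<comment> \<open>The energy of the difference between flow and wave at time 0. It equals the
      pairing of the stream function of this difference with \<rho>, hence is at most sqrt \<theta>
      times its own square root, and so at most \<theta>. In this way the energy converges although
      \<rho> is small only in L^p.\<close>
    define Y where "Y = (\<lambda>n. dirichlet (gx n) (gy n))"
    have Y0: "0 \<le> Y n" for n unfolding Y_def by (intro J_nonneg continuous_intros cg) auto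
    have Yeq: "Y n = J (\<lambda>z. g n z * \<rho> n z)" for n
      unfolding Y_def power2_eq_square by (rule weak_vorticityD[OF wg sg])
    have "Y \<longlonglongrightarrow> 0"
    proof (rule tendsto_zero_if_eventually_le)
      fix \<theta> :: real assume \<theta>: "0 < \<theta>"
      then have "0 < sqrt \<theta>" by simp
      from pairing_small[OF p this] obtain \<delta> where \<delta>: "0 < \<delta>" and
        pair: "\<And>\<rho> \<psi> \<psi>x \<psi>y. continuous_on Q \<rho> \<Longrightarrow> stream_fun \<psi> \<psi>x \<psi>y \<Longrightarrow>
          J (\<lambda>z. \<bar>\<rho> z\<bar> powr p) < \<delta> \<Longrightarrow> J (\<lambda>z. \<bar>\<psi> z * \<rho> z\<bar>) \<le> sqrt \<theta> * sqrt (dirichlet \<psi>x \<psi>y)"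
        by blast
      from order_tendstoD(2)[OF lim\<rho> \<delta>]
      show "eventually (\<lambda>n. \<bar>Y n\<bar> \<le> \<theta>) sequentially"
      proof eventually_elim
        case (elim n)
        have "Y n \<le> J (\<lambda>z. \<bar>g n z * \<rho> n z\<bar>)"
          unfolding Yeq using J_abs_le[of "\<lambda>z. g n z * \<rho> n z"] by (simp add: continuous_intros cg)
        also have "\<dots> \<le> sqrt \<theta> * sqrt (Y n)" unfolding Y_def by (rule pair[OF c\<rho> sg elim])
        finally have le: "sqrt (Y n) * sqrt (Y n) \<le> sqrt \<theta> * sqrt (Y n)" using Y0[of n] by simp
        have "Y n \<le> \<theta>"
        proof (cases "Y n = 0")
          case False
          then have "0 < sqrt (Y n)" using Y0[of n] by simp
          from mult_right_le_imp_le[OF le this] show ?thesis by simp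
        qed (use \<theta> in simp)
        then show ?case using Y0[of n] by simp
      qed
    qed
    moreover have "(\<lambda>n. J (\<lambda>z. f z * \<rho> n z)) \<longlonglongrightarrow> 0"
    proof (rule pair_null)
      show "\<bar>f z\<bar> \<le> M / \<Lambda>" for z using WM[of z] \<Lambda> by (simp add: f_def divide_right_mono)
    qed (intro continuous_intros)
    ultimately have XY: "(\<lambda>n. X0 + 2 * J (\<lambda>z. f z * \<rho> n z) + Y n) \<longlonglongrightarrow> X0 + 2 * 0 + 0"
      by (intro tendsto_intros)
    have "E n = X0 + 2 * J (\<lambda>z. f z * \<rho> n z) + Y n" for n
    proof -
      have "J (\<lambda>z. f z * \<rho> n z) = J (\<lambda>z. fx z * gx n z + fy z * gy n z)"
        by (rule weak_vorticityD[OF wg sf, symmetric])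
      moreover have "E n = J (\<lambda>z. ((fx z)\<^sup>2 + (fy z)\<^sup>2 + 2 * (fx z * gx n z + fy z * gy n z)) + ((gx n z)\<^sup>2 + (gy n z)\<^sup>2))"
        unfolding E_def by (intro J_cong) (simp add: gx_def gy_def power2_eq_square algebra_simps)
      moreover have "\<dots> = X0 + 2 * J (\<lambda>z. fx z * gx n z + fy z * gy n z) + Y n"
        unfolding X0_def Y_def
        by (subst J_add, (intro continuous_intros cg)+, subst J_add, (intro continuous_intros cg)+, simp only: J_cmult)
      ultimately show ?thesis by simp
    qed
    then have "E = (\<lambda>n. X0 + 2 * J (\<lambda>z. f z * \<rho> n z) + Y n)" by (rule ext)
    then show ?thesis using XY by simp
  qed
  \<comment> \<open>As \<open>W\<close> takes values in \<open>[- M, M]\<close>, both \<open>T s\<close> and the excess \<open>s - T s\<close> are controlled by the distance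
    of \<open>s\<close> to a value of \<open>W\<close>, and their integrals are conserved.\<close>
  define T where "T = (\<lambda>s. max (- M) (min M s))"
  have cT: "continuous_on UNIV T" unfolding T_def by (intro continuous_intros)
  have cTw [continuous_intros]: "continuous_on Q (\<lambda>z. T (u z))" if "continuous_on Q u" for u
    by (rule continuous_on_compose2[OF cT that]) auto
  have TM: "\<bar>T s\<bar> \<le> M" for s using M by (auto simp: T_def)
  have T1: "\<bar>T s - m\<bar> \<le> \<bar>s - m\<bar>" and T2: "\<bar>s - T s\<bar> \<le> \<bar>s - m\<bar>" if "\<bar>m\<bar> \<le> M" for s m
    using that by (auto simp: T_def max_def min_def)
  define g where "g = (\<lambda>n z. T (w n (\<tau> n) z))"
  define r where "r = (\<lambda>n z. w n (\<tau> n) z - T (w n (\<tau> n) z))"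
  have cg [continuous_intros]: "continuous_on Q (g n)" and cr [continuous_intros]: "continuous_on Q (r n)" for n
    unfolding g_def r_def by (intro continuous_intros)+
  have gr: "g n z + r n z = w n (\<tau> n) z" for n z by (simp add: g_def r_def)
  note casimir = casimirs_from_moments[OF cw cw moments]
  have limr: "(\<lambda>n. J (\<lambda>z. \<bar>r n z\<bar> powr p)) \<longlonglongrightarrow> 0"
  proof (rule tendsto_zero_squeeze[OF _ _ lim\<rho>])
    show "0 \<le> J (\<lambda>z. \<bar>r n z\<bar> powr p)" for n
      by (auto intro!: J_nonneg cp cr)
    show "J (\<lambda>z. \<bar>r n z\<bar> powr p) \<le> J (\<lambda>z. \<bar>\<rho> n z\<bar> powr p)" for n
    proof -
      have "continuous_on UNIV (\<lambda>s. \<bar>s - T s\<bar> powr p)"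
        using p by (intro continuous_on_powr' continuous_intros cT) auto
      from casimir[OF this] have "J (\<lambda>z. \<bar>r n z\<bar> powr p) = J (\<lambda>z. \<bar>w n 0 z - T (w n 0 z)\<bar> powr p)"
        unfolding r_def .
      also have "\<dots> \<le> J (\<lambda>z. \<bar>\<rho> n z\<bar> powr p)"
        unfolding \<rho>_def using T2[OF WM] p by (intro J_mono cp powr_mono2 continuous_intros) auto
      finally show ?thesis .
    qed
  qed
  have limr1: "(\<lambda>n. J (\<lambda>z. \<bar>r n z\<bar>)) \<longlonglongrightarrow> 0" by (rule J_abs_tendsto_zero[OF p cr limr])
  have limg: "(\<lambda>n. J (\<lambda>z. (g n z) ^ k)) \<longlonglongrightarrow> J (\<lambda>z. (W z) ^ k)" for k
  proof -
    have "(\<lambda>n. J (\<lambda>z. \<bar>T (w n 0 z) - W z\<bar>)) \<longlonglongrightarrow> 0"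
    proof (rule tendsto_zero_squeeze[OF _ _ lim\<rho>1])
      show "0 \<le> J (\<lambda>z. \<bar>T (w n 0 z) - W z\<bar>)" for n
        by (auto intro!: J_nonneg continuous_intros)
      show "J (\<lambda>z. \<bar>T (w n 0 z) - W z\<bar>) \<le> J (\<lambda>z. \<bar>\<rho> n z\<bar>)" for n
        by (intro J_mono continuous_intros) (simp add: \<rho>_def T1[OF WM])
    qed
    from J_power_diff_tendsto_zero[OF _ _ TM WM this, of k]
    have "(\<lambda>n. J (\<lambda>z. (T (w n 0 z)) ^ k) - J (\<lambda>z. (W z) ^ k)) \<longlonglongrightarrow> 0"
      by (simp add: continuous_intros)
    moreover have "J (\<lambda>z. (g n z) ^ k) = J (\<lambda>z. (T (w n 0 z)) ^ k)" for n
      unfolding g_def by (rule casimir) (intro continuous_intros cT)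
    ultimately show ?thesis by (simp add: LIM_zero_iff)
  qed
  obtain K where "\<forall>n. norm (E n) \<le> K"
    using convergent_imp_Bseq[OF convergentI[OF Elim]] unfolding Bseq_def by blast
  then have K: "E n \<le> K" for n by (simp add: abs_le_iff)
  have Et: "dirichlet (\<Psi>x n (\<tau> n)) (\<Psi>y n (\<tau> n)) = E n" for n
    unfolding E_def by (rule energy)
  have limw: "(\<lambda>n. J (w n 0)) \<longlonglongrightarrow> 0"
  proof -
    have "(\<lambda>n. J (\<lambda>z. 1 * \<rho> n z)) \<longlonglongrightarrow> 0" by (rule pair_null[of _ 1]) (auto intro: continuous_intros)
    moreover have "J (\<lambda>z. 1 * \<rho> n z) = J (w n 0)" for n
    proof -
      have "J (\<lambda>z. w n 0 z - W z) = J (w n 0) - J W" by (intro J_diff cw cW)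
      then show ?thesis using wave_mean[of a b 0] by (simp add: \<rho>_def W_def)
    qed
    ultimately show ?thesis by simp
  qed
  have limyw: "(\<lambda>n. J (\<lambda>z. snd z * w n 0 z)) \<longlonglongrightarrow> 0"
  proof -
    have "(\<lambda>n. J (\<lambda>z. snd z * \<rho> n z)) \<longlonglongrightarrow> 0" by (rule pair_null[of _ H]) (auto intro: continuous_intros)
    moreover have "J (\<lambda>z. snd z * \<rho> n z) = J (\<lambda>z. snd z * w n 0 z)" for n
    proof -
      have "J (\<lambda>z. snd z * \<rho> n z) = J (\<lambda>z. snd z * w n 0 z - snd z * W z)"
        by (intro J_cong) (simp add: \<rho>_def algebra_simps)
      also have "\<dots> = J (\<lambda>z. snd z * w n 0 z) - J (\<lambda>z. snd z * W z)" by (intro J_diff continuous_intros)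
      also have "J (\<lambda>z. snd z * W z) = 0" using wave_impulse[of a b 0 0] by (simp add: W_def)
      finally show ?thesis by simp
    qed
    ultimately show ?thesis by simp
  qed
  obtain a1 b1 c1 d1 where
    ker: "(\<lambda>n. J (\<lambda>z. (g n z - (wave (a1 n) (b1 n) (c1 n) z + d1 n * sin (2 * pi / H * snd z)))\<^sup>2)) \<longlonglongrightarrow> 0"
  proof -
    have "\<exists>a b c d. (\<lambda>n. J (\<lambda>z. (g n z - (wave (a n) (b n) (c n) z + d n * sin (2 * pi / H * snd z)))\<^sup>2)) \<longlonglongrightarrow> 0"
    proof (rule kernel_approximation[OF spectral p stream cg cr])
      show "dirichlet (\<Psi>x n (\<tau> n)) (\<Psi>y n (\<tau> n)) \<le> K" for n unfolding Et by (rule K)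
      show "dirichlet (\<Psi>x n (\<tau> n)) (\<Psi>y n (\<tau> n)) = J (\<lambda>z. \<Psi> n (\<tau> n) z * (g n z + r n z))" for n
        unfolding gr power2_eq_square by (rule weak_vorticityD[OF weak stream])
      have "(\<lambda>n. J (\<lambda>z. (g n z)\<^sup>2) - \<Lambda> * E n) \<longlonglongrightarrow> J (\<lambda>z. (W z)\<^sup>2) - \<Lambda> * X0"
        by (intro tendsto_intros limg Elim)
      then show "(\<lambda>n. J (\<lambda>z. (g n z)\<^sup>2) - ((2 * pi / L)\<^sup>2 + (pi / H)\<^sup>2) * dirichlet (\<Psi>x n (\<tau> n)) (\<Psi>y n (\<tau> n))) \<longlonglongrightarrow> 0"
        unfolding X0 Et \<Lambda>_def[symmetric] \<kappa>_def[symmetric] \<eta>_def[symmetric] by simp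
      have "J (\<lambda>z. g n z + r n z) = J (w n 0)" for n unfolding gr using moments[of n "\<tau> n" 1] by simp
      then show "(\<lambda>n. J (\<lambda>z. g n z + r n z)) \<longlonglongrightarrow> 0" using limw by simp
    qed (rule limr)
    then show ?thesis using that by blast
  qed
  have imp: "(\<lambda>n. J (\<lambda>z. snd z * g n z)) \<longlonglongrightarrow> 0"
  proof -
    have "(\<lambda>n. J (\<lambda>z. snd z * r n z)) \<longlonglongrightarrow> 0"
    proof (rule Lim_null_comparison[OF always_eventually tendsto_mult_right_zero[OF limr1, of H]], rule allI)
      fix n
      have "\<bar>J (\<lambda>z. snd z * r n z)\<bar> \<le> J (\<lambda>z. \<bar>snd z * r n z\<bar>)" by (intro J_abs_le continuous_intros)
      also have "\<dots> \<le> J (\<lambda>z. H * \<bar>r n z\<bar>)"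
        by (intro J_mono continuous_intros) (auto simp: abs_mult intro!: mult_right_mono)
      finally show "norm (J (\<lambda>z. snd z * r n z)) \<le> H * J (\<lambda>z. \<bar>r n z\<bar>)" by (simp add: J_cmult)
    qed
    from tendsto_diff[OF limyw this]
    have "(\<lambda>n. J (\<lambda>z. snd z * w n 0 z) - J (\<lambda>z. snd z * r n z)) \<longlonglongrightarrow> 0" by simp
    moreover have "J (\<lambda>z. snd z * w n 0 z) - J (\<lambda>z. snd z * r n z) = J (\<lambda>z. snd z * g n z)" for n
    proof -
      have "J (\<lambda>z. snd z * g n z) = J (\<lambda>z. snd z * w n (\<tau> n) z - snd z * r n z)"
        by (intro J_cong) (simp add: r_def g_def algebra_simps)
      also have "\<dots> = J (\<lambda>z. snd z * w n (\<tau> n) z) - J (\<lambda>z. snd z * r n z)" by (intro J_diff continuous_intros)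
      finally show ?thesis using impulse[of n "\<tau> n"] by simp
    qed
    ultimately show ?thesis by simp
  qed
  \<comment> \<open>The second, third and fourth moments of a wave depend only on a^2 + b^2, so the
    phase may be turned to (A, 0).\<close>
  define A where "A = sqrt (a\<^sup>2 + b\<^sup>2)"
  have A: "0 \<le> A" "A\<^sup>2 = a\<^sup>2 + b\<^sup>2" by (auto simp: A_def)
  have momA: "J (\<lambda>z. (wave A 0 0 z) ^ k) = J (\<lambda>z. (W z) ^ k)" if "k \<in> {2, 3, 4}" for k
    using that by (auto simp: W_def wave_moments A)
  have limA: "(\<lambda>n. J (\<lambda>z. (g n z) ^ k)) \<longlonglongrightarrow> J (\<lambda>z. (wave A 0 0 z) ^ k)" if "k \<in> {2, 3, 4}" for k
    unfolding momA[OF that] by (rule limg)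
  have gM: "\<bar>g n z\<bar> \<le> M" for n z unfolding g_def by (rule TM)
  obtain a' b' where circ: "\<And>n. (a' n)\<^sup>2 + (b' n)\<^sup>2 = A\<^sup>2"
    and L2: "(\<lambda>n. J (\<lambda>z. (g n z - wave (a' n) (b' n) 0 z)\<^sup>2)) \<longlonglongrightarrow> 0"
    using orbit_approximation[OF cg gM A(1) ker imp limA] by blast
  \<comment> \<open>\<open>M\<close> bounds the truncated vorticity and 2 A the waves on the circle;
    the sum is a common bound for both.\<close>
  have bw: "\<bar>wave (a' n) (b' n) 0 z\<bar> \<le> M + 2 * A" for n z
  proof -
    have "(a' n)\<^sup>2 \<le> A\<^sup>2" "(b' n)\<^sup>2 \<le> A\<^sup>2"
      using circ[of n] zero_le_power2[of "a' n"] zero_le_power2[of "b' n"] by linarith+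
    then have "\<bar>a' n\<bar> \<le> A" "\<bar>b' n\<bar> \<le> A"
      using A(1) by (simp_all add: abs_le_square_iff[symmetric])
    then show ?thesis using abs_wave_le[of "a' n" "b' n" 0 z] M by simp
  qed
  have bg: "\<bar>g n z\<bar> \<le> M + 2 * A" for n z using gM[of n z] A(1) by simp
  have "(\<lambda>n. J (\<lambda>z. \<bar>g n z + r n z - wave (a' n) (b' n) 0 z\<bar> powr p)) \<longlonglongrightarrow> 0"
    by (rule Lp_tendsto_zero[OF p cg cr _ bg bw L2 limr]) (intro continuous_intros)
  then show ?thesis using circ unfolding gr A(2) by blast
qed

end

section \<open>The argument by contradiction\<close>

lemma not_stableD:
  assumes "\<not> (\<forall>\<epsilon>>(0::real). \<exists>\<delta>>(0::real). \<forall>v P. E v P \<longrightarrow> N v \<delta> \<longrightarrow> (\<forall>t. G v t \<epsilon>))"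
  shows "\<exists>\<epsilon>>0. \<forall>\<delta>>0. \<exists>v P t. E v P \<and> N v \<delta> \<and> \<not> G v t \<epsilon>"
  using assms by metis

theorem corollary1p9:
  fixes L H p a b c d :: real
  assumes "L > 0" and "H > 0" and "1 < p"
    and "H / L \<le> sqrt 3 / 2"
  shows "\<forall>\<epsilon>>0. \<exists>\<delta>>0. \<forall>v P. euler_flow L H v P \<longrightarrow>
           Lp_norm L H p (\<lambda>x. vorticity (v 0) x - omega_bar L H a b c d x) < \<delta> \<longrightarrow>
           (\<forall>t. \<exists>w. is_arg_min (\<lambda>u. Lp_norm L H p (\<lambda>x. vorticity (v t) x - u x))
                       (\<lambda>u. u \<in> orbit (omega_bar L H a b c d)) w \<and>
                     Lp_norm L H p (\<lambda>x. vorticity (v t) x - w x) < \<epsilon>)"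
proof (rule ccontr)
  interpret periodic_cell L H by unfold_locales (use assms in auto)
  have p0: "0 < p" using assms(3) by simp
  have spectral: "(2 * pi / L)\<^sup>2 + (pi / H)\<^sup>2 \<le> (2 * pi / H)\<^sup>2"
  proof -
    \<comment> \<open>The squared assumption is 4 / L^2 \<le> 3 / H^2. Adding 1 / H^2 and
      multiplying by pi^2 turns it into the comparison of eigenvalues.\<close>
    have "(H / L)\<^sup>2 \<le> (sqrt 3 / 2)\<^sup>2" using assms by (intro power_mono) auto
    then have "4 * H\<^sup>2 \<le> 3 * L\<^sup>2" using assms(1) by (simp add: power_divide field_simps)
    then have "4 / L\<^sup>2 \<le> 3 / H\<^sup>2" using assms(1,2) by (simp add: field_simps)
    moreover have "4 / H\<^sup>2 = 3 / H\<^sup>2 + 1 / H\<^sup>2" by (simp add: add_divide_distrib[symmetric])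
    ultimately have "pi\<^sup>2 * (4 / L\<^sup>2 + 1 / H\<^sup>2) \<le> pi\<^sup>2 * (4 / H\<^sup>2)"
      by (intro mult_left_mono) auto
    moreover have "(2 * pi / L)\<^sup>2 + (pi / H)\<^sup>2 = pi\<^sup>2 * (4 / L\<^sup>2 + 1 / H\<^sup>2)" "(2 * pi / H)\<^sup>2 = pi\<^sup>2 * (4 / H\<^sup>2)"
      by (simp_all add: power_divide power_mult_distrib distrib_left)
    ultimately show ?thesis by simp
  qed
  define A B where "A = ((2 * pi / L)\<^sup>2 + (pi / H)\<^sup>2) * a" and "B = ((2 * pi / L)\<^sup>2 + (pi / H)\<^sup>2) * b"
  have wbar: "omega_bar L H a b c d = wave A B 0" unfolding A_def B_def by (rule omega_bar_wave)
  define good where "good = (\<lambda>(v :: real \<Rightarrow> real \<times> real \<Rightarrow> real \<times> real) t \<epsilon>. \<exists>w. is_arg_min (\<lambda>u. Lp_norm L H p (\<lambda>x. vorticity (v t) x - u x))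
                       (\<lambda>u. u \<in> orbit (wave A B 0)) w \<and> Lp_norm L H p (\<lambda>x. vorticity (v t) x - w x) < \<epsilon>)"
  define near where "near = (\<lambda>(v :: real \<Rightarrow> real \<times> real \<Rightarrow> real \<times> real) \<delta>. Lp_norm L H p (\<lambda>x. vorticity (v 0) x - wave A B 0 x) < \<delta>)"
  assume "\<not> ?thesis"
  then have "\<not> (\<forall>\<epsilon>>0. \<exists>\<delta>>0. \<forall>v P. euler_flow L H v P \<longrightarrow> near v \<delta> \<longrightarrow> (\<forall>t. good v t \<epsilon>))"
    unfolding wbar good_def near_def .
  then have "\<exists>\<epsilon>>0. \<forall>\<delta>>0. \<exists>v P t. euler_flow L H v P \<and> near v \<delta> \<and> \<not> good v t \<epsilon>"
    by (rule not_stableD)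
  then obtain \<epsilon> where \<epsilon>: "0 < \<epsilon>" and bad: "\<forall>\<delta>>0. \<exists>v P t. euler_flow L H v P \<and> near v \<delta> \<and> \<not> good v t \<epsilon>"
    by blast
  \<comment> \<open>The choice \<delta> = 1 / (n + 1) yields initial vorticities converging to the
    wave, together with times at which the claim fails.\<close>
  have "\<forall>n. \<exists>v P t. euler_flow L H v P \<and> near v (1 / real (Suc n)) \<and> \<not> good v t \<epsilon>"
    by (intro allI bad[rule_format]) simp
  then obtain v P \<tau> where euler: "\<And>n. euler_flow L H (v n) (P n)"
    and init: "\<And>n. near (v n) (1 / real (Suc n))"
    and ngood: "\<And>n. \<not> good (v n) (\<tau> n) \<epsilon>"
    by metis
  have "\<forall>n. \<exists>w \<Psi> \<Psi>x \<Psi>y. conserved_flow (v n) w \<Psi> \<Psi>x \<Psi>y"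
    using euler_flow_conservation[OF euler] ..
  then obtain w \<Psi> \<Psi>x \<Psi>y where flow: "\<And>n. conserved_flow (v n) (w n) (\<Psi> n) (\<Psi>x n) (\<Psi>y n)"
    by metis
  have cw: "\<And>n t. continuous_on Q (w n t)"
    and vort: "\<And>n t x y. 0 < y \<Longrightarrow> y < H \<Longrightarrow> w n t (x, y) = vorticity (v n t) (x, y)"
    and moments: "\<And>n t k. J (\<lambda>z. (w n t z) ^ k) = J (\<lambda>z. (w n 0 z) ^ k)"
    and impulse: "\<And>n t. J (\<lambda>z. snd z * w n t z) = J (\<lambda>z. snd z * w n 0 z)"
    and stream: "\<And>n t. stream_fun (\<Psi> n t) (\<Psi>x n t) (\<Psi>y n t)"
    and weak: "\<And>n t. weak_vorticity (\<Psi>x n t) (\<Psi>y n t) (w n t)"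
    and energy: "\<And>n t. dirichlet (\<Psi>x n t) (\<Psi>y n t) = dirichlet (\<Psi>x n 0) (\<Psi>y n 0)"
    using flow unfolding conserved_flow_def by blast+
  have norm: "Lp_norm L H p (\<lambda>x. vorticity (v n t) x - wave a b 0 x) = J (\<lambda>z. \<bar>w n t z - wave a b 0 z\<bar> powr p) powr (1 / p)" for n t a b
    by (rule Lp_norm_eq[OF p0]) (auto intro!: continuous_intros cw simp: vort)
  have nn: "0 \<le> J (\<lambda>z. \<bar>w n t z - wave a b 0 z\<bar> powr p)" for n t a b
    by (intro J_nonneg cont_powr[OF p0] continuous_intros cw) auto
  have "(\<lambda>n. J (\<lambda>z. \<bar>w n 0 z - wave A B 0 z\<bar> powr p)) \<longlonglongrightarrow> 0"
  proof (rule tendsto_zero_squeeze)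
    show "0 \<le> J (\<lambda>z. \<bar>w n 0 z - wave A B 0 z\<bar> powr p)" for n
      by (auto intro!: nn)
    have "(\<lambda>n. 1 / real (Suc n)) \<longlonglongrightarrow> 0" using LIMSEQ_inverse_real_of_nat by (simp add: inverse_eq_divide)
    from tendsto_powr'[OF this tendsto_const, of p] p0
    show "(\<lambda>n. (1 / real (Suc n)) powr p) \<longlonglongrightarrow> 0" by auto
    show "J (\<lambda>z. \<bar>w n 0 z - wave A B 0 z\<bar> powr p) \<le> (1 / real (Suc n)) powr p" for n
    proof -
      have "(J (\<lambda>z. \<bar>w n 0 z - wave A B 0 z\<bar> powr p) powr (1 / p)) powr p \<le> (1 / real (Suc n)) powr p"
        using init[of n] p0 unfolding near_def norm by (intro powr_mono2) auto
      then show ?thesis using nn[of n 0 A B] p0 by (simp add: powr_powr)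
    qed
  qed
  from orbital_stability_sequence[where w = w and \<Psi> = \<Psi> and \<Psi>x = \<Psi>x and \<Psi>y = \<Psi>y and \<tau> = \<tau>,
      OF spectral assms(3) cw moments impulse stream weak energy this]
  obtain a' b' where circ: "\<And>n. (a' n)\<^sup>2 + (b' n)\<^sup>2 = A\<^sup>2 + B\<^sup>2"
    and lim: "(\<lambda>n. J (\<lambda>z. \<bar>w n (\<tau> n) z - wave (a' n) (b' n) 0 z\<bar> powr p)) \<longlonglongrightarrow> 0" by blast
  have "0 < \<epsilon> powr p" using \<epsilon> by simp
  from eventually_happens'[OF sequentially_bot order_tendstoD(2)[OF lim this]]
  obtain n where n: "J (\<lambda>z. \<bar>w n (\<tau> n) z - wave (a' n) (b' n) 0 z\<bar> powr p) < \<epsilon> powr p" by blast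
  have "Lp_norm L H p (\<lambda>x. vorticity (v n (\<tau> n)) x - wave (a' n) (b' n) 0 x) < (\<epsilon> powr p) powr (1 / p)"
    unfolding norm using n nn p0 by (intro powr_less_mono2) auto
  then have close: "Lp_norm L H p (\<lambda>x. vorticity (v n (\<tau> n)) x - wave (a' n) (b' n) 0 x) < \<epsilon>"
    using \<epsilon> p0 by (simp add: powr_powr)
  \<comment> \<open>The minimum is attained in any case, so failure of the claim can only mean that
    it is at least \<epsilon>; the orbit point found above is closer than that.\<close>
  obtain u where u: "is_arg_min (\<lambda>u. Lp_norm L H p (\<lambda>x. vorticity (v n (\<tau> n)) x - u x)) (\<lambda>u. u \<in> orbit (wave A B 0)) u"
    using orbit_minimizer[where f = "w n (\<tau> n)" and g = "vorticity (v n (\<tau> n))" and a = A and b = B,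
        OF p0 cw vort[symmetric]] by (rule exE)
  have "wave (a' n) (b' n) 0 \<in> orbit (wave A B 0)" unfolding orbit_wave using circ by blast
  then have "Lp_norm L H p (\<lambda>x. vorticity (v n (\<tau> n)) x - u x) < \<epsilon>"
    using u close unfolding is_arg_min_def by (metis le_less_trans not_le_imp_less)
  then show False using ngood[of n] u unfolding good_def by blast
qed

end
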